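(* Let $(X,\omega_1,\dots,\omega_s)$ be a smooth polysymplectic manifold of dimension $n(s+1)$ and let $p\in X$. Assume given elements $\phi_1,\dots,\phi_n$ and $\psi^i_j$ ($i=1,\dots,n$, $j=1,\dots,s$) of $T^*_pX$ such that for all $j=1,\dots,s$ one has $(\omega_j)_p=\sum_i\phi_i\wedge\psi^i_j$. Then there are a neighborhood $\mathcal{U}\subset X$ of $p$, a neighborhood $\mathcal{V}\subset\mathbb{R}^{\dim X}$ of $0$ and an isomorphism of polysymplectic manifolds $$\phi:(\mathcal{U},\omega_1,\dots,\omega_s)\to\Big(\mathcal{V},\sum_idx_i\wedge dy_i^1,\dots,\sum_idx_i\wedge dy_i^s\Big),$$ where the coordinates on $\mathbb{R}^{\dim X}$ are denoted $x_1,\dots,x_n,y^1_1,\dots,y^s_n$. With this notation (regarding $x_i,y_i^j$ as coordinates on $\mathcal{U}$ via $\phi$), one can also assume $(dx_i)_p=\phi_i$ and $(dy_i^j)_p=\psi^i_j$ for all $i,j$.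
   Context: For a $2$-form $\alpha$, $\alpha^\perp$ denotes the distribution of vectors $v$ with $\iota_v\alpha=0$. A polysymplectic structure on a vector space $V$ of dimension $n(s+1)$ is given by $\omega_1,\dots,\omega_s\in\Lambda^2V^*$ for which there is a basis $v_1,\dots,v_n,w^1_1,\dots,w^s_n$ of $V$ with $\omega_j=\sum_{i=1}^n v_i^*\wedge (w_i^j)^*$ for all $j$. A polysymplectic manifold is a smooth manifold of dimension $n(s+1)$ with smooth closed $2$-forms $\omega_1,\dots,\omega_s$ inducing a polysymplectic structure on each tangent space and such that $\sum_j\omega_j^\perp$ is an integrable distribution. An isomorphism of polysymplectic manifolds is a diffeomorphism matching the respective $j$-th forms for all $j$. *)

theory Defs
  imports "HOL-Analysis.Analysis"
begin

section \<open>Smooth maps between Euclidean spaces\<close>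

text \<open>Only used for open sets \<open>S\<close>.\<close>

fun Ck_on :: "nat \<Rightarrow> 'a::euclidean_space set \<Rightarrow> ('a \<Rightarrow> 'b::real_normed_vector) \<Rightarrow> bool" where
  "Ck_on 0 S f \<longleftrightarrow> continuous_on S f"
| "Ck_on (Suc k) S f \<longleftrightarrow>
     (\<forall>x\<in>S. f differentiable (at x)) \<and>
     (\<forall>v. Ck_on k S (\<lambda>x. frechet_derivative f (at x) v))"

definition smooth_on :: "'a::euclidean_space set \<Rightarrow> ('a \<Rightarrow> 'b::real_normed_vector) \<Rightarrow> bool" where
  "smooth_on S f \<longleftrightarrow> (\<forall>k. Ck_on k S f)"


section \<open>Smooth manifolds\<close>

text \<open>
  A chart is a pair of its domain and its coordinate map; the latter is only meaningful on the
  domain. The atlas is not required to be maximal: all notions below depend only on the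
  smooth structure it generates.
\<close>

type_synonym ('a, 'e) chart = "'a set \<times> ('a \<Rightarrow> 'e)"

record ('a, 'e) manifold =
  mspace :: "'a topology"
  atlas :: "('a, 'e) chart set"

definition chart_inv :: "('a, 'e) chart \<Rightarrow> 'e \<Rightarrow> 'a" where
  "chart_inv k = inv_into (fst k) (snd k)"

definition chart_range :: "('a, 'e) chart \<Rightarrow> 'e set" where
  "chart_range k = snd k ` fst k"

definition transition :: "('a, 'e) chart \<Rightarrow> ('a, 'e) chart \<Rightarrow> 'e \<Rightarrow> 'e" where
  "transition k l = snd l \<circ> chart_inv k"

definition smooth_manifold :: "('a, 'e::euclidean_space) manifold \<Rightarrow> bool" where
  "smooth_manifold M \<longleftrightarrow>
     Hausdorff_space (mspace M) \<and> second_countable (mspace M) \<and>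
     topspace (mspace M) = (\<Union>k\<in>atlas M. fst k) \<and>
     (\<forall>k\<in>atlas M. openin (mspace M) (fst k) \<and> open (chart_range k) \<and>
        homeomorphic_map (subtopology (mspace M) (fst k)) (top_of_set (chart_range k)) (snd k)) \<and>
     (\<forall>k\<in>atlas M. \<forall>l\<in>atlas M. smooth_on (snd k ` (fst k \<inter> fst l)) (transition k l))"

definition charts_at :: "('a, 'e) manifold \<Rightarrow> 'a \<Rightarrow> ('a, 'e) chart set" where
  "charts_at M p = {k \<in> atlas M. p \<in> fst k}"

definition chart_at :: "('a, 'e) manifold \<Rightarrow> 'a \<Rightarrow> ('a, 'e) chart" where
  "chart_at M p = (SOME k. k \<in> charts_at M p)"

definition euclidean_manifold :: "('e::euclidean_space, 'e) manifold" where
  "euclidean_manifold = \<lparr>mspace = euclidean, atlas = {(UNIV, \<lambda>x. x)}\<rparr>"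

definition smooth_map_on ::
  "('a, 'e::euclidean_space) manifold \<Rightarrow> 'a set \<Rightarrow> ('b, 'f::euclidean_space) manifold \<Rightarrow> ('a \<Rightarrow> 'b) \<Rightarrow> bool" where
  "smooth_map_on M U N F \<longleftrightarrow>
     continuous_map (subtopology (mspace M) U) (mspace N) F \<and>
     (\<forall>k\<in>atlas M. \<forall>l\<in>atlas N.
        smooth_on (snd k ` {q \<in> fst k \<inter> U. F q \<in> fst l}) (snd l \<circ> F \<circ> chart_inv k))"

definition diffeo_between ::
  "('a, 'e::euclidean_space) manifold \<Rightarrow> 'a set \<Rightarrow> ('b, 'f::euclidean_space) manifold \<Rightarrow> 'b set \<Rightarrow> ('a \<Rightarrow> 'b) \<Rightarrow> bool" where
  "diffeo_between M U N V F \<longleftrightarrow>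
     openin (mspace M) U \<and> openin (mspace N) V \<and> bij_betw F U V \<and>
     smooth_map_on M U N F \<and> smooth_map_on N V M (inv_into U F)"


section \<open>Tangent vectors\<close>

text \<open>
  A tangent vector at \<open>p\<close> is an equivalence class of pairs \<open>(k, u)\<close> of a chart \<open>k\<close> around \<open>p\<close> and a
  coordinate vector \<open>u\<close>, where \<open>(k, u)\<close> and \<open>(l, D(l \<circ> k\<^sup>-\<^sup>1) u)\<close> are identified. Every class
  contains exactly one pair for each chart around \<open>p\<close>, so it is encoded as the function \<open>k \<mapsto> u\<close>
  (with value \<open>0\<close> on everything that is not a chart around \<open>p\<close>). The type below only serves to
  provide the pointwise vector space structure; the tangent spaces are subspaces of it.
\<close>

typedef ('a, 'e) tvec = "UNIV :: (('a, 'e) chart \<Rightarrow> 'e) set"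
  morphisms coord Tvec ..

instantiation tvec :: (type, real_vector) real_vector
begin

definition zero_tvec :: "('a, 'b) tvec" where
  "zero_tvec = Tvec (\<lambda>k. 0)"
definition plus_tvec :: "('a, 'b) tvec \<Rightarrow> ('a, 'b) tvec \<Rightarrow> ('a, 'b) tvec" where
  "plus_tvec v w = Tvec (\<lambda>k. coord v k + coord w k)"
definition minus_tvec :: "('a, 'b) tvec \<Rightarrow> ('a, 'b) tvec \<Rightarrow> ('a, 'b) tvec" where
  "minus_tvec v w = Tvec (\<lambda>k. coord v k - coord w k)"
definition uminus_tvec :: "('a, 'b) tvec \<Rightarrow> ('a, 'b) tvec" where
  "uminus_tvec v = Tvec (\<lambda>k. - coord v k)"
definition scaleR_tvec :: "real \<Rightarrow> ('a, 'b) tvec \<Rightarrow> ('a, 'b) tvec" where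
  "scaleR_tvec c v = Tvec (\<lambda>k. c *\<^sub>R coord v k)"

instance
  by standard
    (simp_all add: zero_tvec_def plus_tvec_def minus_tvec_def uminus_tvec_def scaleR_tvec_def
      Tvec_inverse coord_inverse algebra_simps)

end

definition tangent_space ::
  "('a, 'e::euclidean_space) manifold \<Rightarrow> 'a \<Rightarrow> ('a, 'e) tvec set" where
  "tangent_space M p = {v.
     (\<forall>k. k \<notin> charts_at M p \<longrightarrow> coord v k = 0) \<and>
     (\<forall>k\<in>charts_at M p. \<forall>l\<in>charts_at M p.
        coord v l = frechet_derivative (transition k l) (at (snd k p)) (coord v k))}"

text \<open>The tangent vector at \<open>p\<close> that is represented by \<open>u\<close> in the chart \<open>k\<close>.\<close>

definition tangent_of ::
  "('a, 'e::euclidean_space) manifold \<Rightarrow> 'a \<Rightarrow> ('a, 'e) chart \<Rightarrow> 'e \<Rightarrow> ('a, 'e) tvec" where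
  "tangent_of M p k u = Tvec (\<lambda>l. if l \<in> charts_at M p
     then frechet_derivative (transition k l) (at (snd k p)) u else 0)"

text \<open>
  The differential of a map into a normed space \<open>'b\<close>, with the tangent spaces of \<open>'b\<close> identified
  with \<open>'b\<close>; and the tangent map between manifolds. On tangent vectors, neither depends on the
  chart that is chosen at \<open>p\<close>.
\<close>

definition differential ::
  "('a, 'e::euclidean_space) manifold \<Rightarrow> ('a \<Rightarrow> 'b::real_normed_vector) \<Rightarrow> 'a \<Rightarrow> ('a, 'e) tvec \<Rightarrow> 'b" where
  "differential M f p v =
     (let k = chart_at M p
      in frechet_derivative (f \<circ> chart_inv k) (at (snd k p)) (coord v k))"

definition tangent_map ::
  "('a, 'e::euclidean_space) manifold \<Rightarrow> ('b, 'f::euclidean_space) manifold \<Rightarrow> ('a \<Rightarrow> 'b) \<Rightarrow>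
    'a \<Rightarrow> ('a, 'e) tvec \<Rightarrow> ('b, 'f) tvec" where
  "tangent_map M N F p v =
     Tvec (\<lambda>l. if l \<in> charts_at N (F p) then differential M (snd l \<circ> F) p v else 0)"


section \<open>Exterior forms\<close>

text \<open>Forms on a subspace \<open>S\<close> are functions of which only the values on \<open>S\<close> matter.\<close>

definition linear_form_on :: "'v::real_vector set \<Rightarrow> ('v \<Rightarrow> real) \<Rightarrow> bool" where
  "linear_form_on S \<alpha> \<longleftrightarrow>
     (\<forall>u\<in>S. \<forall>v\<in>S. \<alpha> (u + v) = \<alpha> u + \<alpha> v) \<and> (\<forall>c. \<forall>u\<in>S. \<alpha> (c *\<^sub>R u) = c * \<alpha> u)"

definition alternating_2form_on :: "'v::real_vector set \<Rightarrow> ('v \<Rightarrow> 'v \<Rightarrow> real) \<Rightarrow> bool" where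
  "alternating_2form_on S \<omega> \<longleftrightarrow>
     (\<forall>u\<in>S. linear_form_on S (\<lambda>v. \<omega> u v) \<and> linear_form_on S (\<lambda>v. \<omega> v u) \<and> \<omega> u u = 0)"

definition wedge :: "('v \<Rightarrow> real) \<Rightarrow> ('v \<Rightarrow> real) \<Rightarrow> 'v \<Rightarrow> 'v \<Rightarrow> real" where
  "wedge \<alpha> \<beta> u v = \<alpha> u * \<beta> v - \<alpha> v * \<beta> u"

definition perp_on :: "'v set \<Rightarrow> ('v \<Rightarrow> 'v \<Rightarrow> real) \<Rightarrow> 'v set" where
  "perp_on S \<omega> = {v \<in> S. \<forall>u\<in>S. \<omega> v u = 0}"

definition cotangent_space ::
  "('a, 'e::euclidean_space) manifold \<Rightarrow> 'a \<Rightarrow> (('a, 'e) tvec \<Rightarrow> real) set" where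
  "cotangent_space M p = {\<alpha>. linear_form_on (tangent_space M p) \<alpha>}"

type_synonym ('a, 'e) form2 = "'a \<Rightarrow> ('a, 'e) tvec \<Rightarrow> ('a, 'e) tvec \<Rightarrow> real"

definition local_form ::
  "('a, 'e::euclidean_space) manifold \<Rightarrow> ('a, 'e) form2 \<Rightarrow> ('a, 'e) chart \<Rightarrow> 'e \<Rightarrow> 'e \<Rightarrow> 'e \<Rightarrow> real" where
  "local_form M \<omega> k x u v =
     (let p = chart_inv k x in \<omega> p (tangent_of M p k u) (tangent_of M p k v))"

definition smooth_2form ::
  "('a, 'e::euclidean_space) manifold \<Rightarrow> ('a, 'e) form2 \<Rightarrow> bool" where
  "smooth_2form M \<omega> \<longleftrightarrow>
     (\<forall>p\<in>topspace (mspace M). alternating_2form_on (tangent_space M p) (\<omega> p)) \<and>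
     (\<forall>k\<in>atlas M. \<forall>u v. smooth_on (chart_range k) (\<lambda>x. local_form M \<omega> k x u v))"

text \<open>The exterior derivative of a \<open>2\<close>-form on an open set, on constant vector fields \<open>u, v, w\<close>.\<close>

definition ext_deriv2 ::
  "('e::euclidean_space \<Rightarrow> 'e \<Rightarrow> 'e \<Rightarrow> real) \<Rightarrow> 'e \<Rightarrow> 'e \<Rightarrow> 'e \<Rightarrow> 'e \<Rightarrow> real" where
  "ext_deriv2 \<theta> x u v w =
     frechet_derivative (\<lambda>y. \<theta> y v w) (at x) u
     - frechet_derivative (\<lambda>y. \<theta> y u w) (at x) v
     + frechet_derivative (\<lambda>y. \<theta> y u v) (at x) w"

definition closed_2form ::
  "('a, 'e::euclidean_space) manifold \<Rightarrow> ('a, 'e) form2 \<Rightarrow> bool" where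
  "closed_2form M \<omega> \<longleftrightarrow>
     (\<forall>k\<in>atlas M. \<forall>x\<in>chart_range k. \<forall>u v w. ext_deriv2 (local_form M \<omega> k) x u v w = 0)"


section \<open>Polysymplectic manifolds\<close>

text \<open>
  The numbers \<open>n\<close> and \<open>s\<close> are the cardinalities of the finite index types \<open>'n\<close> and \<open>'s\<close>.
  The basis vectors are \<open>v\<^sub>i = b (Inl i)\<close> and \<open>w\<^sub>i\<^sup>j = b (Inr (j, i))\<close>; the elements of the dual basis
  are the coefficient functions of \<^const>\<open>representation\<close>.
\<close>

definition polysymplectic_structure ::
  "'n::finite itself \<Rightarrow> 'v::real_vector set \<Rightarrow> ('s::finite \<Rightarrow> 'v \<Rightarrow> 'v \<Rightarrow> real) \<Rightarrow> bool" where
  "polysymplectic_structure _ S \<omega> \<longleftrightarrow>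
     (\<forall>j. alternating_2form_on S (\<omega> j)) \<and>
     (\<exists>b :: 'n + 's \<times> 'n \<Rightarrow> 'v.
        inj b \<and> independent (range b) \<and> span (range b) = S \<and>
        (let dual = (\<lambda>a u. representation (range b) u (b a))
         in \<forall>j. \<forall>u\<in>S. \<forall>v\<in>S.
              \<omega> j u v = (\<Sum>i\<in>UNIV. wedge (dual (Inl i)) (dual (Inr (j, i))) u v)))"

text \<open>
  A distribution is integrable if it is tangent to a foliation, i.e. if around every point there
  are coordinates \<open>F\<close> in which it is spanned by some of the coordinate vector fields.
\<close>

definition integrable_distribution ::
  "('a, 'e::euclidean_space) manifold \<Rightarrow> ('a \<Rightarrow> ('a, 'e) tvec set) \<Rightarrow> bool" where
  "integrable_distribution M D \<longleftrightarrow>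
     (\<forall>p\<in>topspace (mspace M). \<exists>U V F. \<exists>K\<subseteq>Basis.
        p \<in> U \<and> diffeo_between M U (euclidean_manifold :: ('e, 'e) manifold) V F \<and>
        (\<forall>q\<in>U. D q = {v \<in> tangent_space M q. differential M F q v \<in> span K}))"

definition perp_sum ::
  "('a, 'e::euclidean_space) manifold \<Rightarrow> ('s::finite \<Rightarrow> ('a, 'e) form2) \<Rightarrow> 'a \<Rightarrow> ('a, 'e) tvec set" where
  "perp_sum M \<omega> q = {\<Sum>j\<in>UNIV. v j | v. \<forall>j. v j \<in> perp_on (tangent_space M q) (\<omega> j q)}"

definition polysymplectic_manifold ::
  "'n::finite itself \<Rightarrow> ('a, 'e::euclidean_space) manifold \<Rightarrow> ('s::finite \<Rightarrow> ('a, 'e) form2) \<Rightarrow> bool" where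
  "polysymplectic_manifold _ M \<omega> \<longleftrightarrow>
     smooth_manifold M \<and>
     DIM('e) = CARD('n) * (CARD('s) + 1) \<and>
     (\<forall>j. smooth_2form M (\<omega> j) \<and> closed_2form M (\<omega> j)) \<and>
     (\<forall>p\<in>topspace (mspace M).
        polysymplectic_structure TYPE('n) (tangent_space M p) (\<lambda>j. \<omega> j p)) \<and>
     integrable_distribution M (perp_sum M \<omega>)"

text \<open>
  Isomorphisms between the open submanifolds \<open>U \<subseteq> M\<close> and \<open>V \<subseteq> N\<close>, with the restricted forms; the
  tangent spaces of an open submanifold are those of the ambient manifold.
\<close>

definition polysymplectic_iso ::
  "('a, 'e::euclidean_space) manifold \<Rightarrow> 'a set \<Rightarrow> ('s \<Rightarrow> ('a, 'e) form2) \<Rightarrow>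
   ('b, 'f::euclidean_space) manifold \<Rightarrow> 'b set \<Rightarrow> ('s \<Rightarrow> ('b, 'f) form2) \<Rightarrow> ('a \<Rightarrow> 'b) \<Rightarrow> bool" where
  "polysymplectic_iso M U \<omega> N V \<eta> F \<longleftrightarrow>
     diffeo_between M U N V F \<and>
     (\<forall>j. \<forall>q\<in>U. \<forall>u\<in>tangent_space M q. \<forall>v\<in>tangent_space M q.
        \<omega> j q u v = \<eta> j (F q) (tangent_map M N F q u) (tangent_map M N F q v))"

text \<open>The model space has coordinates \<open>x\<^sub>i\<close>, \<open>y\<^sub>i\<^sup>j\<close> and hence dimension \<open>n + sn = n(s + 1)\<close>.\<close>

type_synonym ('n, 's) model = "(real ^ 'n) \<times> ((real ^ 'n) ^ 's)"

definition x_coord :: "'n::finite \<Rightarrow> ('n, 's::finite) model \<Rightarrow> real" where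
  "x_coord i z = fst z $ i"

definition y_coord :: "'n::finite \<Rightarrow> 's::finite \<Rightarrow> ('n, 's) model \<Rightarrow> real" where
  "y_coord i j z = snd z $ j $ i"

definition standard_form :: "'s::finite \<Rightarrow> (('n::finite, 's) model, ('n, 's) model) form2" where
  "standard_form j z u v =
     (\<Sum>i\<in>UNIV. wedge (differential euclidean_manifold (x_coord i) z)
                      (differential euclidean_manifold (y_coord i j) z) u v)"

end

theory Submission
  imports Defs
begin

text \<open>
  If \<open>s \<ge> 2\<close>, then \<open>\<Sum>\<^sub>j \<omega>\<^sub>j\<^sup>\<bottom>\<close> is isotropic for all \<open>\<omega>\<^sub>j\<close>, and at \<open>p\<close> it is the common kernel of the \<open>\<phi>\<^sub>i\<close>.
  Integrability provides coordinates that straighten it; after a linear change they are adapted to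
  the given covectors at \<open>p\<close>. A relative Poincare lemma then gives
  \<open>\<omega>\<^sub>j = - d (\<Sum>\<^sub>i f\<^sub>i\<^sup>j dx\<^sub>i) = \<Sum>\<^sub>i dx\<^sub>i \<and> df\<^sub>i\<^sup>j\<close>, and the \<open>x\<^sub>i\<close> and \<open>f\<^sub>i\<^sup>j\<close> are the required coordinates.
  If \<open>s = 1\<close>, then the distribution is zero and the claim is the theorem of Darboux, with prescribed
  differentials at \<open>p\<close>; it follows from Moser's argument. The smooth dependence of the flow on
  the initial point comes from viewing trajectories as solutions of a fixed point equation in the
  Banach space of curves: differentiating the equation gives a linear equation for the derivative,
  and regularity follows by induction.
\<close>

section \<open>Calculus of \<open>C\<^sup>k\<close> maps\<close>

text \<open>\<open>Ck_on\<close> is defined by derivatives in fixed directions on a Euclidean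
  domain, but values may lie in any normed space. This shapes the analysis: the map from an initial
  point to its trajectory goes from a Euclidean space into a Banach space of curves and fits the
  definition, whereas operators on curves do not; they are differentiated once, and beyond that only
  studied after composition with such a map. Higher regularity of inverse functions, of flows and of
  Moser's vector field all comes from one fact about linear equations
  \<open>A x (w x) = b x\<close>.

  Prescribing the differentials at \<open>p\<close> is a matter of normalisation: an affine change
  of coordinates makes the forms equal to the model forms at the origin, and every later change of
  coordinates fixes the origin with derivative the identity. In Moser's case this rests on the
  vanishing of the field and its spatial derivative at the origin, which also makes the field
  Lipschitz with constant 1/2 on a small ball, so that the flow reaches time 1.\<close>

abbreviation fderiv :: "('a::real_normed_vector \<Rightarrow> 'b::real_normed_vector) \<Rightarrow> 'a \<Rightarrow> 'a \<Rightarrow> 'b" where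
  "fderiv f x \<equiv> frechet_derivative f (at x)"

lemma Ck_on_cong:
  assumes "open S" "\<And>x. x \<in> S \<Longrightarrow> f x = g x"
  shows "Ck_on k S f \<longleftrightarrow> Ck_on k S g"
  using assms(2)
proof (induction k arbitrary: f g)
  case 0
  then show ?case by (simp cong: continuous_on_cong)
next
  case (Suc k)
  have hd: "(f has_derivative D) (at x) \<longleftrightarrow> (g has_derivative D) (at x)" if "x \<in> S" for x D
    using has_derivative_transform_within_open[OF _ assms(1) that] Suc.prems by metis
  have "f differentiable (at x) \<longleftrightarrow> g differentiable (at x)" if "x \<in> S" for x
    unfolding differentiable_def using hd[OF that] by simp
  moreover have "fderiv f x = fderiv g x" if "x \<in> S" for x
    unfolding frechet_derivative_def using hd[OF that] by simp
  ultimately show ?case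
    using Suc.IH[of "\<lambda>x. fderiv f x _" "\<lambda>x. fderiv g x _"] by simp
qed

lemma Ck_on_SucI:
  assumes "open S" "\<And>x. x \<in> S \<Longrightarrow> (f has_derivative f' x) (at x)"
    and "\<And>v. Ck_on k S (\<lambda>x. f' x v)"
  shows "Ck_on (Suc k) S f"
proof -
  have eq: "f' x = fderiv f x" if "x \<in> S" for x
    using frechet_derivative_at[OF assms(2)[OF that]] .
  have "Ck_on k S (\<lambda>x. fderiv f x v)" for v
    using Ck_on_cong[OF assms(1), of "\<lambda>x. f' x v" "\<lambda>x. fderiv f x v" k] eq assms(3) by simp
  then show ?thesis
    using assms(2) by (auto simp: differentiable_def)
qed

lemma Ck_on_SucD:
  assumes "Ck_on (Suc k) S f" "x \<in> S"
  shows "(f has_derivative fderiv f x) (at x)"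
  using assms by (auto simp: frechet_derivative_works)

lemma Ck_on_imp_continuous_on:
  assumes "Ck_on k S f"
  shows "continuous_on S f"
proof (cases k)
  case 0
  then show ?thesis using assms by simp
next
  case (Suc m)
  then have "\<forall>x\<in>S. continuous (at x) f"
    using assms by (simp add: differentiable_imp_continuous_within)
  then show ?thesis by (rule continuous_at_imp_continuous_on)
qed

lemma Ck_on_Suc_imp_Ck_on: "Ck_on (Suc k) S f \<Longrightarrow> Ck_on k S f"
proof (induction k arbitrary: f)
  case 0
  then show ?case using Ck_on_imp_continuous_on[OF 0] by simp
next
  case (Suc k)
  then show ?case by (metis Ck_on.simps(2))
qed

lemma Ck_on_subset: "Ck_on k S f \<Longrightarrow> T \<subseteq> S \<Longrightarrow> Ck_on k T f"
  by (induction k arbitrary: f) (auto intro: continuous_on_subset)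

lemma Ck_on_const: "open S \<Longrightarrow> Ck_on k S (\<lambda>x. c)"
proof (induction k arbitrary: c)
  case (Suc k)
  show ?case
    by (rule Ck_on_SucI[where f' = "\<lambda>x v. 0"]) (use Suc in auto)
qed simp

lemma Ck_on_bounded_linear:
  assumes "open S" "bounded_linear L" "Ck_on k S f"
  shows "Ck_on k S (\<lambda>x. L (f x))"
  using assms(3)
proof (induction k arbitrary: f)
  case 0
  then show ?case by (simp add: bounded_linear.continuous_on assms(2))
next
  case (Suc k)
  show ?case
  proof (rule Ck_on_SucI[OF assms(1)])
    show "((\<lambda>x. L (f x)) has_derivative (\<lambda>v. L (fderiv f x v))) (at x)" if "x \<in> S" for x
      by (rule bounded_linear.has_derivative[OF assms(2)]) (rule Ck_on_SucD[OF Suc.prems that])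
    show "Ck_on k S (\<lambda>x. L (fderiv f x v))" for v
      by (rule Suc.IH) (use Suc.prems in simp)
  qed
qed

lemma Ck_on_linear:
  assumes "open S" "bounded_linear L"
  shows "Ck_on k S L"
proof (cases k)
  case 0
  then show ?thesis by (simp add: assms(2) linear_continuous_on)
next
  case (Suc m)
  show ?thesis unfolding Suc
    by (rule Ck_on_SucI[where f' = "\<lambda>x. L"])
       (use assms in \<open>auto intro: bounded_linear_imp_has_derivative Ck_on_const\<close>)
qed

lemma Ck_on_add:
  assumes "open S" "Ck_on k S f" "Ck_on k S g"
  shows "Ck_on k S (\<lambda>x. f x + g x)"
  using assms(2,3)
proof (induction k arbitrary: f g)
  case 0
  then show ?case by (simp add: continuous_on_add)
next
  case (Suc k)
  show ?case
  proof (rule Ck_on_SucI[OF assms(1)])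
    show "((\<lambda>x. f x + g x) has_derivative (\<lambda>v. fderiv f x v + fderiv g x v)) (at x)"
      if "x \<in> S" for x
      using Suc.prems that by (auto intro!: has_derivative_add Ck_on_SucD)
  qed (use Suc in auto)
qed

lemma Ck_on_sum:
  assumes "open S" "\<And>i. i \<in> I \<Longrightarrow> Ck_on k S (f i)"
  shows "Ck_on k S (\<lambda>x. \<Sum>i\<in>I. f i x)"
  using assms(2)
  by (induction I rule: infinite_finite_induct) (auto intro: Ck_on_add Ck_on_const assms(1))

lemma Ck_on_uminus: "open S \<Longrightarrow> Ck_on k S f \<Longrightarrow> Ck_on k S (\<lambda>x. - f x)"
  using Ck_on_bounded_linear[OF _ bounded_linear_minus[OF bounded_linear_ident]] by blast

lemma Ck_on_diff:
  assumes "open S" "Ck_on k S f" "Ck_on k S g"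
  shows "Ck_on k S (\<lambda>x. f x - g x)"
  using Ck_on_add[OF assms(1,2) Ck_on_uminus[OF assms(1,3)]] by simp

lemma Ck_on_bilinear:
  assumes "open S" "bounded_bilinear B" "Ck_on k S f" "Ck_on k S g"
  shows "Ck_on k S (\<lambda>x. B (f x) (g x))"
  using assms(3,4)
proof (induction k arbitrary: f g)
  case 0
  then show ?case by (simp add: bounded_bilinear.continuous_on[OF assms(2)])
next
  case (Suc k)
  show ?case
  proof (rule Ck_on_SucI[OF assms(1)])
    show "((\<lambda>x. B (f x) (g x)) has_derivative (\<lambda>v. B (f x) (fderiv g x v) + B (fderiv f x v) (g x))) (at x)"
      if "x \<in> S" for x
      by (rule bounded_bilinear.FDERIV[OF assms(2)]) (use Suc.prems that in \<open>auto intro!: Ck_on_SucD\<close>)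
    show "Ck_on k S (\<lambda>x. B (f x) (fderiv g x v) + B (fderiv f x v) (g x))" for v
      using Suc.prems by (intro Ck_on_add assms(1) Suc.IH) (auto intro: Ck_on_Suc_imp_Ck_on)
  qed
qed

lemma Ck_on_derivative_expand:
  fixes f :: "'a::euclidean_space \<Rightarrow> 'b::real_normed_vector"
  assumes "f differentiable (at x)"
  shows "fderiv f x u = (\<Sum>b\<in>Basis. (u \<bullet> b) *\<^sub>R fderiv f x b)"
proof -
  interpret bounded_linear "fderiv f x"
    using assms frechet_derivative_works has_derivative_bounded_linear by blast
  have "fderiv f x u = fderiv f x (\<Sum>b\<in>Basis. (u \<bullet> b) *\<^sub>R b)"
    by (simp add: euclidean_representation)
  then show ?thesis by (simp add: sum scaleR)
qed

text \<open>\<open>Ck_on\<close> controls derivatives in constant directions only. Expanding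
  \<open>u x\<close> in the basis turns the moving direction of the chain rule into finitely many
  constant ones with Ck coefficients.\<close>

lemma Ck_on_derivative_apply:
  fixes f :: "'a::euclidean_space \<Rightarrow> 'b::real_normed_vector" and h :: "'c::euclidean_space \<Rightarrow> 'a"
  assumes "open S" and diff: "\<And>x. x \<in> S \<Longrightarrow> f differentiable (at (h x))"
    and "\<And>v. Ck_on k S (\<lambda>x. fderiv f (h x) v)" "Ck_on k S u"
  shows "Ck_on k S (\<lambda>x. fderiv f (h x) (u x))"
proof -
  have "Ck_on k S (\<lambda>x. \<Sum>b\<in>Basis. (u x \<bullet> b) *\<^sub>R fderiv f (h x) b)"
    by (intro Ck_on_sum Ck_on_bilinear[OF _ bounded_bilinear_scaleR] assms
        Ck_on_bounded_linear[OF _ bounded_linear_inner_left])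
  then show ?thesis
    by (subst Ck_on_cong[OF assms(1) Ck_on_derivative_expand[OF diff]])
qed

lemma Ck_on_compose:
  fixes f :: "'a::euclidean_space \<Rightarrow> 'b::euclidean_space" and g :: "'b \<Rightarrow> 'c::real_normed_vector"
  assumes "open S" "open T" "f ` S \<subseteq> T" "Ck_on k S f" "Ck_on k T g"
  shows "Ck_on k S (\<lambda>x. g (f x))"
  using assms(4,5)
proof (induction k arbitrary: g)
  case 0
  then show ?case using assms(3) by (auto intro: continuous_on_compose2)
next
  case (Suc k)
  have fT: "f x \<in> T" if "x \<in> S" for x using that assms(3) by blast
  show ?case
  proof (rule Ck_on_SucI[OF assms(1)])
    show "((\<lambda>x. g (f x)) has_derivative (\<lambda>v. fderiv g (f x) (fderiv f x v))) (at x)"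
      if "x \<in> S" for x
      using diff_chain_at[OF Ck_on_SucD[OF Suc.prems(1) that] Ck_on_SucD[OF Suc.prems(2) fT[OF that]]]
      by (simp add: o_def)
    show "Ck_on k S (\<lambda>x. fderiv g (f x) (fderiv f x v))" for v
    proof (rule Ck_on_derivative_apply[OF assms(1)])
      show "Ck_on k S (\<lambda>x. fderiv g (f x) w)" for w
        by (rule Suc.IH[OF Ck_on_Suc_imp_Ck_on[OF Suc.prems(1)]]) (use Suc.prems in simp)
    qed (use Suc.prems fT in auto)
  qed
qed

text \<open>Differentiating \<open>A x (w x) = b x\<close> gives \<open>A x (w' x) = b' x - A' x (w x)\<close>, an equation of the same
  shape, so regularity follows by induction.\<close>

lemma continuous_at_linear_solve:
  fixes A :: "'a::real_normed_vector \<Rightarrow> 'b::real_normed_vector \<Rightarrow>\<^sub>L 'c::real_normed_vector"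
  assumes A: "continuous (at x) A" and b: "continuous (at x) b"
    and B: "\<And>v. blinfun_apply B (A x v) = v"
    and eq: "eventually (\<lambda>y. A y (w y) = b y) (nhds x)"
  shows "continuous (at x) w"
proof -
  have eqx: "A x (w x) = b x" using eq by (rule eventually_nhds_x_imp_x)
  define M where "M = norm (w x)"
  \<comment> \<open>The left inverse \<open>B\<close> of \<open>A x\<close> is applied to
    \<open>A x (w y - w x)\<close>. The unknown difference reappears on the right with factor at
    most 1/2 and is absorbed, whence the leading 2. No bound on \<open>w\<close> near
    \<open>x\<close> is presupposed.\<close>
  have key: "norm (w y - w x) \<le> 2 * (norm B * (norm (b y - b x) + norm (A y - A x) * M))"
    if "A y (w y) = b y" "norm B * norm (A y - A x) \<le> 1/2" for y
  proof -
    have "w y - w x = B (b y - b x - (A y - A x) (w x) - (A y - A x) (w y - w x))"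
      using that(1) eqx B[of "w y - w x"]
      by (simp add: blinfun.bilinear_simps algebra_simps)
    also have "norm \<dots> \<le> norm B * norm (b y - b x - (A y - A x) (w x) - (A y - A x) (w y - w x))"
      by (rule norm_blinfun)
    also have "norm (b y - b x - (A y - A x) (w x) - (A y - A x) (w y - w x))
        \<le> norm (b y - b x) + norm (A y - A x) * M + norm (A y - A x) * norm (w y - w x)"
      unfolding M_def
      by (intro order_trans[OF norm_triangle_ineq4] add_mono norm_blinfun order_refl)
    finally have "norm (w y - w x) \<le> norm B * (norm (b y - b x) + norm (A y - A x) * M + norm (A y - A x) * norm (w y - w x))"
      by (simp add: mult_left_mono)
    also have "\<dots> = norm B * (norm (b y - b x) + norm (A y - A x) * M)
        + (norm B * norm (A y - A x)) * norm (w y - w x)"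
      by (simp add: algebra_simps)
    also have "\<dots> \<le> norm B * (norm (b y - b x) + norm (A y - A x) * M) + 1/2 * norm (w y - w x)"
      using that(2) by (intro add_mono order_refl mult_right_mono) auto
    finally show ?thesis by simp
  qed
  have An: "((\<lambda>y. norm (A y - A x)) \<longlongrightarrow> 0) (at x)"
    using A by (simp add: continuous_at LIM_zero_iff tendsto_norm_zero_iff)
  have bn: "((\<lambda>y. norm (b y - b x)) \<longlongrightarrow> 0) (at x)"
    using b by (simp add: continuous_at LIM_zero_iff tendsto_norm_zero_iff)
  have "((\<lambda>y. norm B * norm (A y - A x)) \<longlongrightarrow> norm B * 0) (at x)"
    by (intro tendsto_intros An)
  then have "eventually (\<lambda>y. norm B * norm (A y - A x) < 1/2) (at x)"
    by (rule order_tendstoD) simp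
  moreover have "eventually (\<lambda>y. A y (w y) = b y) (at x)"
    using eq by (simp add: eventually_nhds_conv_at)
  ultimately have ev: "eventually (\<lambda>y. norm (w y - w x) \<le> 2 * (norm B * (norm (b y - b x) + norm (A y - A x) * M))) (at x)"
    by eventually_elim (auto intro: key)
  have "((\<lambda>y. 2 * (norm B * (norm (b y - b x) + norm (A y - A x) * M))) \<longlongrightarrow> 2 * (norm B * (0 + 0 * M))) (at x)"
    by (intro tendsto_intros An bn)
  then have "((\<lambda>y. w y - w x) \<longlongrightarrow> 0) (at x)"
    by (intro Lim_null_comparison[OF ev]) simp
  then show ?thesis by (simp add: continuous_at LIM_zero_iff)
qed

text \<open>A product rule with one factor merely continuous: as \<open>A x = 0\<close>, the
  remainder \<open>A y (w y - w x)\<close> is O(\<open>norm (y - x)\<close>) times a quantity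
  tending to 0.\<close>

lemma has_derivative_apply_vanishing:
  fixes A :: "'a::real_normed_vector \<Rightarrow> 'b::real_normed_vector \<Rightarrow>\<^sub>L 'c::real_normed_vector"
  assumes A: "(A has_derivative A') (at x)" and "A x = 0" and w: "continuous (at x) w"
  shows "((\<lambda>y. A y (w y)) has_derivative (\<lambda>v. A' v (w x))) (at x)"
proof -
  have 1: "((\<lambda>y. A y (w x)) has_derivative (\<lambda>v. A' v (w x))) (at x)"
    by (rule bounded_linear.has_derivative[OF blinfun.bounded_linear_left A])
  have lin: "bounded_linear A'" using A by (rule has_derivative_bounded_linear)
  obtain K where K: "\<And>v. norm (A' v) \<le> norm v * K" "K > 0"
    using bounded_linear.pos_bounded[OF lin] by blast
  have "((\<lambda>y. A y (w y - w x)) has_derivative (\<lambda>v. 0)) (at x)"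
    unfolding has_derivative_at_within
  proof (intro conjI bounded_linear_zero)
    have nA: "((\<lambda>y. norm (A y - A x - A' (y - x)) / norm (y - x)) \<longlongrightarrow> 0) (at x)"
      using tendsto_norm[OF has_derivative_at_within[THEN iffD1, OF A, THEN conjunct2]]
      by (simp add: divide_inverse_commute)
    have nw: "((\<lambda>y. norm (w y - w x)) \<longlongrightarrow> 0) (at x)"
      using w by (simp add: continuous_at LIM_zero_iff tendsto_norm_zero_iff)
    have lim: "((\<lambda>y. (norm (A y - A x - A' (y - x)) / norm (y - x) + K) * norm (w y - w x)) \<longlongrightarrow> (0 + K) * 0) (at x)"
      by (intro tendsto_intros nA nw)
    have ev: "eventually (\<lambda>y. norm (A y (w y - w x) /\<^sub>R norm (y - x))
      \<le> (norm (A y - A x - A' (y - x)) / norm (y - x) + K) * norm (w y - w x)) (at x)"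
      unfolding eventually_at_filter
    proof (intro always_eventually allI impI)
      fix y assume "y \<noteq> x"
      then have p: "norm (y - x) > 0" by simp
      have "norm (A y) \<le> norm (A y - A x - A' (y - x)) + norm (A' (y - x))"
        using norm_triangle_ineq[of "A y - A x - A' (y - x)" "A' (y - x)"] assms(2) by simp
      also have "\<dots> \<le> norm (A y - A x - A' (y - x)) + norm (y - x) * K"
        using K by simp
      finally have "norm (A y) / norm (y - x) \<le> norm (A y - A x - A' (y - x)) / norm (y - x) + K"
        using p by (simp add: field_simps)
      moreover have "norm (A y (w y - w x)) / norm (y - x) \<le> norm (A y) / norm (y - x) * norm (w y - w x)"
        using p norm_blinfun[of "A y" "w y - w x"] by (simp add: field_simps)
      ultimately have "norm (A y (w y - w x)) / norm (y - x)
        \<le> (norm (A y - A x - A' (y - x)) / norm (y - x) + K) * norm (w y - w x)"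
        using mult_right_mono[OF _ norm_ge_zero[of "w y - w x"]] order_trans by blast
      then show "norm (A y (w y - w x) /\<^sub>R norm (y - x))
        \<le> (norm (A y - A x - A' (y - x)) / norm (y - x) + K) * norm (w y - w x)"
        by (simp add: divide_inverse_commute)
    qed
    have "((\<lambda>y. A y (w y - w x) /\<^sub>R norm (y - x)) \<longlongrightarrow> 0) (at x)"
      by (rule Lim_null_comparison[OF ev]) (use lim in simp)
    then show "((\<lambda>y. (A y (w y - w x) - A x (w x - w x) - 0) /\<^sub>R norm (y - x)) \<longlongrightarrow> 0) (at x)"
      by simp
  qed
  from has_derivative_add[OF 1 this] show ?thesis
    by (simp add: blinfun.bilinear_simps)
qed

text \<open>With \<open>B\<close> a left inverse of \<open>A x\<close>, the equation reads
  \<open>w y = B (b y - (A y - A x) (w y))\<close>. The operator \<open>A y - A x\<close> vanishes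
  at \<open>x\<close>, so continuity of \<open>w\<close> is enough to differentiate the right-hand
  side.\<close>

lemma has_derivative_linear_solve:
  fixes A :: "'a::real_normed_vector \<Rightarrow> 'b::real_normed_vector \<Rightarrow>\<^sub>L 'c::real_normed_vector"
  assumes A: "(A has_derivative A') (at x)" and b: "(b has_derivative b') (at x)"
    and B: "\<And>v. blinfun_apply B (A x v) = v"
    and eq: "eventually (\<lambda>y. A y (w y) = b y) (nhds x)"
  shows "(w has_derivative (\<lambda>v. B (b' v - A' v (w x)))) (at x)"
proof -
  have w: "continuous (at x) w"
    using continuous_at_linear_solve[OF has_derivative_continuous[OF A] has_derivative_continuous[OF b] B eq] .
  have "((\<lambda>y. A y - A x) has_derivative A') (at x)"
    using has_derivative_diff[OF A has_derivative_const[of "A x"]] by simp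
  from has_derivative_apply_vanishing[OF this _ w]
  have "((\<lambda>y. (A y - A x) (w y)) has_derivative (\<lambda>v. A' v (w x))) (at x)" by simp
  from bounded_linear.has_derivative[OF blinfun.bounded_linear_right[of B] has_derivative_diff[OF b this]]
  have d: "((\<lambda>y. B (b y - (A y - A x) (w y))) has_derivative (\<lambda>v. B (b' v - A' v (w x)))) (at x)" .
  obtain T where T: "open T" "x \<in> T" "\<And>y. y \<in> T \<Longrightarrow> A y (w y) = b y"
    using eq unfolding eventually_nhds by blast
  show ?thesis
    by (rule has_derivative_transform_within_open[OF d T(1,2)])
       (simp add: T(3)[symmetric] blinfun.bilinear_simps B)
qed

lemma Ck_on_linear_solve:
  fixes A :: "'a::euclidean_space \<Rightarrow> 'b::real_normed_vector \<Rightarrow>\<^sub>L 'c::real_normed_vector"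
  assumes "open S" "Ck_on k S A" "Ck_on k S b"
    and inv: "\<And>x. x \<in> S \<Longrightarrow> \<exists>B. (\<forall>v. blinfun_apply B (A x v) = v) \<and> (\<forall>v. A x (blinfun_apply B v) = v)"
    and eq: "\<And>x. x \<in> S \<Longrightarrow> A x (w x) = b x"
  shows "Ck_on k S w"
  using assms(2,3) eq
proof (induction k arbitrary: b w)
  case 0
  have "continuous (at x) w" if x: "x \<in> S" for x
  proof -
    obtain B where B: "\<And>v. blinfun_apply B (A x v) = v" using inv[OF x] by blast
    have ev: "eventually (\<lambda>y. A y (w y) = b y) (nhds x)"
      using eventually_nhds assms(1) x 0(3) by blast
    have "continuous (at x) A" "continuous (at x) b"
      using 0(1,2) x continuous_on_eq_continuous_at[OF assms(1)] by auto
    from continuous_at_linear_solve[OF this B ev] show ?thesis .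
  qed
  then show ?case by (simp add: continuous_at_imp_continuous_on)
next
  case (Suc k)
  \<comment> \<open>The inverses are chosen point by point, with no regularity in \<open>x\<close>;
    all regularity is extracted from the equation.\<close>
  have "\<forall>x\<in>S. \<exists>B. (\<forall>v. blinfun_apply B (A x v) = v) \<and> (\<forall>v. A x (blinfun_apply B v) = v)"
    using inv by blast
  from bchoice[OF this] obtain BB
    where BB': "\<forall>x\<in>S. (\<forall>v. blinfun_apply (BB x) (A x v) = v) \<and> (\<forall>v. A x (blinfun_apply (BB x) v) = v)"
    by blast
  then have BB: "BB x (A x v) = v" "A x (BB x v') = v'" if "x \<in> S" for x v v'
    using that by blast+
  let ?A' = "\<lambda>x. fderiv A x" and ?b' = "\<lambda>x. fderiv b x"
  have w: "Ck_on k S w"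
    by (rule Suc.IH) (use Suc.prems Ck_on_Suc_imp_Ck_on in auto)
  show ?case
  proof (rule Ck_on_SucI[OF assms(1)])
    show "(w has_derivative (\<lambda>v. BB x (?b' x v - ?A' x v (w x)))) (at x)" if x: "x \<in> S" for x
    proof (rule has_derivative_linear_solve)
      show "eventually (\<lambda>y. A y (w y) = b y) (nhds x)"
        using eventually_nhds assms(1) x Suc.prems(3) by blast
    qed (use Suc.prems x BB Ck_on_SucD in blast)+
    show "Ck_on k S (\<lambda>x. BB x (?b' x v - ?A' x v (w x)))" for v
    proof (rule Suc.IH)
      show "Ck_on k S A" using Suc.prems Ck_on_Suc_imp_Ck_on by auto
      show "Ck_on k S (\<lambda>x. ?b' x v - ?A' x v (w x))"
        using Suc.prems by (intro Ck_on_diff assms(1) Ck_on_bilinear[OF _ bounded_bilinear_blinfun_apply] w) auto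
    qed (auto simp: BB)
  qed
qed

text \<open>On a Euclidean space an operator is a finite sum of rank-one operators built from its
  values on the basis, so regularity of these values already gives regularity in operator
  norm.\<close>

lemma Ck_on_blinfun_componentwise:
  fixes A :: "'a::euclidean_space \<Rightarrow> 'b::euclidean_space \<Rightarrow>\<^sub>L 'c::real_normed_vector"
  assumes "open S" "\<And>v. v \<in> Basis \<Longrightarrow> Ck_on k S (\<lambda>x. A x v)"
  shows "Ck_on k S A"
proof -
  have eq: "A x = (\<Sum>i\<in>Basis. blinfun_scaleR_left (A x i) o\<^sub>L blinfun_inner_left i)" for x
  proof (rule blinfun_eqI)
    fix v
    have "(\<Sum>i\<in>Basis. blinfun_scaleR_left (A x i) o\<^sub>L blinfun_inner_left i) v = A x (\<Sum>i\<in>Basis. (v \<bullet> i) *\<^sub>R i)"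
      by (simp add: blinfun.sum_left blinfun.sum_right blinfun.scaleR_right blinfun_inner_left.rep_eq
          del: euclidean_representation)
    then show "A x v = (\<Sum>i\<in>Basis. blinfun_scaleR_left (A x i) o\<^sub>L blinfun_inner_left i) v"
      by (simp only: euclidean_representation)
  qed
  define A' where "A' = (\<lambda>x. \<Sum>i\<in>Basis. blinfun_scaleR_left (A x i) o\<^sub>L blinfun_inner_left i)"
  have "Ck_on k S A'"
    unfolding A'_def by (intro Ck_on_sum Ck_on_bounded_linear[where L = "\<lambda>c. blinfun_scaleR_left c o\<^sub>L blinfun_inner_left _"] assms
        bounded_linear_compose[OF bounded_bilinear.bounded_linear_left[OF bounded_bilinear_blinfun_compose]
          bounded_linear_blinfun_scaleR_left])
  moreover have "A = A'"
    unfolding A'_def by (rule ext) (rule eq)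
  ultimately show ?thesis by simp
qed

lemma Ck_on_frechet_blinfun:
  fixes f :: "'a::euclidean_space \<Rightarrow> 'b::real_normed_vector"
  assumes "open S" "Ck_on (Suc k) S f"
  shows "Ck_on k S (\<lambda>x. Blinfun (fderiv f x))"
proof (rule Ck_on_blinfun_componentwise[OF assms(1)])
  fix v
  have "Blinfun (fderiv f x) v = fderiv f x v" if "x \<in> S" for x
    using has_derivative_bounded_linear[OF Ck_on_SucD[OF assms(2) that]]
    by (simp add: bounded_linear_Blinfun_apply)
  then show "Ck_on k S (\<lambda>x. Blinfun (fderiv f x) v)"
    using assms(2) by (subst Ck_on_cong[OF assms(1)]) auto
qed

section \<open>Differentiation under the integral sign\<close>

lemma has_derivative_integral_param:
  fixes h :: "real \<times> 'a::euclidean_space \<Rightarrow> 'b::banach"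
  assumes "open Q" "open S" "{0..1} \<times> S \<subseteq> Q" "Ck_on (Suc 0) Q h" "x \<in> S"
  shows "((\<lambda>x. integral {0..1} (\<lambda>t. h (t, x))) has_derivative
    (\<lambda>v. integral {0..1} (\<lambda>t. fderiv h (t, x) (0, v)))) (at x)"
proof -
  obtain r where r: "r > 0" "ball x r \<subseteq> S" using assms(2,5) open_contains_ball by blast
  let ?U = "ball x r"
  \<comment> \<open>Composition with the inclusion of the second factor extracts the partial
    derivative in the parameter, as an operator; the Leibniz rule needs its joint
    continuity.\<close>
  define fx where "fx = (\<lambda>y t. Blinfun (fderiv h (t, y)) o\<^sub>L Blinfun (\<lambda>v::'a. (0::real, v)))"
  have sub: "(t, y) \<in> Q" if "t \<in> {0..1}" "y \<in> S" for t y using assms(3) that by auto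
  have b0: "bounded_linear (\<lambda>v::'a. (0::real, v))" by (intro bounded_linear_intros)
  have fx: "fx y t v = fderiv h (t, y) (0, v)" if "t \<in> {0..1}" "y \<in> S" for t y v
    using has_derivative_bounded_linear[OF Ck_on_SucD[OF assms(4) sub[OF that]]]
    by (simp only: fx_def blinfun_apply_blinfun_compose bounded_linear_Blinfun_apply b0)
  have hcont: "continuous_on Q h" using assms(4) by (rule Ck_on_imp_continuous_on)
  have cfx: "continuous_on (?U \<times> cbox 0 1) (\<lambda>(y, t). fx y t)"
  proof -
    have "continuous_on Q (\<lambda>z. Blinfun (fderiv h z))"
      using Ck_on_frechet_blinfun[OF assms(1,4)] by simp
    from bounded_linear.continuous_on[OF bounded_bilinear.bounded_linear_left[OF bounded_bilinear_blinfun_compose] this]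
    have c: "continuous_on Q (\<lambda>z. Blinfun (fderiv h z) o\<^sub>L Blinfun (\<lambda>v::'a. (0::real, v)))" .
    have s: "continuous_on (?U \<times> cbox 0 1) (\<lambda>p. (snd p, fst p))"
      by (intro continuous_intros)
    have "(\<lambda>p. (snd p, fst p)) ` (?U \<times> cbox 0 1) \<subseteq> Q" using r(2) sub by auto
    from continuous_on_compose2[OF c s this] show ?thesis
      by (simp only: case_prod_unfold fx_def)
  qed
  have "((\<lambda>x. integral (cbox 0 1) (\<lambda>t. h (t, x))) has_derivative integral (cbox 0 1) (fx x)) (at x within ?U)"
  proof (rule leibniz_rule[OF _ _ cfx])
    fix y t assume yt: "y \<in> ?U" "t \<in> cbox (0::real) 1"
    then have m: "t \<in> {0..1}" "y \<in> S" using r(2) by auto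
    have "((\<lambda>y. h (t, y)) has_derivative (\<lambda>v. fderiv h (t, y) (0, v))) (at y)"
      by (rule has_derivative_compose[where f = "\<lambda>y. (t, y)" and g = h, OF _ Ck_on_SucD[OF assms(4) sub[OF m]]])
         (intro has_derivative_Pair has_derivative_const has_derivative_ident)
    then have "((\<lambda>y. h (t, y)) has_derivative fx y t) (at y)"
      by (simp add: fx[OF m, symmetric])
    then show "((\<lambda>y. h (t, y)) has_derivative fx y t) (at y within ?U)"
      by (rule has_derivative_at_withinI)
  next
    fix y assume "y \<in> ?U"
    then have "continuous_on (cbox 0 1) (\<lambda>t. h (t, y))"
      using r(2) sub
      by (intro continuous_on_compose2[OF hcont, of _ "\<lambda>t. (t, y)"] continuous_on_Pair continuous_on_id continuous_on_const) auto
    then show "(\<lambda>t. h (t, y)) integrable_on cbox 0 1" by (rule integrable_continuous)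
  qed (use r in auto)
  then have d: "((\<lambda>x. integral {0..1} (\<lambda>t. h (t, x))) has_derivative integral {0..1} (fx x)) (at x)"
    unfolding cbox_interval at_within_open[OF centre_in_ball[THEN iffD2, OF r(1)] open_ball] .
  have "integral {0..1} (fx x) v = integral {0..1} (\<lambda>t. fderiv h (t, x) (0, v))" for v
  proof -
    have "continuous_on (cbox 0 1) (fx x)"
    proof -
      have "(\<lambda>t. (x, t)) ` cbox 0 1 \<subseteq> ?U \<times> cbox 0 1" using r by auto
      from continuous_on_compose2[OF cfx continuous_on_Pair[OF continuous_on_const continuous_on_id] this]
      show ?thesis by simp
    qed
    from integrable_continuous[OF this] have "fx x integrable_on {0..1}" by (simp add: cbox_interval)
    from integral_linear[OF this blinfun.bounded_linear_left[of v]]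
    have "integral {0..1} (fx x) v = integral {0..1} (\<lambda>t. fx x t v)" by (simp add: o_def)
    also have "\<dots> = integral {0..1} (\<lambda>t. fderiv h (t, x) (0, v))"
      using fx assms(5) by (intro integral_cong) auto
    finally show ?thesis .
  qed
  then have "blinfun_apply (integral {0..1} (fx x)) = (\<lambda>v. integral {0..1} (\<lambda>t. fderiv h (t, x) (0, v)))"
    by (rule ext)
  with d show ?thesis by (simp only:)
qed

text \<open>The derivative in direction \<open>v\<close> is an integral of the same kind, with
  \<open>h\<close> replaced by its derivative along \<open>(0, v)\<close>, so the induction varies
  \<open>h\<close>. The open set \<open>Q\<close> makes \<open>h\<close> differentiable at the end
  times 0 and 1 too.\<close>

lemma Ck_on_integral_param:
  fixes h :: "real \<times> 'a::euclidean_space \<Rightarrow> 'b::banach"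
  assumes "open Q" "open S" "{0..1} \<times> S \<subseteq> Q" "Ck_on k Q h"
  shows "Ck_on k S (\<lambda>x. integral {0..1} (\<lambda>t. h (t, x)))"
  using assms(4)
proof (induction k arbitrary: h)
  case 0
  have "continuous_on Q h" using 0 by simp
  moreover have "continuous_on (S \<times> cbox 0 1) (\<lambda>p. (snd p, fst p))"
    by (intro continuous_intros)
  moreover have "(\<lambda>p. (snd p, fst p)) ` (S \<times> cbox 0 1) \<subseteq> Q" using assms(3) by auto
  ultimately have "continuous_on (S \<times> cbox 0 1) (\<lambda>p. h (snd p, fst p))"
    by (rule continuous_on_compose2)
  then have "continuous_on (S \<times> cbox 0 1) (\<lambda>(x, t). h (t, x))"
    by (simp only: case_prod_unfold)
  from integral_continuous_on_param[OF this] show ?case by (simp add: cbox_interval)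
next
  case (Suc k)
  show ?case
  proof (rule Ck_on_SucI[OF assms(2)])
    have "Ck_on (Suc 0) Q h"
      using Suc.prems Ck_on_imp_continuous_on by (metis Ck_on.simps)
    then show "((\<lambda>x. integral {0..1} (\<lambda>t. h (t, x))) has_derivative
      (\<lambda>v. integral {0..1} (\<lambda>t. fderiv h (t, x) (0, v)))) (at x)" if "x \<in> S" for x
      using has_derivative_integral_param[OF assms(1-3) _ that] by blast
  qed (use Suc in auto)
qed

text \<open>The inverse function theorem supplies a differentiable \<open>g\<close>. For fixed
  \<open>v\<close> its derivative solves \<open>f' (g y) w = v\<close>, an equation whose
  coefficients are as regular as \<open>g\<close>; so each order of regularity yields the
  next.\<close>

lemma smooth_on_local_inverse:
  fixes f :: "'a::euclidean_space \<Rightarrow> 'a"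
  assumes "open S" "smooth_on S f" "x0 \<in> S" and inj: "\<And>v. fderiv f x0 v = 0 \<Longrightarrow> v = 0"
  obtains U V g where "open U" "U \<subseteq> S" "x0 \<in> U" "open V" "homeomorphism U V f g" "smooth_on V g"
proof -
  define f' where "f' = (\<lambda>x. Blinfun (fderiv f x))"
  have Ck: "Ck_on k S f" for k using assms(2) by (auto simp: smooth_on_def)
  have hd: "(f has_derivative fderiv f x) (at x)" if "x \<in> S" for x
    using Ck_on_SucD[OF Ck that] .
  have f': "blinfun_apply (f' x) = fderiv f x" if "x \<in> S" for x
    unfolding f'_def using has_derivative_bounded_linear[OF hd[OF that]] by (simp add: bounded_linear_Blinfun_apply)
  have f'Ck: "Ck_on k S f'" for k
    unfolding f'_def by (rule Ck_on_frechet_blinfun[OF assms(1) Ck])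
  have lin: "linear (fderiv f x0)"
    using has_derivative_linear[OF hd[OF assms(3)]] .
  then have "inj (fderiv f x0)"
    using inj by (simp add: linear_injective_0)
  then obtain i where i: "linear i" "i \<circ> fderiv f x0 = id"
    using linear_injective_left_inverse[OF lin] by blast
  have inv: "Blinfun i o\<^sub>L f' x0 = id_blinfun"
  proof (rule blinfun_eqI)
    fix v
    show "(Blinfun i o\<^sub>L f' x0) v = id_blinfun v"
      using i(2) by (simp add: f' assms(3) bounded_linear_Blinfun_apply linear_conv_bounded_linear[THEN iffD1, OF i(1)])
         (metis comp_apply id_apply)
  qed
  obtain U V g g' where UV: "open U" "U \<subseteq> S" "x0 \<in> U" "open V" "homeomorphism U V f g"
    and g: "\<And>y. y \<in> V \<Longrightarrow> (g has_derivative (g' y)) (at y)"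
      "\<And>y. y \<in> V \<Longrightarrow> g' y = inv (blinfun_apply (f' (g y)))"
      "\<And>y. y \<in> V \<Longrightarrow> bij (blinfun_apply (f' (g y)))"
  proof (rule inverse_function_theorem[where f = f and f' = f', OF assms(1) _ _ assms(3) inv])
    show "(f has_derivative f' x) (at x)" if "x \<in> S" for x using hd f' that by simp
    show "continuous_on S f'" using f'Ck[of 0] by simp
  qed blast
  have gV: "g ` V \<subseteq> S" using UV by (auto simp: homeomorphism_def)
  have "Ck_on k V g" for k
  proof (induction k)
    case 0
    then show ?case using UV by (simp add: homeomorphism_def)
  next
    case (Suc k)
    show ?case
    proof (rule Ck_on_SucI[OF UV(4) g(1)])
      fix v
      show "Ck_on k V (\<lambda>y. g' y v)"
      proof (rule Ck_on_linear_solve[OF UV(4)])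
        show "Ck_on k V (\<lambda>y. f' (g y))"
          by (rule Ck_on_compose[OF UV(4) assms(1) gV Suc f'Ck])
        show "Ck_on k V (\<lambda>y. v)" by (rule Ck_on_const[OF UV(4)])
        fix y assume y: "y \<in> V"
        show "f' (g y) (g' y v) = v"
          using g(2,3)[OF y] by (simp add: bij_is_surj surj_f_inv_f)
        have "blinfun_apply (Blinfun (g' y)) = g' y"
          using has_derivative_bounded_linear[OF g(1)[OF y]] by (simp add: bounded_linear_Blinfun_apply)
        then show "\<exists>B. (\<forall>v. blinfun_apply B (f' (g y) v) = v) \<and> (\<forall>v. f' (g y) (blinfun_apply B v) = v)"
          using g(2,3)[OF y] by (intro exI[of _ "Blinfun (g' y)"]) (simp add: bij_is_surj surj_f_inv_f bij_is_inj)
      qed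
    qed
  qed
  then have "smooth_on V g" by (simp add: smooth_on_def)
  with UV that show ?thesis by blast
qed

section \<open>Symmetry of second derivatives\<close>

lemma mixed_difference_mvt:
  fixes f :: "'a::euclidean_space \<Rightarrow> real"
  assumes S: "open S" "Ck_on 2 S f" and "s > 0"
    and sub: "\<And>\<sigma> \<tau>. 0 \<le> \<sigma> \<Longrightarrow> \<sigma> \<le> s \<Longrightarrow> 0 \<le> \<tau> \<Longrightarrow> \<tau> \<le> s \<Longrightarrow> x + \<sigma> *\<^sub>R u + \<tau> *\<^sub>R v \<in> S"
  obtains \<sigma> \<tau> where "0 \<le> \<sigma>" "\<sigma> \<le> s" "0 \<le> \<tau>" "\<tau> \<le> s"
    "f (x + s *\<^sub>R u + s *\<^sub>R v) - f (x + s *\<^sub>R u) - f (x + s *\<^sub>R v) + f x =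
      s * (s * fderiv (\<lambda>y. fderiv f y u) (x + \<sigma> *\<^sub>R u + \<tau> *\<^sub>R v) v)"
proof -
  let ?D = "\<lambda>y. fderiv f y"
  let ?D2 = "\<lambda>y. fderiv (\<lambda>y. fderiv f y u) y"
  have C2: "Ck_on (Suc (Suc 0)) S f" using S(2) by (simp add: numeral_2_eq_2)
  have hd1: "(f has_derivative ?D y) (at y)" if "y \<in> S" for y
    using Ck_on_SucD[OF C2 that] .
  have hd2: "((\<lambda>y. ?D y u) has_derivative ?D2 y) (at y)" if "y \<in> S" for y
    using C2 that by (auto simp: frechet_derivative_works)
  \<comment> \<open>The difference in direction \<open>v\<close> as a function of the displacement
    along \<open>u\<close>. The second difference is its increment over \<open>{0..s}\<close>; a
    second mean value step then acts along \<open>v\<close>.\<close>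
  define \<phi> where "\<phi> = (\<lambda>\<tau>. f (x + \<tau> *\<^sub>R u + s *\<^sub>R v) - f (x + \<tau> *\<^sub>R u))"
  have "(\<phi> has_derivative (\<lambda>h. ?D (x + \<tau> *\<^sub>R u + s *\<^sub>R v) (h *\<^sub>R u) - ?D (x + \<tau> *\<^sub>R u) (h *\<^sub>R u))) (at \<tau> within {0..s})"
    if "0 \<le> \<tau>" "\<tau> \<le> s" for \<tau>
    unfolding \<phi>_def
    using sub[OF that, of s] sub[OF that, of 0] \<open>s > 0\<close>
    by (intro has_derivative_diff has_derivative_compose[OF _ hd1]) (auto intro!: derivative_eq_intros)
  from mvt_very_simple[of 0 s \<phi>, OF _ this] \<open>s > 0\<close>
  obtain \<sigma> where \<sigma>: "0 \<le> \<sigma>" "\<sigma> \<le> s"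
    and e1: "\<phi> s - \<phi> 0 = ?D (x + \<sigma> *\<^sub>R u + s *\<^sub>R v) ((s - 0) *\<^sub>R u) - ?D (x + \<sigma> *\<^sub>R u) ((s - 0) *\<^sub>R u)"
    by auto
  have m: "x + \<sigma> *\<^sub>R u + s *\<^sub>R v \<in> S" "x + \<sigma> *\<^sub>R u \<in> S"
    using sub[OF \<sigma>, of s] sub[OF \<sigma>, of 0] \<open>s > 0\<close> by auto
  have e2: "\<phi> s - \<phi> 0 = s * (?D (x + \<sigma> *\<^sub>R u + s *\<^sub>R v) u - ?D (x + \<sigma> *\<^sub>R u) u)"
    using e1 linear_scale[OF has_derivative_linear[OF hd1[OF m(1)]], of s u]
      linear_scale[OF has_derivative_linear[OF hd1[OF m(2)]], of s u]
    by (simp add: algebra_simps)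
  have "((\<lambda>\<tau>. ?D (x + \<sigma> *\<^sub>R u + \<tau> *\<^sub>R v) u) has_derivative (\<lambda>h. ?D2 (x + \<sigma> *\<^sub>R u + \<tau> *\<^sub>R v) (h *\<^sub>R v))) (at \<tau> within {0..s})"
    if "0 \<le> \<tau>" "\<tau> \<le> s" for \<tau>
    using sub[OF \<sigma> that]
    by (intro has_derivative_compose[OF _ hd2]) (auto intro!: derivative_eq_intros)
  from mvt_very_simple[of 0 s "\<lambda>\<tau>. ?D (x + \<sigma> *\<^sub>R u + \<tau> *\<^sub>R v) u", OF _ this] \<open>s > 0\<close>
  obtain \<tau> where \<tau>: "0 \<le> \<tau>" "\<tau> \<le> s"
    and e3: "?D (x + \<sigma> *\<^sub>R u + s *\<^sub>R v) u - ?D (x + \<sigma> *\<^sub>R u) u = ?D2 (x + \<sigma> *\<^sub>R u + \<tau> *\<^sub>R v) ((s - 0) *\<^sub>R v)"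
    by auto
  have "\<phi> s - \<phi> 0 = s * (s * ?D2 (x + \<sigma> *\<^sub>R u + \<tau> *\<^sub>R v) v)"
    using e2 e3 linear_scale[OF has_derivative_linear[OF hd2[OF sub[OF \<sigma> \<tau>]]], of s v] by simp
  then show ?thesis using that[OF \<sigma> \<tau>] by (simp add: \<phi>_def algebra_simps)
qed

text \<open>The second difference over a small parallelogram is symmetric in \<open>u\<close> and
  \<open>v\<close> and equals \<open>s * s\<close> times either mixed derivative at some point of
  it. With \<open>e\<close> half of the supposed gap at \<open>x\<close>, continuity brings both
  values too close together.\<close>

lemma frechet_derivative_symmetric_real:
  fixes f :: "'a::euclidean_space \<Rightarrow> real"
  assumes S: "open S" "Ck_on 2 S f" and x: "x \<in> S"
  shows "fderiv (\<lambda>y. fderiv f y u) x v =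
    fderiv (\<lambda>y. fderiv f y v) x u" (is "?L = ?R")
proof (rule ccontr)
  assume ne: "?L \<noteq> ?R"
  define a where "a = (\<lambda>u v z. fderiv (\<lambda>y. fderiv f y u) z v)"
  have cont: "continuous_on S (a u v)" for u v
    using S(2) by (simp add: numeral_2_eq_2 a_def)
  define e where "e = \<bar>?L - ?R\<bar> / 2"
  have "e > 0" using ne by (simp add: e_def)
  have ex: "\<exists>d>0. \<forall>z. dist z x < d \<longrightarrow> z \<in> S \<and> \<bar>a u v z - a u v x\<bar> < e" for u v
  proof -
    have "continuous (at x) (a u v)"
      using cont continuous_on_eq_continuous_at S(1) x by blast
    then obtain d1 where "d1 > 0" "\<And>z. dist z x < d1 \<Longrightarrow> \<bar>a u v z - a u v x\<bar> < e"
      using \<open>e > 0\<close> unfolding continuous_at_eps_delta by (auto simp: dist_real_def)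
    moreover obtain d2 where "d2 > 0" "\<And>z. dist z x < d2 \<Longrightarrow> z \<in> S"
      using S(1) x unfolding open_dist by blast
    ultimately show ?thesis by (intro exI[of _ "min d1 d2"]) auto
  qed
  obtain d1 where d1: "d1 > 0" "\<And>z. dist z x < d1 \<Longrightarrow> z \<in> S \<and> \<bar>a u v z - a u v x\<bar> < e"
    using ex by blast
  obtain d2 where d2: "d2 > 0" "\<And>z. dist z x < d2 \<Longrightarrow> z \<in> S \<and> \<bar>a v u z - a v u x\<bar> < e"
    using ex by blast
  \<comment> \<open>The summand 1 keeps \<open>N\<close> positive when \<open>u\<close> and
    \<open>v\<close> are both zero; \<open>s\<close> then confines the parallelogram to half of the
    admissible radius.\<close>
  define N where "N = norm u + norm v + 1"
  have N: "N > 0" by (simp add: N_def add_nonneg_pos)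
  define s where "s = min d1 d2 / (2 * N)"
  have s: "s > 0" using d1 d2 N by (simp add: s_def)
  have near: "dist (x + \<sigma> *\<^sub>R u + \<tau> *\<^sub>R v) x < min d1 d2" if "0 \<le> \<sigma>" "\<sigma> \<le> s" "0 \<le> \<tau>" "\<tau> \<le> s" for \<sigma> \<tau>
  proof -
    have "dist (x + \<sigma> *\<^sub>R u + \<tau> *\<^sub>R v) x = norm (\<sigma> *\<^sub>R u + \<tau> *\<^sub>R v)"
      by (simp add: dist_norm algebra_simps)
    also have "\<dots> \<le> \<sigma> * norm u + \<tau> * norm v"
      using that norm_triangle_ineq[of "\<sigma> *\<^sub>R u" "\<tau> *\<^sub>R v"] by simp
    also have "\<dots> \<le> s * norm u + s * norm v" using that by (intro add_mono mult_right_mono) auto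
    also have "\<dots> \<le> s * N" using s by (simp add: N_def algebra_simps)
    also have "\<dots> = min d1 d2 / 2" using N by (simp add: s_def)
    also have "\<dots> < min d1 d2" using d1(1) d2(1) by (simp add: min_def)
    finally show ?thesis .
  qed
  obtain \<sigma> \<tau> where 1: "0 \<le> \<sigma>" "\<sigma> \<le> s" "0 \<le> \<tau>" "\<tau> \<le> s"
    and e1: "f (x + s *\<^sub>R u + s *\<^sub>R v) - f (x + s *\<^sub>R u) - f (x + s *\<^sub>R v) + f x = s * (s * a u v (x + \<sigma> *\<^sub>R u + \<tau> *\<^sub>R v))"
    using mixed_difference_mvt[OF S s, of x u v] near d1(2) unfolding a_def by (metis min_less_iff_conj)
  have near': "dist (x + \<sigma> *\<^sub>R v + \<tau> *\<^sub>R u) x < min d1 d2" if "0 \<le> \<sigma>" "\<sigma> \<le> s" "0 \<le> \<tau>" "\<tau> \<le> s" for \<sigma> \<tau>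
    using near[of \<tau> \<sigma>] that by (simp add: add_ac)
  obtain \<sigma>' \<tau>' where 2: "0 \<le> \<sigma>'" "\<sigma>' \<le> s" "0 \<le> \<tau>'" "\<tau>' \<le> s"
    and e2: "f (x + s *\<^sub>R v + s *\<^sub>R u) - f (x + s *\<^sub>R v) - f (x + s *\<^sub>R u) + f x = s * (s * a v u (x + \<sigma>' *\<^sub>R v + \<tau>' *\<^sub>R u))"
    using mixed_difference_mvt[OF S s, of x v u] near' d1(2) unfolding a_def by (metis min_less_iff_conj)
  have "a u v (x + \<sigma> *\<^sub>R u + \<tau> *\<^sub>R v) = a v u (x + \<sigma>' *\<^sub>R v + \<tau>' *\<^sub>R u)"
  proof -
    have "f (x + s *\<^sub>R v + s *\<^sub>R u) = f (x + s *\<^sub>R u + s *\<^sub>R v)" by (simp add: add_ac)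
    then have "s * (s * a u v (x + \<sigma> *\<^sub>R u + \<tau> *\<^sub>R v)) = s * (s * a v u (x + \<sigma>' *\<^sub>R v + \<tau>' *\<^sub>R u))"
      using e1 e2 by linarith
    then show ?thesis using s by simp
  qed
  moreover have "\<bar>a u v (x + \<sigma> *\<^sub>R u + \<tau> *\<^sub>R v) - a u v x\<bar> < e"
    using d1(2) near[OF 1] by simp
  moreover have "\<bar>a v u (x + \<sigma>' *\<^sub>R v + \<tau>' *\<^sub>R u) - a v u x\<bar> < e"
    using d2(2) near'[OF 2] by simp
  ultimately have "\<bar>a u v x - a v u x\<bar> < 2 * e" by linarith
  then show False by (simp add: e_def a_def)
qed

lemma frechet_derivative_symmetric:
  fixes f :: "'a::euclidean_space \<Rightarrow> 'b::euclidean_space"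
  assumes S: "open S" "Ck_on 2 S f" and x: "x \<in> S"
  shows "fderiv (\<lambda>y. fderiv f y u) x v =
    fderiv (\<lambda>y. fderiv f y v) x u"
proof (rule euclidean_eqI)
  fix b :: 'b assume "b \<in> Basis"
  have C2: "Ck_on (Suc (Suc 0)) S f" using S(2) by (simp add: numeral_2_eq_2)
  have 1: "fderiv (\<lambda>y. f y \<bullet> b) y w = fderiv f y w \<bullet> b" if "y \<in> S" for y w
    using frechet_derivative_at[OF bounded_linear.has_derivative[OF bounded_linear_inner_left Ck_on_SucD[OF C2 that]]]
    by metis
  have 2: "fderiv (\<lambda>y. fderiv (\<lambda>y. f y \<bullet> b) y w) x z
      = fderiv (\<lambda>y. fderiv f y w) x z \<bullet> b" for w z
  proof -
    have "((\<lambda>y. fderiv f y w) has_derivative fderiv (\<lambda>y. fderiv f y w) x) (at x)"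
      using C2 x by (auto simp: frechet_derivative_works)
    from bounded_linear.has_derivative[OF bounded_linear_inner_left this]
    have "((\<lambda>y. fderiv f y w \<bullet> b) has_derivative (\<lambda>z. fderiv (\<lambda>y. fderiv f y w) x z \<bullet> b)) (at x)" .
    from has_derivative_transform_within_open[OF this S(1) x]
    have "((\<lambda>y. fderiv (\<lambda>y. f y \<bullet> b) y w) has_derivative (\<lambda>z. fderiv (\<lambda>y. fderiv f y w) x z \<bullet> b)) (at x)"
      using 1 by metis
    from frechet_derivative_at[OF this] show ?thesis by metis
  qed
  have "Ck_on 2 S (\<lambda>y. f y \<bullet> b)"
    by (rule Ck_on_bounded_linear[OF S(1) bounded_linear_inner_left S(2)])
  from frechet_derivative_symmetric_real[OF S(1) this x, of u v]
  show "fderiv (\<lambda>y. fderiv f y u) x v \<bullet> b =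
    fderiv (\<lambda>y. fderiv f y v) x u \<bullet> b"
    by (simp add: 2)
qed

section \<open>Flows of time-dependent vector fields\<close>

text \<open>Curves over \<open>[0, 1]\<close> are represented by bounded continuous functions on the real line, of which
  only the restriction to \<open>[0, 1]\<close> matters.\<close>

definition clamp01 :: "real \<Rightarrow> real" where
  "clamp01 t = max 0 (min 1 t)"

lemma clamp01_in [simp]: "0 \<le> clamp01 t" "clamp01 t \<le> 1"
  by (auto simp: clamp01_def)

lemma clamp01_id: "t \<in> {0..1} \<Longrightarrow> clamp01 t = t"
  by (auto simp: clamp01_def)

lemma continuous_on_clamp01: "continuous_on A clamp01"
  unfolding clamp01_def by (intro continuous_intros)

lemma bcontfun_clamp01:
  assumes "continuous_on {0..1} f"
  shows "(\<lambda>t. f (clamp01 t)) \<in> bcontfun"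
proof -
  have "continuous_on UNIV (\<lambda>t. f (clamp01 t))"
    by (rule continuous_on_compose2[OF assms continuous_on_clamp01]) auto
  moreover have "bounded (range (\<lambda>t. f (clamp01 t)))"
    by (rule bounded_subset[OF compact_imp_bounded[OF compact_continuous_image[OF assms]]]) auto
  ultimately show ?thesis by (simp add: bcontfun_def)
qed

definition bc_integral :: "(real \<Rightarrow>\<^sub>C 'e::euclidean_space) \<Rightarrow> real \<Rightarrow>\<^sub>C 'e" where
  "bc_integral u = Bcontfun (\<lambda>t. integral {0..clamp01 t} u)"

lemma bcontfun_integrable: "apply_bcontfun u integrable_on {a..b::real}"
  for u :: "real \<Rightarrow>\<^sub>C 'e::euclidean_space"
  by (rule integrable_continuous_real) simp

lemma apply_bc_integral: "apply_bcontfun (bc_integral u) t = integral {0..clamp01 t} u"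
proof -
  have "continuous_on {0..1} (\<lambda>t. integral {0..t} u)"
    by (rule indefinite_integral_continuous_1) (rule bcontfun_integrable)
  from fun_cong[OF Bcontfun_inverse[OF bcontfun_clamp01[OF this]], of t] show ?thesis
    unfolding bc_integral_def .
qed

text \<open>The constant is 1 because the time interval has length 1. A pointwise Lipschitz constant
  1/2 of a vector field thereby passes unchanged to the Picard operator.\<close>

lemma norm_bc_integral_le:
  assumes "\<And>t. t \<in> {0..1} \<Longrightarrow> norm (apply_bcontfun u t) \<le> B"
  shows "norm (bc_integral u) \<le> B"
proof (rule norm_bound)
  fix t
  have B: "0 \<le> B" using order_trans[OF norm_ge_zero assms[of 0]] by simp
  have "norm (u s) \<le> B" if "s \<in> cbox 0 (clamp01 t)" for s
    using assms[of s] that clamp01_in(2)[of t] by (simp del: clamp01_in)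
  moreover have "apply_bcontfun u integrable_on cbox 0 (clamp01 t)"
    unfolding cbox_interval by (rule bcontfun_integrable)
  ultimately have "norm (integral (cbox 0 (clamp01 t)) u) \<le> B * measure lborel (cbox 0 (clamp01 t))"
    using integrable_bound[OF B] by blast
  also have "\<dots> \<le> B * 1" using B by (intro mult_left_mono) auto
  finally show "norm (apply_bcontfun (bc_integral u) t) \<le> B" by (simp add: apply_bc_integral)
qed

lemma bounded_linear_bc_integral: "bounded_linear (bc_integral :: (real \<Rightarrow>\<^sub>C 'e::euclidean_space) \<Rightarrow> _)"
proof (rule bounded_linear_intro[where K = 1])
  show "bc_integral (u + v) = bc_integral u + bc_integral v" for u v :: "real \<Rightarrow>\<^sub>C 'e"
    by (rule bcontfun_eqI) (simp add: apply_bc_integral integral_add bcontfun_integrable)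
  show "bc_integral (r *\<^sub>R u) = r *\<^sub>R bc_integral u" for r and u :: "real \<Rightarrow>\<^sub>C 'e"
    by (rule bcontfun_eqI) (simp add: apply_bc_integral)
  show "norm (bc_integral u) \<le> norm u * 1" for u :: "real \<Rightarrow>\<^sub>C 'e"
    by (simp add: norm_bc_integral_le norm_bounded)
qed

text \<open>The superposition (Nemytskii) operator of \<open>G\<close>. Clamping both occurrences of
  the time makes only the graph over \<open>{0..1}\<close>, a compact set, matter.\<close>

definition superpos :: "(real \<times> 'e::euclidean_space \<Rightarrow> 'f::real_normed_vector) \<Rightarrow> (real \<Rightarrow>\<^sub>C 'e) \<Rightarrow> real \<Rightarrow>\<^sub>C 'f" where
  "superpos G u = Bcontfun (\<lambda>t. G (clamp01 t, u (clamp01 t)))"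

lemma apply_superpos:
  assumes "continuous_on Q G" "\<And>t. t \<in> {0..1} \<Longrightarrow> (t, apply_bcontfun u t) \<in> Q"
  shows "apply_bcontfun (superpos G u) t = G (clamp01 t, u (clamp01 t))"
proof -
  have "continuous_on {0..1} (\<lambda>t. G (t, u t))"
    by (rule continuous_on_compose2[OF assms(1)]) (use assms(2) in \<open>auto intro!: continuous_on_Pair continuous_on_id\<close>)
  from fun_cong[OF Bcontfun_inverse[OF bcontfun_clamp01[OF this]], of t] show ?thesis
    unfolding superpos_def .
qed

text \<open>Multiplication of the curve \<open>w\<close> by the \<open>b\<close>-component of
  \<open>h\<close>. Summed over the basis, with partial derivatives of \<open>G\<close> along
  \<open>u\<close> for \<open>w\<close>, it is the derivative of \<open>superpos G\<close> at
  \<open>u\<close>. This form keeps it bilinear in curves, so that the product rules for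
  \<open>Ck_on\<close> apply.\<close>

definition bc_scale :: "'e \<Rightarrow> (real \<Rightarrow>\<^sub>C 'f::real_normed_vector) \<Rightarrow> (real \<Rightarrow>\<^sub>C 'e::euclidean_space) \<Rightarrow> real \<Rightarrow>\<^sub>C 'f" where
  "bc_scale b w h = Bcontfun (\<lambda>t. (h (clamp01 t) \<bullet> b) *\<^sub>R w (clamp01 t))"

lemma apply_bc_scale: "apply_bcontfun (bc_scale b w h) t = (h (clamp01 t) \<bullet> b) *\<^sub>R w (clamp01 t)"
proof -
  have "continuous_on {0..1} (\<lambda>t. (h t \<bullet> b) *\<^sub>R w t)" by (intro continuous_intros) auto
  from fun_cong[OF Bcontfun_inverse[OF bcontfun_clamp01[OF this]], of t] show ?thesis
    unfolding bc_scale_def .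
qed

lemma bounded_bilinear_bc_scale:
  "bounded_bilinear (bc_scale b :: (real \<Rightarrow>\<^sub>C 'f::real_normed_vector) \<Rightarrow> (real \<Rightarrow>\<^sub>C 'e::euclidean_space) \<Rightarrow> _)"
proof (rule bounded_bilinear.intro)
  show "\<exists>K. \<forall>(w :: real \<Rightarrow>\<^sub>C 'f) (h :: real \<Rightarrow>\<^sub>C 'e). norm (bc_scale b w h) \<le> norm w * norm h * K"
  proof (intro exI allI)
    fix w :: "real \<Rightarrow>\<^sub>C 'f" and h :: "real \<Rightarrow>\<^sub>C 'e"
    show "norm (bc_scale b w h) \<le> norm w * norm h * norm b"
    proof (rule norm_bound)
      fix t
      have "\<bar>h (clamp01 t) \<bullet> b\<bar> \<le> norm (h (clamp01 t)) * norm b" by (rule Cauchy_Schwarz_ineq2)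
      also have "\<dots> \<le> norm h * norm b" by (intro mult_right_mono norm_bounded) simp
      finally have "\<bar>h (clamp01 t) \<bullet> b\<bar> * norm (w (clamp01 t)) \<le> (norm h * norm b) * norm w"
        by (intro mult_mono norm_bounded) auto
      then show "norm (apply_bcontfun (bc_scale b w h) t) \<le> norm w * norm h * norm b"
        by (simp add: apply_bc_scale mult_ac)
    qed
  qed
qed (rule bcontfun_eqI; simp add: apply_bc_scale algebra_simps inner_add_left)+

text \<open>A thin closed tube around the compact set is itself compact and lies in
  \<open>Q\<close>, so uniform continuity holds on the tube and \<open>z'\<close> may leave
  \<Gamma>.\<close>

lemma uniformly_continuous_near_compact:
  fixes G :: "'a::{heine_borel} \<Rightarrow> 'b::metric_space"
  assumes "compact \<Gamma>" "open Q" "\<Gamma> \<subseteq> Q" "continuous_on Q G" "e > 0"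
  obtains d where "d > 0" "\<And>z z'. z \<in> \<Gamma> \<Longrightarrow> dist z' z < d \<Longrightarrow> z' \<in> Q \<and> dist (G z') (G z) < e"
proof (cases "\<Gamma> = {}")
  case True
  then show ?thesis using that[of 1] by simp
next
  case False
  obtain r where r: "r > 0" "{x. infdist x \<Gamma> \<le> r} \<subseteq> Q"
    using compact_in_open_separated[OF False assms(1-3)] by blast
  have "compact {x. infdist x \<Gamma> \<le> r}"
    by (rule compact_infdist_le[OF False assms(1) r(1)])
  then have "uniformly_continuous_on {x. infdist x \<Gamma> \<le> r} G"
    using compact_uniformly_continuous continuous_on_subset[OF assms(4) r(2)] by blast
  then obtain d where d: "d > 0" "\<And>x x'. infdist x \<Gamma> \<le> r \<Longrightarrow> infdist x' \<Gamma> \<le> r \<Longrightarrow> dist x' x < d \<Longrightarrow> dist (G x') (G x) < e"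
    unfolding uniformly_continuous_on_def using assms(5) by blast
  show ?thesis
  proof (rule that[of "min d r"])
    fix z z' assume z: "z \<in> \<Gamma>" "dist z' z < min d r"
    have "infdist z' \<Gamma> \<le> dist z' z" by (rule infdist_le[OF z(1)])
    then have 1: "infdist z' \<Gamma> \<le> r" using z(2) by simp
    moreover have "infdist z \<Gamma> \<le> r" using z(1) r(1) by simp
    ultimately show "z' \<in> Q \<and> dist (G z') (G z) < e" using d(2)[of z z'] r(2) z(2) by auto
  qed (use d r in auto)
qed

lemma compact_graph: "compact ((\<lambda>t. (t, apply_bcontfun u t)) ` {0..1::real})"
  for u :: "real \<Rightarrow>\<^sub>C 'e::euclidean_space"
  by (rule compact_continuous_image) (auto intro!: continuous_on_Pair continuous_on_id)

lemma dist_bcontfun_le: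
  fixes u v :: "real \<Rightarrow>\<^sub>C 'f::real_normed_vector"
  assumes "\<And>t. norm (u t - v t) \<le> e"
  shows "norm (u - v) \<le> e"
  by (rule norm_bound) (simp add: assms)

lemma continuous_superpos:
  fixes G :: "real \<times> 'e::euclidean_space \<Rightarrow> 'f::real_normed_vector"
  assumes "open Q" "continuous_on Q G" "\<And>t. t \<in> {0..1} \<Longrightarrow> (t, apply_bcontfun u t) \<in> Q"
  shows "continuous (at u) (superpos G)"
  unfolding continuous_at_eps_delta
proof (intro allI impI)
  fix e :: real assume e: "e > 0"
  \<comment> \<open>Half of \<open>e\<close> is used because the supremum over \<open>t\<close> only
    preserves the weak inequality.\<close>
  obtain d where d: "d > 0" "\<And>z z'. z \<in> (\<lambda>t. (t, u t)) ` {0..1} \<Longrightarrow> dist z' z < d \<Longrightarrow> z' \<in> Q \<and> dist (G z') (G z) < e / 2"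
    by (rule uniformly_continuous_near_compact[OF compact_graph[of u] assms(1) _ assms(2), of "e / 2"])
       (use assms(3) e in auto)
  show "\<exists>d>0. \<forall>v. dist v u < d \<longrightarrow> dist (superpos G v) (superpos G u) < e"
  proof (intro exI[of _ d] conjI allI impI d(1))
    fix v assume v: "dist v u < d"
    have near: "(t, v t) \<in> Q \<and> dist (G (t, v t)) (G (t, u t)) < e / 2" if "t \<in> {0..1}" for t
    proof (rule d(2))
      have "dist (v t) (u t) \<le> dist v u" by (rule dist_bounded)
      then show "dist (t, v t) (t, u t) < d" using v by (simp add: dist_Pair_Pair)
    qed (use that in auto)
    have "norm (superpos G v - superpos G u) \<le> e / 2"
    proof (rule dist_bcontfun_le)
      fix t
      have "apply_bcontfun (superpos G v) t = G (clamp01 t, v (clamp01 t))"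
        by (rule apply_superpos[OF assms(2)]) (use near in auto)
      moreover have "apply_bcontfun (superpos G u) t = G (clamp01 t, u (clamp01 t))"
        by (rule apply_superpos[OF assms(2)]) (use assms(3) in auto)
      ultimately show "norm (superpos G v t - superpos G u t) \<le> e / 2"
        using near[of "clamp01 t"] by (simp add: dist_norm)
    qed
    then show "dist (superpos G v) (superpos G u) < e" using e by (simp add: dist_norm)
  qed
qed

lemma apply_superpos_derivative:
  fixes G :: "real \<times> 'e::euclidean_space \<Rightarrow> 'f::real_normed_vector"
  assumes G: "Ck_on (Suc 0) Q G" and u: "\<And>t. t \<in> {0..1} \<Longrightarrow> (t, apply_bcontfun u t) \<in> Q"
  shows "(\<Sum>b\<in>Basis. bc_scale b (superpos (\<lambda>z. fderiv G z (0, b)) u) h) t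
    = fderiv G (clamp01 t, u (clamp01 t)) (0, h (clamp01 t))" (is "?L t = _")
proof -
  have cdG: "continuous_on Q (\<lambda>z. fderiv G z w)" for w
    using G by (simp only: Ck_on.simps)
  have hd: "(G has_derivative fderiv G z) (at z)" if "z \<in> Q" for z
    using Ck_on_SucD[OF G that] .
  let ?z = "(clamp01 t, u (clamp01 t))"
  have "?z \<in> Q" using u by auto
  interpret D: bounded_linear "fderiv G ?z"
    using has_derivative_bounded_linear[OF hd[OF \<open>?z \<in> Q\<close>]] .
  have sp: "superpos (\<lambda>z. fderiv G z (0, b)) u (clamp01 t) = fderiv G ?z (0, b)" for b
    using apply_superpos[OF cdG u, of "(0, b)" "clamp01 t"] by (simp add: clamp01_id)
  have app: "apply_bcontfun (\<Sum>b\<in>B. f b) t = (\<Sum>b\<in>B. f b t)" if "finite B" for B and f :: "'e \<Rightarrow> real \<Rightarrow>\<^sub>C 'f"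
    using that by induction auto
  have "?L t = (\<Sum>b\<in>Basis. (h (clamp01 t) \<bullet> b) *\<^sub>R fderiv G ?z (0, b))"
    by (simp add: app apply_bc_scale sp)
  also have "\<dots> = fderiv G ?z (\<Sum>b\<in>Basis. (h (clamp01 t) \<bullet> b) *\<^sub>R (0, b))"
    by (simp add: D.sum D.scaleR del: scaleR_Pair)
  also have "(\<Sum>b\<in>Basis. (h (clamp01 t) \<bullet> b) *\<^sub>R (0::real, b)) = (0, h (clamp01 t))"
    by (simp add: sum_prod euclidean_representation)
  finally show ?thesis .
qed

text \<open>The linearisation error of \<open>G\<close> on the segment from \<open>(t, u t)\<close>
  to \<open>(t, v t)\<close> is bounded by the oscillation of its derivative there. Compactness of
  the graph makes this bound uniform in \<open>t\<close>, hence a bound in the norm of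
  curves.\<close>

lemma has_derivative_superpos:
  fixes G :: "real \<times> 'e::euclidean_space \<Rightarrow> 'f::real_normed_vector"
  assumes Q: "open Q" and G: "Ck_on (Suc 0) Q G" and u: "\<And>t. t \<in> {0..1} \<Longrightarrow> (t, apply_bcontfun u t) \<in> Q"
  shows "(superpos G has_derivative
    (\<lambda>h. \<Sum>b\<in>Basis. bc_scale b (superpos (\<lambda>z. fderiv G z (0, b)) u) h)) (at u)"
    (is "(_ has_derivative ?L) _")
proof -
  have cG: "continuous_on Q G" using G by (rule Ck_on_imp_continuous_on)
  have hd: "(G has_derivative fderiv G z) (at z)" if "z \<in> Q" for z
    using Ck_on_SucD[OF G that] .

  have blL: "bounded_linear ?L"
    by (intro bounded_linear_sum bounded_bilinear.bounded_linear_right[OF bounded_bilinear_bc_scale])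
  show ?thesis
    unfolding has_derivative_at_alt
  proof (intro conjI blL allI impI)
    fix e :: real assume e: "e > 0"
    define DG where "DG = (\<lambda>z. Blinfun (fderiv G z))"
    have DG: "blinfun_apply (DG z) = fderiv G z" if "z \<in> Q" for z
      unfolding DG_def using has_derivative_bounded_linear[OF hd[OF that]] by (simp add: bounded_linear_Blinfun_apply)
    have "continuous_on Q DG" using Ck_on_frechet_blinfun[OF Q G] by (simp add: DG_def)
    then obtain d where d: "d > 0" "\<And>z z'. z \<in> (\<lambda>t. (t, u t)) ` {0..1} \<Longrightarrow> dist z' z < d \<Longrightarrow> z' \<in> Q \<and> dist (DG z') (DG z) < e"
      using uniformly_continuous_near_compact[OF compact_graph[of u] Q _ _ e, of DG] u by blast
    show "\<exists>d>0. \<forall>v. norm (v - u) < d \<longrightarrow> norm (superpos G v - superpos G u - ?L (v - u)) \<le> e * norm (v - u)"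
    proof (intro exI[of _ d] conjI allI impI d(1))
      fix v assume v: "norm (v - u) < d"
      have near: "(t, v t) \<in> Q" "norm (G (t, v t) - G (t, u t) - fderiv G (t, u t) (0, v t - u t)) \<le> e * norm (v - u)"
        if t: "t \<in> {0..1}" for t
      proof -
        let ?S = "ball (t, u t) d"
        have n: "norm (v t - u t) \<le> norm (v - u)" using norm_bounded[of "v - u" t] by simp
        have SQ: "z \<in> Q" "norm (DG z - DG (t, u t)) \<le> e" if "z \<in> ?S" for z
          using d(2)[of "(t, u t)" z] t that by (auto simp: dist_norm norm_minus_commute less_imp_le)
        have mem: "(t, u t) + \<tau> *\<^sub>R ((t, v t) - (t, u t)) \<in> ?S" if "\<tau> \<in> {0..1}" for \<tau>
        proof -
          have "\<tau> * norm (v t - u t) \<le> 1 * norm (v t - u t)" using that by (intro mult_right_mono) auto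
          then have "norm (\<tau> *\<^sub>R (v t - u t)) < d" using n v that by simp
          then show ?thesis by (simp add: dist_norm norm_Pair)
        qed
        show "(t, v t) \<in> Q" using SQ(1)[OF mem[of 1]] by simp
        have "norm (G (t, v t) - G (t, u t) - DG (t, u t) ((t, v t) - (t, u t))) \<le> norm ((t, v t) - (t, u t)) * e"
        proof (rule differentiable_bound_linearization[where S = ?S and f' = "\<lambda>z. blinfun_apply (DG z)"])
          show "(G has_derivative blinfun_apply (DG z)) (at z within ?S)" if "z \<in> ?S" for z
            using hd[OF SQ(1)[OF that]] DG[OF SQ(1)[OF that]] has_derivative_at_withinI by metis
          have "blinfun_apply (DG z) - blinfun_apply (DG (t, u t)) = blinfun_apply (DG z - DG (t, u t))" for z
            by (rule ext) (simp add: blinfun.diff_left)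
          then show "onorm (blinfun_apply (DG z) - blinfun_apply (DG (t, u t))) \<le> e" if "z \<in> ?S" for z
            using SQ(2)[OF that] by (simp add: norm_blinfun.rep_eq)
        qed (use mem d in \<open>auto simp: closed_segment_def\<close>)
        then have "norm (G (t, v t) - G (t, u t) - fderiv G (t, u t) (0, v t - u t)) \<le> norm (v t - u t) * e"
          using DG[OF u[OF t]] by (simp add: norm_Pair)
        also have "\<dots> \<le> e * norm (v - u)" using n e by (simp add: mult.commute)
        finally show "norm (G (t, v t) - G (t, u t) - fderiv G (t, u t) (0, v t - u t)) \<le> e * norm (v - u)" .
      qed
      show "norm (superpos G v - superpos G u - ?L (v - u)) \<le> e * norm (v - u)"
      proof (rule norm_bound)
        fix t
        have "apply_bcontfun (superpos G v) t = G (clamp01 t, v (clamp01 t))"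
          by (rule apply_superpos[OF cG]) (use near(1) in auto)
        moreover have "apply_bcontfun (superpos G u) t = G (clamp01 t, u (clamp01 t))"
          by (rule apply_superpos[OF cG u])
        moreover have "?L (v - u) t = fderiv G (clamp01 t, u (clamp01 t)) (0, v (clamp01 t) - u (clamp01 t))"
          using apply_superpos_derivative[where u = u and h = "v - u" and t = t, OF G u] by simp
        ultimately show "norm ((superpos G v - superpos G u - ?L (v - u)) t) \<le> e * norm (v - u)"
          using near(2)[of "clamp01 t"] by (simp only: minus_bcontfun.rep_eq) simp
      qed
    qed
  qed
qed

text \<open>Formulated after composition with \<open>U\<close> because \<open>Ck_on\<close> needs a
  Euclidean domain. The derivative combines superpositions of partial derivatives of
  \<open>G\<close> with the derivative of \<open>U\<close>, so the induction generalises over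
  \<open>G\<close> while \<open>U\<close> stays fixed.\<close>

lemma Ck_on_superpos:
  fixes G :: "real \<times> 'e::euclidean_space \<Rightarrow> 'f::real_normed_vector" and U :: "'a::euclidean_space \<Rightarrow> real \<Rightarrow>\<^sub>C 'e"
  assumes Q: "open Q" and S: "open S" and graph: "\<And>x t. x \<in> S \<Longrightarrow> t \<in> {0..1} \<Longrightarrow> (t, apply_bcontfun (U x) t) \<in> Q"
    and "Ck_on k Q G" "Ck_on k S U"
  shows "Ck_on k S (\<lambda>x. superpos G (U x))"
  using assms(4,5)
proof (induction k arbitrary: G)
  case 0
  have cU: "continuous_on S U" and cG: "continuous_on Q G" using 0 by simp_all
  have "continuous (at x) (\<lambda>x. superpos G (U x))" if x: "x \<in> S" for x
  proof (rule isCont_o2[where f = U and g = "superpos G"])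
    show "continuous (at (U x)) (superpos G)" by (rule continuous_superpos[OF Q cG graph[OF x]])
    show "continuous (at x) U" using cU S x continuous_on_eq_continuous_at by blast
  qed
  then show ?case by (simp add: continuous_at_imp_continuous_on)
next
  case (Suc k)
  let ?dG = "\<lambda>b z. fderiv G z (0, b)"
  have G1: "Ck_on (Suc 0) Q G"
    using Suc.prems(1) Ck_on_imp_continuous_on by (simp) blast
  show ?case
  proof (rule Ck_on_SucI[OF S])
    show "((\<lambda>x. superpos G (U x)) has_derivative
      (\<lambda>v. \<Sum>b\<in>Basis. bc_scale b (superpos (?dG b) (U x)) (fderiv U x v))) (at x)" if "x \<in> S" for x
      by (rule has_derivative_compose[OF Ck_on_SucD[OF Suc.prems(2) that] has_derivative_superpos[OF Q G1 graph[OF that]]])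
    show "Ck_on k S (\<lambda>x. \<Sum>b\<in>Basis. bc_scale b (superpos (?dG b) (U x)) (fderiv U x v))" for v
    proof (intro Ck_on_sum[OF S] Ck_on_bilinear[OF S bounded_bilinear_bc_scale])
      show "Ck_on k S (\<lambda>x. superpos (?dG b) (U x))" for b
        by (rule Suc.IH) (use Suc.prems Ck_on_Suc_imp_Ck_on in auto)
    qed (use Suc.prems in simp)
  qed
qed

text \<open>\<Psi> inverts \<open>u - P u\<close>: its value at \<open>z\<close> is the unique fixed
  point of the contraction \<open>z + P u\<close>. The Lipschitz constant 2 is 1 / (1 -
  1/2).\<close>

lemma contraction_perturbation:
  fixes P :: "'b::{real_normed_vector, complete_space} \<Rightarrow> 'b"
  assumes P: "\<And>u v. norm (P u - P v) \<le> norm (u - v) / 2"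
  obtains \<Psi> where "\<And>z. \<Psi> z = z + P (\<Psi> z)" "\<And>u z. u = z + P u \<Longrightarrow> u = \<Psi> z"
    "\<And>z z'. norm (\<Psi> z - \<Psi> z') \<le> 2 * norm (z - z')"
proof -
  have "\<exists>!u. z + P u = u" for z
    by (rule banach_fix_type[of "1/2"]) (use P in \<open>auto simp: dist_norm\<close>)
  then obtain \<Psi> where \<Psi>: "\<And>z. z + P (\<Psi> z) = \<Psi> z" "\<And>u z. z + P u = u \<Longrightarrow> u = \<Psi> z"
    by metis
  have "norm (\<Psi> z - \<Psi> z') \<le> 2 * norm (z - z')" for z z'
  proof -
    have "\<Psi> z - \<Psi> z' = (z + P (\<Psi> z)) - (z' + P (\<Psi> z'))" by (simp only: \<Psi>(1))
    also have "\<dots> = (z - z') + (P (\<Psi> z) - P (\<Psi> z'))" by simp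
    finally have "norm (\<Psi> z - \<Psi> z') \<le> norm (z - z') + norm (P (\<Psi> z) - P (\<Psi> z'))"
      using norm_triangle_ineq[of "z - z'" "P (\<Psi> z) - P (\<Psi> z')"] by simp
    with P[of "\<Psi> z" "\<Psi> z'"] show ?thesis by simp
  qed
  with \<Psi> show ?thesis by (metis that)
qed

text \<open>The inverse given by the contraction principle is linear by uniqueness of fixed points:
  sums and multiples of solutions solve the equation for the sums and multiples of the data.\<close>

lemma blinfun_neumann_inverse:
  fixes A :: "'b::{real_normed_vector, complete_space} \<Rightarrow>\<^sub>L 'b"
  assumes A: "\<And>h. norm (A h) \<le> norm h / 2"
  obtains B :: "'b \<Rightarrow>\<^sub>L 'b" where "\<And>v. B (v - A v) = v" "\<And>v. B v - A (B v) = v"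
proof -
  have "norm (A u - A v) \<le> norm (u - v) / 2" for u v
    using A[of "u - v"] by (simp add: blinfun.diff_right)
  then obtain \<Psi> where \<Psi>: "\<And>z. \<Psi> z = z + A (\<Psi> z)" "\<And>u z. u = z + A u \<Longrightarrow> u = \<Psi> z"
    "\<And>z z'. norm (\<Psi> z - \<Psi> z') \<le> 2 * norm (z - z')"
    by (rule contraction_perturbation) (rule that; assumption)
  have "bounded_linear \<Psi>"
  proof (rule bounded_linear_intro[where K = 2])
    show "\<Psi> (x + y) = \<Psi> x + \<Psi> y" for x y
    proof -
      have "\<Psi> x + \<Psi> y = (x + A (\<Psi> x)) + (y + A (\<Psi> y))" using \<Psi>(1) by metis
      also have "\<dots> = (x + y) + A (\<Psi> x + \<Psi> y)" by (simp add: blinfun.add_right)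
      finally have "\<Psi> x + \<Psi> y = (x + y) + A (\<Psi> x + \<Psi> y)" .
      from \<Psi>(2)[OF this] show ?thesis ..
    qed
    show "\<Psi> (r *\<^sub>R x) = r *\<^sub>R \<Psi> x" for r x
    proof -
      have "r *\<^sub>R \<Psi> x = r *\<^sub>R (x + A (\<Psi> x))" using \<Psi>(1) by metis
      also have "\<dots> = r *\<^sub>R x + A (r *\<^sub>R \<Psi> x)" by (simp add: blinfun.scaleR_right scaleR_add_right)
      finally have "r *\<^sub>R \<Psi> x = r *\<^sub>R x + A (r *\<^sub>R \<Psi> x)" .
      from \<Psi>(2)[OF this] show ?thesis ..
    qed
    have "0 = \<Psi> 0" by (rule \<Psi>(2)) simp
    then show "norm (\<Psi> x) \<le> norm x * 2" for x using \<Psi>(3)[of x 0] by simp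
  qed
  then have app: "blinfun_apply (Blinfun \<Psi>) = \<Psi>" by (rule bounded_linear_Blinfun_apply)
  have 1: "\<Psi> (v - A v) = v" for v using \<Psi>(2)[of v "v - A v"] by simp
  have 2: "\<Psi> v - A (\<Psi> v) = v" for v using \<Psi>(1)[of v] by (simp add: algebra_simps)
  show ?thesis by (rule that[of "Blinfun \<Psi>"]) (simp_all only: app 1 2)
qed

lemma bounded_linear_const_bcontfun: "bounded_linear (const_bcontfun :: 'f::real_normed_vector \<Rightarrow> real \<Rightarrow>\<^sub>C 'f)"
proof (rule bounded_linear_intro[where K = 1])
  show "norm (const_bcontfun x :: real \<Rightarrow>\<^sub>C 'f) \<le> norm x * 1" for x :: 'f
    by (rule norm_bound) (simp add: const_bcontfun.rep_eq)
qed (rule bcontfun_eqI; simp add: const_bcontfun.rep_eq)+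

lemma bounded_linear_apply_bcontfun: "bounded_linear (\<lambda>u :: real \<Rightarrow>\<^sub>C 'f::real_normed_vector. apply_bcontfun u t)"
  by (rule bounded_linear_intro[where K = 1]) (auto simp: norm_bounded)

lemma bc_integral_has_vector_derivative:
  assumes "u = const_bcontfun c + bc_integral f" "t \<in> {0..1}"
  shows "((\<lambda>t. apply_bcontfun u t) has_vector_derivative f t) (at t within {0..1})"
proof -
  have "((\<lambda>t. c + integral {0..t} f) has_vector_derivative 0 + f t) (at t within {0..1})"
    by (intro has_vector_derivative_add has_vector_derivative_const integral_has_vector_derivative assms(2)) simp
  then show ?thesis
    unfolding add_0
    by (rule has_vector_derivative_transform[OF assms(2), rotated])
       (simp add: assms(1) const_bcontfun.rep_eq apply_bc_integral clamp01_id)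
qed

text \<open>The flow is the fixed point of the Picard operator on curves. Replacing \<open>g\<close> by its composition with
  the nearest point projection onto the ball makes that operator a contraction of the whole space
  of curves, without changing it near the curves that stay inside the ball.\<close>

theorem smooth_flow:
  fixes g :: "real \<times> 'e::euclidean_space \<Rightarrow> 'e"
  assumes Q: "open Q" and g: "smooth_on Q g" and \<rho>: "\<rho> > 0" and sub: "{0..1} \<times> cball 0 \<rho> \<subseteq> Q"
    and g0: "\<And>t. t \<in> {0..1} \<Longrightarrow> g (t, 0) = 0"
    and bound: "\<And>t y v. t \<in> {0..1} \<Longrightarrow> y \<in> cball 0 \<rho> \<Longrightarrow> norm (fderiv g (t, y) (0, v)) \<le> norm v / 2"
  obtains \<Phi> :: "real \<Rightarrow> 'e \<Rightarrow> 'e" where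
    "\<And>t. smooth_on (ball 0 (\<rho> / 2)) (\<Phi> t)"
    "\<And>x. x \<in> ball 0 (\<rho> / 2) \<Longrightarrow> \<Phi> 0 x = x"
    "\<And>t. \<Phi> t 0 = 0"
    "\<And>t x. x \<in> ball 0 (\<rho> / 2) \<Longrightarrow> \<Phi> t x \<in> ball 0 \<rho>"
    "\<And>t x. x \<in> ball 0 (\<rho> / 2) \<Longrightarrow> t \<in> {0..1} \<Longrightarrow>
      ((\<lambda>t. \<Phi> t x) has_vector_derivative g (t, \<Phi> t x)) (at t within {0..1})"
    "\<And>t x v. x \<in> ball 0 (\<rho> / 2) \<Longrightarrow> t \<in> {0..1} \<Longrightarrow>
      ((\<lambda>t. fderiv (\<Phi> t) x v) has_vector_derivative
        fderiv g (t, \<Phi> t x) (0, fderiv (\<Phi> t) x v)) (at t within {0..1})"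
proof -
  let ?K = "cball (0::'e) \<rho>" and ?S = "ball (0::'e) (\<rho> / 2)"
  have Ckg: "Ck_on k Q g" for k using g by (simp add: smooth_on_def)
  have cg: "continuous_on Q g" using Ck_on_imp_continuous_on[OF Ckg] .
  have hdg: "(g has_derivative fderiv g z) (at z)" if "z \<in> Q" for z
    using Ck_on_SucD[OF Ckg that] .
  have inQ: "(t, y) \<in> Q" if "t \<in> {0..1}" "y \<in> ?K" for t y using sub that by blast
  have Kne: "convex ?K" "closed ?K" "?K \<noteq> {}" using \<rho> by auto
  have lip: "norm (g (t, y) - g (t, y')) \<le> norm (y - y') / 2" if t: "t \<in> {0..1}" and y: "y \<in> ?K" "y' \<in> ?K" for t y y'
  proof -
    have "norm (g (t, y) - g (t, y')) \<le> 1 / 2 * norm (y - y')"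
    proof (rule differentiable_bound[where S = ?K and f' = "\<lambda>y v. fderiv g (t, y) (0, v)"])
      fix z assume z: "z \<in> ?K"
      show "((\<lambda>y. g (t, y)) has_derivative (\<lambda>v. fderiv g (t, z) (0, v))) (at z within ?K)"
        by (rule has_derivative_compose[where f = "\<lambda>y. (t, y)" and g = g, OF _ hdg[OF inQ[OF t z]]])
           (intro has_derivative_Pair has_derivative_const has_derivative_ident)
      show "onorm (\<lambda>v. fderiv g (t, z) (0, v)) \<le> 1 / 2"
        by (rule onorm_le) (use bound[OF t z] in simp)
    qed (use Kne y in auto)
    then show ?thesis by simp
  qed
  define \<pi> where "\<pi> = closest_point ?K"
  have \<pi>K: "\<pi> y \<in> ?K" for y unfolding \<pi>_def by (rule closest_point_in_set[OF Kne(2,3)])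
  have \<pi>id: "\<pi> y = y" if "y \<in> ?K" for y unfolding \<pi>_def by (rule closest_point_self[OF that])
  have \<pi>lip: "norm (\<pi> y - \<pi> y') \<le> norm (y - y')" for y y'
    using closest_point_lipschitz[OF Kne, of y y'] by (simp add: \<pi>_def dist_norm)
  have \<pi>cont: "continuous_on A \<pi>" for A unfolding \<pi>_def by (rule continuous_on_closest_point[OF Kne])
  define gt where "gt = (\<lambda>z. g (fst z, \<pi> (snd z)))"
  have cgt: "continuous_on ({0..1} \<times> UNIV) gt"
    unfolding gt_def
    by (rule continuous_on_compose2[OF cg])
       (use inQ \<pi>K in \<open>auto intro!: continuous_on_Pair continuous_on_fst continuous_on_snd continuous_on_id
          continuous_on_compose2[OF \<pi>cont]\<close>)
  have app: "apply_bcontfun (superpos gt u) t = g (clamp01 t, \<pi> (u (clamp01 t)))" for u t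
    using apply_superpos[OF cgt, of u t] by (simp add: gt_def)
  define P where "P = (\<lambda>u. bc_integral (superpos gt u))"
  have Plip: "norm (P u - P v) \<le> norm (u - v) / 2" for u v
  proof -
    have "P u - P v = bc_integral (superpos gt u - superpos gt v)"
      unfolding P_def by (simp add: linear_diff[OF bounded_linear.linear[OF bounded_linear_bc_integral]])
    moreover have "norm (bc_integral (superpos gt u - superpos gt v)) \<le> norm (u - v) / 2"
    proof (rule norm_bc_integral_le)
      fix t :: real assume "t \<in> {0..1}"
      have "norm (g (clamp01 t, \<pi> (u (clamp01 t))) - g (clamp01 t, \<pi> (v (clamp01 t))))
          \<le> norm (\<pi> (u (clamp01 t)) - \<pi> (v (clamp01 t))) / 2"
        by (rule lip) (use \<pi>K in auto)
      also have "\<dots> \<le> norm (u (clamp01 t) - v (clamp01 t)) / 2" using \<pi>lip by (intro divide_right_mono) auto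
      also have "\<dots> \<le> norm (u - v) / 2" using norm_bounded[of "u - v" "clamp01 t"] by simp
      finally show "norm ((superpos gt u - superpos gt v) t) \<le> norm (u - v) / 2" by (simp add: app)
    qed
    ultimately show ?thesis by simp
  qed
  obtain \<Psi> where \<Psi>: "\<And>z. \<Psi> z = z + P (\<Psi> z)" "\<And>u z. u = z + P u \<Longrightarrow> u = \<Psi> z"
    "\<And>z z'. norm (\<Psi> z - \<Psi> z') \<le> 2 * norm (z - z')"
    by (rule contraction_perturbation[of P, OF Plip]) (rule that; assumption)
  have "superpos gt 0 = 0"
    by (rule bcontfun_eqI) (simp add: app \<pi>id g0 \<rho> less_imp_le)
  then have "P 0 = 0" by (simp add: P_def bounded_linear.linear[OF bounded_linear_bc_integral] linear_0)
  then have \<Psi>0: "\<Psi> 0 = 0" using \<Psi>(2)[of 0 0] by simp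
  \<comment> \<open>The constant curve plays the role of the initial value: \<open>U x\<close> is
    the trajectory of the truncated field that starts at \<open>x\<close>.\<close>
  define U where "U = (\<lambda>x. \<Psi> (const_bcontfun x))"
  have U0: "U 0 = 0" by (simp add: U_def \<Psi>0)
  \<comment> \<open>As \<Psi> is 2-Lipschitz and fixes 0, starting points of norm below
    \<open>\<rho> / 2\<close> have trajectories of norm below \<rho>, where the truncation changes
    nothing. This is why the radius is halved.\<close>
  have Unorm: "norm (U x) < \<rho>" if "x \<in> ?S" for x
  proof -
    have "norm (U x) \<le> 2 * norm (const_bcontfun x :: real \<Rightarrow>\<^sub>C 'e)"
      using \<Psi>(3)[of "const_bcontfun x" 0] by (simp add: U_def \<Psi>0)
    also have "norm (const_bcontfun x :: real \<Rightarrow>\<^sub>C 'e) \<le> norm x"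
      by (rule norm_bound) (simp add: const_bcontfun.rep_eq)
    finally show ?thesis using that by simp
  qed
  have small: "superpos gt u = superpos g u" "\<And>t. t \<in> {0..1} \<Longrightarrow> (t, u t) \<in> Q" if "norm u < \<rho>" for u
  proof -
    have "u t \<in> ?K" for t using norm_bounded[of u t] that by simp
    then show "superpos gt u = superpos g u" "\<And>t. t \<in> {0..1} \<Longrightarrow> (t, u t) \<in> Q"
      by (auto simp: superpos_def gt_def \<pi>id intro: inQ)
  qed
  note graph = small(2)[OF Unorm]
  let ?dg = "\<lambda>b z. fderiv g z (0, b)"
  \<comment> \<open>The derivative of the Picard operator at \<open>U x\<close>, assembled as an
    operator from superpositions so that its regularity in \<open>x\<close> can be read off from
    that of \<open>U\<close>.\<close>
  define A where "A = (\<lambda>x. \<Sum>b\<in>Basis. Blinfun bc_integral o\<^sub>L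
    bounded_bilinear.prod_right (bc_scale b) (superpos (?dg b) (U x)))"
  have Aapp: "A x h = bc_integral (\<Sum>b\<in>Basis. bc_scale b (superpos (?dg b) (U x)) h)" for x h
    by (simp add: A_def blinfun.sum_left bounded_linear_Blinfun_apply[OF bounded_linear_bc_integral]
        bounded_bilinear.prod_right.rep_eq[OF bounded_bilinear_bc_scale]
        linear_sum[OF bounded_linear.linear[OF bounded_linear_bc_integral]])
  have Anorm: "norm (A x h) \<le> norm h / 2" if x: "x \<in> ?S" for x h
    unfolding Aapp
  proof (rule norm_bc_integral_le)
    fix t :: real assume t: "t \<in> {0..1}"
    have "(\<Sum>b\<in>Basis. bc_scale b (superpos (?dg b) (U x)) h) t
        = fderiv g (clamp01 t, U x (clamp01 t)) (0, h (clamp01 t))"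
      by (rule apply_superpos_derivative[OF Ckg graph[OF x]])
    also have "norm \<dots> \<le> norm (h (clamp01 t)) / 2"
      by (rule bound) (use norm_bounded[of "U x" "clamp01 t"] Unorm[OF x] in auto)
    also have "\<dots> \<le> norm h / 2" using norm_bounded[of h "clamp01 t"] by simp
    finally show "norm ((\<Sum>b\<in>Basis. bc_scale b (superpos (?dg b) (U x)) h) t) \<le> norm h / 2" .
  qed
  have "\<exists>B. (\<forall>v. blinfun_apply B (v - A x v) = v) \<and> (\<forall>v. B v - A x (B v) = v)" if "x \<in> ?S" for x
    using blinfun_neumann_inverse[of "A x", OF Anorm[OF that]] by metis
  then obtain B where B: "\<And>x v. x \<in> ?S \<Longrightarrow> blinfun_apply (B x) (v - A x v) = v"
      "\<And>x v. x \<in> ?S \<Longrightarrow> B x v - A x (B x v) = v"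
    by metis
  have hdU: "(U has_derivative (\<lambda>v. B x (const_bcontfun v))) (at x)" if x: "x \<in> ?S" for x
  proof -
    have "(superpos g has_derivative (\<lambda>h. \<Sum>b\<in>Basis. bc_scale b (superpos (?dg b) (U x)) h)) (at (U x))"
      by (rule has_derivative_superpos[OF Q Ckg graph[OF x]])
    \<comment> \<open>The nearest point projection need not be differentiable, but the truncated and
      the original superposition agree on the open ball of curves of norm below \<rho>, which
      contains \<open>U x\<close>.\<close>
    then have "(superpos gt has_derivative (\<lambda>h. \<Sum>b\<in>Basis. bc_scale b (superpos (?dg b) (U x)) h)) (at (U x))"
      by (rule has_derivative_transform_within_open[where s = "ball 0 \<rho>"]) (use small(1) Unorm[OF x] in auto)
    from bounded_linear.has_derivative[OF bounded_linear_bc_integral this]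
    have "(P has_derivative A x) (at (U x))" unfolding P_def Aapp .
    then have F: "((\<lambda>u. u - P u) has_derivative (\<lambda>h. h - A x h)) (at (\<Psi> (const_bcontfun x)))"
      unfolding U_def by (intro has_derivative_diff has_derivative_ident)
    have "(\<Psi> has_derivative B x) (at (const_bcontfun x))"
    proof (rule has_derivative_inverse_basic[where f = "\<lambda>u. u - P u" and g = \<Psi> and y = "const_bcontfun x" and T = UNIV,
          OF F blinfun.bounded_linear_right])
      show "B x \<circ> (\<lambda>h. h - A x h) = id" using B(1)[OF x] by auto
      show "continuous (at (const_bcontfun x)) \<Psi>"
        unfolding continuous_at_eps_delta
      proof (intro allI impI)
        fix e :: real assume "e > 0"
        then show "\<exists>d>0. \<forall>z. dist z (const_bcontfun x) < d \<longrightarrow> dist (\<Psi> z) (\<Psi> (const_bcontfun x)) < e"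
          using \<Psi>(3)[of _ "const_bcontfun x"]
          by (intro exI[of _ "e / 2"]) (fastforce simp: dist_norm intro: le_less_trans)
      qed
      show "\<Psi> z - P (\<Psi> z) = z" for z using \<Psi>(1)[of z] by (simp add: algebra_simps)
    qed auto
    from has_derivative_compose[OF bounded_linear_imp_has_derivative[OF bounded_linear_const_bcontfun] this]
    show ?thesis unfolding U_def .
  qed
  \<comment> \<open>The derivative in direction \<open>v\<close> solves
    \<open>w - A x w = const_bcontfun v\<close>. If \<open>U\<close> is Ck, then so is
    \<open>A\<close>, hence so is this derivative, and \<open>U\<close> gains one order.\<close>
  have CkU: "Ck_on k ?S U" for k
  proof (induction k)
    case 0
    have "continuous (at x) U" if "x \<in> ?S" for x
      using has_derivative_continuous[OF hdU[OF that]] .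
    then show ?case by (simp add: continuous_at_imp_continuous_on)
  next
    case (Suc k)
    have CkA: "Ck_on k ?S A"
      unfolding A_def
    proof (intro Ck_on_sum open_ball Ck_on_bilinear[OF _ bounded_bilinear_blinfun_compose] Ck_on_const)
      fix b :: 'e
      have "Ck_on k Q (?dg b)" using Ckg[of "Suc k"] by simp
      from Ck_on_superpos[OF Q open_ball graph this Suc]
      have "Ck_on k ?S (\<lambda>x. superpos (?dg b) (U x))" .
      then show "Ck_on k ?S (\<lambda>x. bounded_bilinear.prod_right (bc_scale b) (superpos (?dg b) (U x)))"
        by (rule Ck_on_bounded_linear[OF open_ball bounded_bilinear.bounded_linear_prod_right[OF bounded_bilinear_bc_scale]])
    qed
    show ?case
    proof (rule Ck_on_SucI[OF open_ball hdU])
      fix v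
      show "Ck_on k ?S (\<lambda>x. B x (const_bcontfun v))"
      proof (rule Ck_on_linear_solve[OF open_ball])
        show "Ck_on k ?S (\<lambda>x. id_blinfun - A x)"
          by (intro Ck_on_diff open_ball Ck_on_const CkA)
        show "Ck_on k ?S (\<lambda>x. const_bcontfun v :: real \<Rightarrow>\<^sub>C 'e)"
          by (intro open_ball Ck_on_const)
        fix x assume x: "x \<in> ?S"
        show "(id_blinfun - A x) (B x (const_bcontfun v)) = const_bcontfun v"
          by (simp add: blinfun.diff_left B(2)[OF x])
        show "\<exists>B. (\<forall>v. blinfun_apply B ((id_blinfun - A x) v) = v) \<and> (\<forall>v. (id_blinfun - A x) (blinfun_apply B v) = v)"
          by (rule exI[of _ "B x"]) (simp add: blinfun.diff_left B[OF x])
      qed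
    qed
  qed
  define \<Phi> where "\<Phi> = (\<lambda>t x. apply_bcontfun (U x) t)"
  have hd\<Phi>: "(\<Phi> t has_derivative (\<lambda>v. B x (const_bcontfun v) t)) (at x)" if "x \<in> ?S" for t x
    unfolding \<Phi>_def by (rule bounded_linear.has_derivative[OF bounded_linear_apply_bcontfun hdU[OF that]])
  have fd\<Phi>: "fderiv (\<Phi> t) x v = B x (const_bcontfun v) t" if "x \<in> ?S" for t x v
    using frechet_derivative_at[OF hd\<Phi>[OF that]] by metis
  have Ueq: "U x = const_bcontfun x + bc_integral (superpos gt (U x))" for x
    using \<Psi>(1)[of "const_bcontfun x"] by (simp add: U_def P_def)
  \<comment> \<open>The equation for the derivative of \<open>U\<close>, read along time, is the
    integrated variational equation; it yields the last conclusion.\<close>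
  have Beq: "B x (const_bcontfun v) = const_bcontfun v
      + bc_integral (\<Sum>b\<in>Basis. bc_scale b (superpos (?dg b) (U x)) (B x (const_bcontfun v)))" if "x \<in> ?S" for x v
    using B(2)[OF that, of "const_bcontfun v"] unfolding Aapp by (simp add: algebra_simps)
  show ?thesis
  proof (rule that[of \<Phi>])
    show "smooth_on ?S (\<Phi> t)" for t
      unfolding smooth_on_def \<Phi>_def
      using Ck_on_bounded_linear[OF open_ball bounded_linear_apply_bcontfun CkU] by blast
    show "\<Phi> t 0 = 0" for t by (simp add: \<Phi>_def U0)
    show "\<Phi> 0 x = x" for x
      unfolding \<Phi>_def by (subst Ueq) (simp add: const_bcontfun.rep_eq apply_bc_integral clamp01_def)
    show "\<Phi> t x \<in> ball 0 \<rho>" if "x \<in> ?S" for t x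
      using norm_bounded[of "U x" t] Unorm[OF that] by (simp add: \<Phi>_def)
    show "((\<lambda>t. \<Phi> t x) has_vector_derivative g (t, \<Phi> t x)) (at t within {0..1})" if x: "x \<in> ?S" and t: "t \<in> {0..1}" for t x
    proof -
      have "superpos gt (U x) t = g (t, U x t)"
        using app[of "U x" t] norm_bounded[of "U x" t] Unorm[OF x] by (simp add: clamp01_id[OF t] \<pi>id)
      with bc_integral_has_vector_derivative[OF Ueq t, of x] show ?thesis by (simp add: \<Phi>_def)
    qed
    show "((\<lambda>t. fderiv (\<Phi> t) x v) has_vector_derivative
        fderiv g (t, \<Phi> t x) (0, fderiv (\<Phi> t) x v)) (at t within {0..1})"
      if x: "x \<in> ?S" and t: "t \<in> {0..1}" for t x v
      using bc_integral_has_vector_derivative[OF Beq[OF x] t, of v]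
        apply_superpos_derivative[OF Ckg graph[OF x], of "B x (const_bcontfun v)" t]
      unfolding fd\<Phi>[OF x] by (simp add: clamp01_id[OF t] \<Phi>_def)
  qed
qed

section \<open>Closed two-forms on a ball\<close>

lemma smooth_on_imp_Ck_on: "smooth_on S f \<Longrightarrow> Ck_on k S f"
  by (simp add: smooth_on_def)

lemma smooth_onD: "smooth_on S f \<Longrightarrow> x \<in> S \<Longrightarrow> (f has_derivative fderiv f x) (at x)"
  using Ck_on_SucD smooth_on_imp_Ck_on by blast

lemma smooth_on_frechet_apply: "smooth_on S f \<Longrightarrow> smooth_on S (\<lambda>x. fderiv f x v)"
  unfolding smooth_on_def by (metis Ck_on.simps(2))

type_synonym 'e bilinear_form = "'e \<Rightarrow>\<^sub>L 'e \<Rightarrow>\<^sub>L real"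

definition alternating_on :: "'e::euclidean_space set \<Rightarrow> ('e \<Rightarrow> 'e bilinear_form) \<Rightarrow> bool" where
  "alternating_on S Z \<longleftrightarrow> (\<forall>y\<in>S. \<forall>u v. Z y u v = - Z y v u)"

text \<open>In \<open>fderiv Z y u v w\<close> the vector \<open>u\<close> is the direction of
  differentiation and \<open>v\<close>, \<open>w\<close> are the arguments of the form; the
  condition is \<open>dZ = 0\<close>, as in \<open>ext_deriv2\<close>.\<close>

definition closed_on :: "'e::euclidean_space set \<Rightarrow> ('e \<Rightarrow> 'e bilinear_form) \<Rightarrow> bool" where
  "closed_on S Z \<longleftrightarrow> (\<forall>y\<in>S. \<forall>u v w. fderiv Z y u v w
     - fderiv Z y v u w + fderiv Z y w u v = 0)"

text \<open>Since \<open>Z\<close> is closed, the \<open>t\<close>-derivative of \<open>Z (A t y) (A t u) (A t v)\<close> is the integrand of the exterior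
  derivative of \<open>\<eta>\<close>.\<close>

proposition homotopy_primitive:
  fixes Z :: "'e::euclidean_space \<Rightarrow> 'e bilinear_form" and P :: "'e \<Rightarrow>\<^sub>L 'e"
  defines "A \<equiv> \<lambda>t. P + t *\<^sub>R (id_blinfun - P)"
  assumes Z: "smooth_on (ball 0 r) Z" and alt: "alternating_on (ball 0 r) Z" and closed: "closed_on (ball 0 r) Z"
    and A: "\<And>t y. t \<in> {0..1} \<Longrightarrow> norm (A t y) \<le> norm y"
  obtains \<eta> :: "'e \<Rightarrow> 'e \<Rightarrow>\<^sub>L real" where
    "smooth_on (ball 0 r) \<eta>"
    "\<And>y u. y \<in> ball 0 r \<Longrightarrow> \<eta> y u = integral {0..1} (\<lambda>t. Z (A t y) (y - P y) (A t u))"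
    "\<And>y u v. y \<in> ball 0 r \<Longrightarrow> fderiv \<eta> y u v - fderiv \<eta> y v u
      = Z y u v - Z (P y) (P u) (P v)"
    "\<And>u v. r > 0 \<Longrightarrow> fderiv \<eta> 0 u v = integral {0..1} (\<lambda>t. Z 0 (u - P u) (A t v))"
proof -
  let ?V = "ball (0::'e) r"
  \<comment> \<open>The path \<open>A t y\<close> runs straight from \<open>P y\<close> to
    \<open>y\<close> with velocity \<open>?B y\<close>. Taking \<open>P = 0\<close> gives the radial
    contraction, a projection gives the contraction onto a subspace.\<close>
  let ?B = "id_blinfun - P"
  define a where "a = (\<lambda>z :: real \<times> 'e. A (fst z) (snd z))"
  define Q where "Q = a -` ?V"

  have a_eq: "a = (\<lambda>z. P (snd z) + fst z *\<^sub>R ?B (snd z))"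
    by (auto simp: a_def A_def blinfun.bilinear_simps)
  have aCk: "Ck_on k UNIV a" for k
    unfolding a_eq
    by (intro Ck_on_add open_UNIV Ck_on_bilinear[OF _ bounded_bilinear_scaleR] Ck_on_linear
        bounded_linear_fst bounded_linear_compose[OF blinfun.bounded_linear_right bounded_linear_snd])
  have ca: "continuous_on UNIV a" using aCk[of 0] by simp
  have Q: "open Q" unfolding Q_def using ca open_vimage open_ball by blast
  have mem: "A t y \<in> ?V" if "t \<in> {0..1}" "y \<in> ?V" for t y
    using A[OF that(1), of y] that(2) by simp
  then have sub: "{0..1} \<times> ?V \<subseteq> Q"
    by (auto simp only: Q_def a_def vimage_eq mem_Times_iff fst_conv snd_conv)
  \<comment> \<open>The contraction of \<open>Z\<close> with the velocity, pulled back along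
    \<open>A t\<close>; integrating over \<open>t\<close> is the homotopy operator.\<close>
  define h where "h = (\<lambda>z. Z (a z) (?B (snd z)) o\<^sub>L A (fst z))"

  have hCk: "Ck_on k Q h" for k
    unfolding h_def
  proof (rule Ck_on_bilinear[OF Q bounded_bilinear_blinfun_compose Ck_on_bilinear[OF Q bounded_bilinear_blinfun_apply]])
    show "Ck_on k Q (\<lambda>z. Z (a z))"
      by (rule Ck_on_compose[OF Q open_ball _ Ck_on_subset[OF aCk] smooth_on_imp_Ck_on[OF Z]]) (auto simp: Q_def)
    show "Ck_on k Q (\<lambda>z. ?B (snd z))"
      by (intro Ck_on_linear Q bounded_linear_compose[OF blinfun.bounded_linear_right bounded_linear_snd])
    have "Ck_on k Q (\<lambda>z. P + fst z *\<^sub>R ?B)"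
      by (intro Ck_on_add Q Ck_on_const Ck_on_bilinear[OF _ bounded_bilinear_scaleR] Ck_on_linear bounded_linear_fst)
    then show "Ck_on k Q (\<lambda>z. A (fst z))" by (simp add: A_def)
  qed
  define \<eta> where "\<eta> = (\<lambda>y. integral {0..1} (\<lambda>t. h (t, y)))"
  have \<eta>Ck: "Ck_on k ?V \<eta>" for k
    unfolding \<eta>_def by (rule Ck_on_integral_param[OF Q open_ball sub hCk])
  have hint: "(\<lambda>t. h (t, y)) integrable_on {0..1}" if "y \<in> ?V" for y
  proof (rule integrable_continuous_real)
    show "continuous_on {0..1} (\<lambda>t. h (t, y))"
      by (rule continuous_on_compose2[where f = "\<lambda>t. (t, y)", OF Ck_on_imp_continuous_on[OF hCk]])
         (use sub that in \<open>auto intro!: continuous_on_Pair continuous_on_id continuous_on_const\<close>)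
  qed
  have dhcont: "continuous_on {0..1} (\<lambda>t. fderiv h (t, y) w)" if "y \<in> ?V" for y w
  proof (rule continuous_on_compose2[where g = "\<lambda>z. fderiv h z w" and f = "\<lambda>t. (t, y)"])
    show "continuous_on Q (\<lambda>z. fderiv h z w)"
      using hCk[of "Suc 0"] by (simp only: Ck_on.simps)
  qed (use sub that in \<open>auto intro!: continuous_on_Pair continuous_on_id continuous_on_const\<close>)
  have blapp: "integral {0..1} f v = integral {0..1} (\<lambda>t. f t v)" if "f integrable_on {0..1}"
    for f :: "real \<Rightarrow> 'e \<Rightarrow>\<^sub>L real" and v
    using integral_linear[OF that blinfun.bounded_linear_left[of v]] by (simp add: o_def)
  have hdZ: "(Z has_derivative fderiv Z y) (at y)" if "y \<in> ?V" for y
    using smooth_onD[OF Z that] .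
  have dh: "fderiv h (t, y) (0, u) v
      = fderiv Z (A t y) (A t u) (?B y) (A t v) + Z (A t y) (?B u) (A t v)"
    if t: "t \<in> {0..1}" and y: "y \<in> ?V" for t y u v
  proof -
    have a1: "((\<lambda>y. A t y) has_derivative A t) (at y)"
      by (rule bounded_linear_imp_has_derivative[OF blinfun.bounded_linear_right])
    have z1: "((\<lambda>y. Z (A t y)) has_derivative (\<lambda>u. fderiv Z (A t y) (A t u))) (at y)"
      by (rule has_derivative_compose[OF a1 hdZ[OF mem[OF t y]]])
    have b1: "((\<lambda>y. ?B y) has_derivative ?B) (at y)"
      by (rule bounded_linear_imp_has_derivative[OF blinfun.bounded_linear_right])
    from bounded_bilinear.FDERIV[OF bounded_bilinear_blinfun_apply z1 b1]
    have "((\<lambda>y. Z (A t y) (?B y)) has_derivative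
        (\<lambda>u. Z (A t y) (?B u) + fderiv Z (A t y) (A t u) (?B y))) (at y)" .
    from bounded_linear.has_derivative[OF bounded_bilinear.bounded_linear_left[OF bounded_bilinear_blinfun_compose, of "A t"] this]
    have 1: "((\<lambda>y. h (t, y)) has_derivative
        (\<lambda>u. (Z (A t y) (?B u) + fderiv Z (A t y) (A t u) (?B y)) o\<^sub>L A t)) (at y)"
      by (simp only: h_def a_def fst_conv snd_conv)
    have "(t, y) \<in> Q" using sub t y by blast
    have "((\<lambda>y. (t, y)) has_derivative (\<lambda>u. (0, u))) (at y)"
      by (intro has_derivative_Pair has_derivative_const has_derivative_ident)
    from has_derivative_compose[OF this Ck_on_SucD[OF hCk \<open>(t, y) \<in> Q\<close>]]
    have 2: "((\<lambda>y. h (t, y)) has_derivative (\<lambda>u. fderiv h (t, y) (0, u))) (at y)" .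
    from has_derivative_unique[OF 2 1]
    have "fderiv h (t, y) (0, u) = (Z (A t y) (?B u) + fderiv Z (A t y) (A t u) (?B y)) o\<^sub>L A t"
      by metis
    then show ?thesis by (simp add: blinfun.add_left)
  qed
  have \<eta>app: "\<eta> y u = integral {0..1} (\<lambda>t. Z (A t y) (y - P y) (A t u))" if y: "y \<in> ?V" for y u
    unfolding \<eta>_def blapp[OF hint[OF y]] by (simp add: h_def a_def blinfun.diff_left)
  let ?I = "\<lambda>y u v t. fderiv Z (A t y) (A t u) (?B y) (A t v) + Z (A t y) (?B u) (A t v)"
  have d\<eta>: "fderiv \<eta> y u v = integral {0..1} (?I y u v)"
    and d\<eta>int: "(?I y u v) integrable_on {0..1}"
    if y: "y \<in> ?V" for y u v
  proof -
    have int: "(\<lambda>t. fderiv h (t, y) (0, u)) integrable_on {0..1}"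
      by (rule integrable_continuous_real[OF dhcont[OF y]])
    have "fderiv \<eta> y u = integral {0..1} (\<lambda>t. fderiv h (t, y) (0, u))"
      using frechet_derivative_at[OF has_derivative_integral_param[OF Q open_ball sub hCk y]] unfolding \<eta>_def by metis
    then have "fderiv \<eta> y u v = integral {0..1} (\<lambda>t. fderiv h (t, y) (0, u) v)"
      using blapp[OF int] by simp
    also have "\<dots> = integral {0..1} (?I y u v)"
      by (rule integral_cong) (rule dh[OF _ y])
    finally show "fderiv \<eta> y u v = integral {0..1} (?I y u v)" .
    have "(\<lambda>t. fderiv h (t, y) (0, u) v) integrable_on {0..1}"
      using integrable_linear[OF int blinfun.bounded_linear_left[of v]] by (simp add: o_def)
    then show "(?I y u v) integrable_on {0..1}"
      by (rule integrable_eq) (rule dh[OF _ y])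
  qed
  have main: "fderiv \<eta> y u v - fderiv \<eta> y v u = Z y u v - Z (P y) (P u) (P v)"
    if y: "y \<in> ?V" for y u v
  proof -
    let ?f = "\<lambda>t. Z (A t y) (A t u) (A t v)"
    have At: "((\<lambda>t. A t w) has_vector_derivative ?B w) (at t within {0..1})" for t w
      unfolding A_def has_vector_derivative_def blinfun.add_left blinfun.scaleR_left
      by (auto intro!: derivative_eq_intros)
    have "(?f has_vector_derivative ?I y u v t - ?I y v u t) (at t within {0..1})" if t: "t \<in> {0..1}" for t
    proof -
      have "((\<lambda>t. Z (A t y)) has_vector_derivative fderiv Z (A t y) (?B y)) (at t within {0..1})"
        using has_derivative_compose[OF At[unfolded has_vector_derivative_def] hdZ[OF mem[OF t y]]]
        unfolding has_vector_derivative_def linear_scale[OF has_derivative_linear[OF hdZ[OF mem[OF t y]]]] .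
      from bounded_bilinear.has_vector_derivative[OF bounded_bilinear_blinfun_apply
          bounded_bilinear.has_vector_derivative[OF bounded_bilinear_blinfun_apply this At[of u]] At[of v]]
      have "(?f has_vector_derivative Z (A t y) (A t u) (?B v) +
        (Z (A t y) (?B u) + fderiv Z (A t y) (?B y) (A t u)) (A t v)) (at t within {0..1})" .
      moreover have "Z (A t y) (A t u) (?B v) + (Z (A t y) (?B u) + fderiv Z (A t y) (?B y) (A t u)) (A t v)
          = ?I y u v t - ?I y v u t"
      proof -
        have "Z (A t y) (A t u) (?B v) = - Z (A t y) (?B v) (A t u)"
          by (rule alt[unfolded alternating_on_def, rule_format, OF mem[OF t y]])
        moreover have "fderiv Z (A t y) (?B y) (A t u) (A t v)
            = fderiv Z (A t y) (A t u) (?B y) (A t v) - fderiv Z (A t y) (A t v) (?B y) (A t u)"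
          using closed[unfolded closed_on_def, rule_format, OF mem[OF t y], of "?B y" "A t u" "A t v"] by linarith
        ultimately show ?thesis by (simp only: blinfun.add_left)
      qed
      ultimately show ?thesis by (simp only:)
    qed
    then have "((\<lambda>t. ?I y u v t - ?I y v u t) has_integral ?f 1 - ?f 0) {0..1}"
      by (intro fundamental_theorem_of_calculus) auto
    then have "integral {0..1} (\<lambda>t. ?I y u v t - ?I y v u t) = ?f 1 - ?f 0"
      by (rule integral_unique)
    moreover have "integral {0..1} (\<lambda>t. ?I y u v t - ?I y v u t) = integral {0..1} (?I y u v) - integral {0..1} (?I y v u)"
      by (rule integral_diff[OF d\<eta>int[OF y] d\<eta>int[OF y]])
    moreover have "A 1 = id_blinfun" "A 0 = P" by (simp_all add: A_def)
    ultimately show ?thesis by (simp add: d\<eta>[OF y])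
  qed
  show ?thesis
  proof (rule that[of \<eta>])
    show "smooth_on ?V \<eta>" using \<eta>Ck by (simp add: smooth_on_def)
    \<comment> \<open>At the origin \<open>?B y = 0\<close>, so the term with the derivative of
      \<open>Z\<close> drops out and only \<open>Z 0\<close> enters. This gives control over
      differentials at the base point.\<close>
    show "fderiv \<eta> 0 u v = integral {0..1} (\<lambda>t. Z 0 (u - P u) (A t v))" if "r > 0" for u v
    proof -
      have "0 \<in> ?V" using that by simp
      from d\<eta>[OF this] show ?thesis by (simp add: blinfun.bilinear_simps)
    qed
  qed (use \<eta>app main in auto)
qed

section \<open>Covectors as vectors, and Darboux coordinates for a single form\<close>

lemma frechet_derivative_eqI:
  "(f has_derivative f') (at x) \<Longrightarrow> fderiv f x v = f' v"
  by (metis frechet_derivative_at)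

lemma blinfun_left_inverse:
  fixes L :: "'e::euclidean_space \<Rightarrow>\<^sub>L 'e"
  assumes "\<And>u. L u = 0 \<Longrightarrow> u = 0"
  obtains B :: "'e \<Rightarrow>\<^sub>L 'e" where "\<And>u. B (L u) = u" "\<And>u. L (B u) = u"
proof -
  have lin: "linear (blinfun_apply L)" by (rule bounded_linear.linear[OF blinfun.bounded_linear_right])
  then have inj: "inj (blinfun_apply L)" using assms by (simp add: linear_injective_0)
  then obtain g where g: "linear g" "g \<circ> blinfun_apply L = id" "blinfun_apply L \<circ> g = id"
    using linear_injective_isomorphism[OF lin] by (metis comp_apply eq_id_iff ext)
  have "blinfun_apply (Blinfun g) = g"
    using g(1) by (simp add: bounded_linear_Blinfun_apply linear_conv_bounded_linear)
  then show ?thesis using that[of "Blinfun g"] g(2,3) by (metis comp_apply id_apply)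
qed

text \<open>The vector dual to a covector. It turns a bilinear form into an endomorphism, so that
  invertibility can be treated in one space.\<close>

definition riesz :: "('e::euclidean_space \<Rightarrow>\<^sub>L real) \<Rightarrow> 'e" where
  "riesz l = (\<Sum>b\<in>Basis. l b *\<^sub>R b)"

lemma riesz_inner: "riesz l \<bullet> v = l v"
proof -
  have "l v = l (\<Sum>b\<in>Basis. (v \<bullet> b) *\<^sub>R b)" by (simp add: euclidean_representation)
  also have "\<dots> = riesz l \<bullet> v"
    by (simp add: riesz_def inner_sum_left blinfun.sum_right blinfun.scaleR_right inner_commute[of v] mult.commute
        del: euclidean_representation)
  finally show ?thesis ..
qed

lemma bounded_linear_riesz: "bounded_linear riesz"
  unfolding riesz_def
  by (intro bounded_linear_sum bounded_linear_scaleR_left[THEN bounded_linear_compose] blinfun.bounded_linear_left)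

lemma riesz_eq_iff: "riesz l = riesz l' \<longleftrightarrow> l = l'"
  by (metis blinfun_eqI riesz_inner)

text \<open>Moser's argument: \<open>X\<close> below satisfies \<open>\<omega>\<^sub>t (X, \<cdot>) = - \<eta>\<close> for \<open>\<omega>\<^sub>t = \<omega>\<^sub>0 + t (\<omega> - \<omega>\<^sub>0)\<close> and a primitive
  \<open>\<eta>\<close> of \<open>\<omega> - \<omega>\<^sub>0\<close>, so the pullback of \<open>\<omega>\<^sub>t\<close> along its flow is constant. As \<open>\<omega> = \<omega>\<^sub>0\<close> at the origin,
  \<open>\<eta>\<close> and \<open>X\<close> vanish to second order there, and the flow is tangent to the identity.\<close>

theorem moser:
  fixes Z :: "'e::euclidean_space \<Rightarrow> 'e bilinear_form"
  assumes r: "r > 0" and Z: "smooth_on (ball 0 r) Z" and alt: "alternating_on (ball 0 r) Z"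
    and closed: "closed_on (ball 0 r) Z" and nondeg: "\<And>u. Z 0 u = 0 \<Longrightarrow> u = 0"
  obtains \<phi> \<rho> where "\<rho> > 0" "smooth_on (ball 0 \<rho>) \<phi>" "\<phi> 0 = 0" "\<phi> ` ball 0 \<rho> \<subseteq> ball 0 r"
    "\<And>v. fderiv \<phi> 0 v = v"
    "\<And>y u v. y \<in> ball 0 \<rho> \<Longrightarrow> Z (\<phi> y) (fderiv \<phi> y u) (fderiv \<phi> y v) = Z 0 u v"
proof -
  let ?V = "ball (0::'e) r"
  have 0: "0 \<in> ?V" using r by simp
  define \<alpha> where "\<alpha> = (\<lambda>y. Z y - Z 0)"
  have hdZ: "(Z has_derivative fderiv Z y) (at y)" if "y \<in> ?V" for y
    using smooth_onD[OF Z that] .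
  have hd\<alpha>: "(\<alpha> has_derivative fderiv Z y) (at y)" if "y \<in> ?V" for y
    unfolding \<alpha>_def using has_derivative_diff[OF hdZ[OF that] has_derivative_const] by simp
  have d\<alpha>: "fderiv \<alpha> y = fderiv Z y" if "y \<in> ?V" for y
    using frechet_derivative_eqI[OF hd\<alpha>[OF that]] by blast
  have \<alpha>Ck: "Ck_on k ?V \<alpha>" for k
    unfolding \<alpha>_def by (intro Ck_on_diff open_ball Ck_on_const smooth_on_imp_Ck_on[OF Z])
  have \<alpha>s: "smooth_on ?V \<alpha>" using \<alpha>Ck by (simp add: smooth_on_def)
  have \<alpha>alt: "\<alpha> y u v = - \<alpha> y v u" if "y \<in> ?V" for y u v
    unfolding \<alpha>_def blinfun.diff_left
    using alt[unfolded alternating_on_def, rule_format, OF that, of u v]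
      alt[unfolded alternating_on_def, rule_format, OF 0, of u v] by linarith
  have \<alpha>cl: "fderiv Z y u v w - fderiv Z y v u w + fderiv Z y w u v = 0"
    if "y \<in> ?V" for y u v w
    using closed that by (auto simp: closed_on_def)
  \<comment> \<open>With \<open>P = 0\<close> the homotopy contracts the ball to the origin and the
    term at \<open>P y\<close> vanishes: the usual primitive of \<alpha>.\<close>
  let ?P = "0 :: 'e \<Rightarrow>\<^sub>L 'e"
  obtain \<eta> :: "'e \<Rightarrow> 'e \<Rightarrow>\<^sub>L real" where \<eta>: "smooth_on ?V \<eta>"
    "\<And>y u. y \<in> ?V \<Longrightarrow> \<eta> y u = integral {0..1} (\<lambda>t. \<alpha> ((?P + t *\<^sub>R (id_blinfun - ?P)) y) (y - ?P y) ((?P + t *\<^sub>R (id_blinfun - ?P)) u))"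
    "\<And>y u v. y \<in> ?V \<Longrightarrow> fderiv \<eta> y u v - fderiv \<eta> y v u
      = \<alpha> y u v - \<alpha> (?P y) (?P u) (?P v)"
    "\<And>u v. r > 0 \<Longrightarrow> fderiv \<eta> 0 u v = integral {0..1} (\<lambda>t. \<alpha> 0 (u - ?P u) ((?P + t *\<^sub>R (id_blinfun - ?P)) v))"
  proof (rule homotopy_primitive[of r \<alpha> ?P, OF \<alpha>s])
    show "alternating_on ?V \<alpha>" unfolding alternating_on_def using \<alpha>alt by blast
    show "closed_on ?V \<alpha>" unfolding closed_on_def using d\<alpha> \<alpha>cl by simp
    show "norm ((?P + t *\<^sub>R (id_blinfun - ?P)) y) \<le> norm y" if "t \<in> {0..1}" for t and y :: 'e
      using that by (simp add: blinfun.bilinear_simps mult_left_le_one_le)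
  qed (rule that; assumption)
  have \<alpha>0: "\<alpha> 0 = 0" by (simp add: \<alpha>_def)
  have \<eta>0: "\<eta> 0 = 0" by (rule blinfun_eqI) (simp add: \<eta>(2)[OF 0] \<alpha>0)
  have d\<eta>: "fderiv \<eta> y u v - fderiv \<eta> y v u = \<alpha> y u v" if "y \<in> ?V" for y u v
    using \<eta>(3)[OF that, of u v] by simp
  have d\<eta>0: "fderiv \<eta> 0 u = 0" for u
    by (rule blinfun_eqI) (simp add: \<eta>(4)[OF r] \<alpha>0)
  have hd\<eta>: "(\<eta> has_derivative fderiv \<eta> y) (at y)" if "y \<in> ?V" for y
    using smooth_onD[OF \<eta>(1) that] .

  define R where "R = Blinfun (riesz :: ('e \<Rightarrow>\<^sub>L real) \<Rightarrow> 'e)"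
  have R: "blinfun_apply R = riesz" unfolding R_def by (rule bounded_linear_Blinfun_apply[OF bounded_linear_riesz])
  have R0: "R l = 0 \<longleftrightarrow> l = 0" for l using riesz_eq_iff[of l 0] by (simp add: R riesz_def)
  \<comment> \<open>\<open>B0\<close> inverts the form at the origin; after applying
    \<open>R\<close> and \<open>B0\<close>, the form \<open>W z\<close> below becomes a small
    perturbation of the identity.\<close>
  obtain B0 where B0: "\<And>u. blinfun_apply B0 ((R o\<^sub>L Z 0) u) = u" "\<And>u. (R o\<^sub>L Z 0) (blinfun_apply B0 u) = u"
    using blinfun_left_inverse[of "R o\<^sub>L Z 0"] nondeg R0 by (metis blinfun_apply_blinfun_compose)
  have "continuous (at 0) (\<lambda>y. B0 o\<^sub>L (R o\<^sub>L \<alpha> y))"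
    by (intro bounded_linear.continuous[OF bounded_bilinear.bounded_linear_right[OF bounded_bilinear_blinfun_compose]]
        has_derivative_continuous[OF hd\<alpha>[OF 0]])
  \<comment> \<open>Times in \<open>Q\<close> below have absolute value less than 2, so 1/4 leaves
    the factor 1/2 required by \<open>blinfun_neumann_inverse\<close>.\<close>
  then obtain d where d: "d > 0" "\<And>y. dist y 0 < d \<Longrightarrow> dist (B0 o\<^sub>L (R o\<^sub>L \<alpha> y)) (B0 o\<^sub>L (R o\<^sub>L \<alpha> 0)) < 1/4"
    unfolding continuous_at_eps_delta by (metis zero_less_divide_1_iff zero_less_numeral)
  define \<rho>1 where "\<rho>1 = min d r"
  have \<rho>1: "\<rho>1 > 0" "\<rho>1 \<le> r" using d r by (auto simp: \<rho>1_def)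
  have sub1: "ball 0 \<rho>1 \<subseteq> ?V" using \<rho>1 by auto
  have small: "norm (B0 (R (\<alpha> y h))) \<le> norm h / 4" if "y \<in> ball 0 \<rho>1" for y h
  proof -
    have "norm (B0 o\<^sub>L (R o\<^sub>L \<alpha> y)) \<le> 1/4"
      using d(2)[of y] that by (simp add: \<rho>1_def \<alpha>0 dist_norm less_imp_le)
    then have "norm (B0 o\<^sub>L (R o\<^sub>L \<alpha> y)) * norm h \<le> 1/4 * norm h" by (rule mult_right_mono) simp
    then show ?thesis using norm_blinfun[of "B0 o\<^sub>L (R o\<^sub>L \<alpha> y)" h] by simp
  qed
  define Q where "Q = {-2<..<2::real} \<times> ball (0::'e) \<rho>1"
  have Q: "open Q" unfolding Q_def by (intro open_Times open_greaterThanLessThan open_ball)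
  have Q_V: "snd z \<in> ?V" if "z \<in> Q" for z using that sub1 by (auto simp: Q_def)
  define W where "W = (\<lambda>z :: real \<times> 'e. Z 0 + fst z *\<^sub>R \<alpha> (snd z))"
  have WCk: "Ck_on k Q W" for k
    unfolding W_def
    by (intro Ck_on_add Q Ck_on_const Ck_on_bilinear[OF _ bounded_bilinear_scaleR] Ck_on_linear bounded_linear_fst
        Ck_on_compose[OF Q open_ball _ Ck_on_linear[OF Q bounded_linear_snd] \<alpha>Ck]) (use Q_V in auto)
  have Winv: "\<exists>B. (\<forall>v. blinfun_apply B ((R o\<^sub>L W z) v) = v) \<and> (\<forall>v. (R o\<^sub>L W z) (blinfun_apply B v) = v)" if z: "z \<in> Q" for z
  proof -
    let ?A = "- (fst z *\<^sub>R (B0 o\<^sub>L (R o\<^sub>L \<alpha> (snd z))))"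
    have "norm (?A h) \<le> norm h / 2" for h
    proof -
      have "norm (?A h) = \<bar>fst z\<bar> * norm (B0 (R (\<alpha> (snd z) h)))" by (simp add: blinfun.bilinear_simps)
      also have "\<dots> \<le> 2 * (norm h / 4)" using z by (intro mult_mono small) (auto simp: Q_def)
      finally show ?thesis by simp
    qed
    then obtain B1 where B1: "\<And>v. blinfun_apply B1 (v - ?A v) = v" "\<And>v. blinfun_apply B1 v - ?A (B1 v) = v"
      by (rule blinfun_neumann_inverse) (rule that; assumption)
    have eq: "B0 ((R o\<^sub>L W z) v) = v - ?A v" for v
      using B0(1)[of v] by (simp add: W_def blinfun.bilinear_simps)
    show ?thesis
    proof (intro exI[of _ "B1 o\<^sub>L B0"] conjI allI)
      show "(B1 o\<^sub>L B0) ((R o\<^sub>L W z) v) = v" for v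
        by (simp only: blinfun_apply_blinfun_compose[of B1] eq B1(1))
      show "(R o\<^sub>L W z) ((B1 o\<^sub>L B0) v) = v" for v
      proof -
        have "B0 ((R o\<^sub>L W z) ((B1 o\<^sub>L B0) v)) = B0 v" by (simp only: eq blinfun_apply_blinfun_compose[of B1] B1(2))
        then show ?thesis using B0(2) by metis
      qed
    qed
  qed
  have "\<exists>x. (R o\<^sub>L W z) x = - R (\<eta> (snd z))" if "z \<in> Q" for z using Winv[OF that] by blast
  then obtain X where X: "\<And>z. z \<in> Q \<Longrightarrow> (R o\<^sub>L W z) (X z) = - R (\<eta> (snd z))" by metis
  have WX: "W z (X z) = - \<eta> (snd z)" if "z \<in> Q" for z
    using X[OF that] R0[of "W z (X z) + \<eta> (snd z)"] by (simp add: blinfun.add_right eq_neg_iff_add_eq_0)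
  have Winj: "x = 0" if "z \<in> Q" "W z x = 0" for z x
    using Winv[OF that(1)] that(2) by (metis blinfun_apply_blinfun_compose blinfun.zero_right)
  have XCk: "Ck_on k Q X" for k
  proof (rule Ck_on_linear_solve[OF Q _ _ Winv X])
    show "Ck_on k Q (\<lambda>z. R o\<^sub>L W z)"
      by (intro Ck_on_bilinear[OF Q bounded_bilinear_blinfun_compose] Ck_on_const Q WCk)
    have "Ck_on k Q (\<lambda>z. \<eta> (snd z))"
      by (rule Ck_on_compose[OF Q open_ball _ Ck_on_linear[OF Q bounded_linear_snd] smooth_on_imp_Ck_on[OF \<eta>(1)]]) (use Q_V in auto)
    then show "Ck_on k Q (\<lambda>z. - R (\<eta> (snd z)))"
      by (intro Ck_on_uminus Q Ck_on_bounded_linear[OF _ blinfun.bounded_linear_right])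
  qed
  let ?DX = "\<lambda>z. fderiv X z"
  have hdX: "(X has_derivative ?DX z) (at z)" if "z \<in> Q" for z using Ck_on_SucD[OF XCk that] .
  have hdW: "(W has_derivative (\<lambda>w. fst z *\<^sub>R fderiv Z (snd z) (snd w) + fst w *\<^sub>R \<alpha> (snd z))) (at z)" if "z \<in> Q" for z
  proof -
    have "((\<lambda>z. \<alpha> (snd z)) has_derivative (\<lambda>w. fderiv Z (snd z) (snd w))) (at z)"
      by (rule has_derivative_compose[OF bounded_linear_imp_has_derivative[OF bounded_linear_snd] hd\<alpha>[OF Q_V[OF that]]])
    from has_derivative_add[OF has_derivative_const[of "Z 0"] has_derivative_scaleR[OF bounded_linear_imp_has_derivative[OF bounded_linear_fst] this]]
    show ?thesis unfolding W_def by simp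
  qed
  \<comment> \<open>The derivative of the defining equation of \<open>X\<close>. At the origin it
    forces the spatial derivative of \<open>X\<close> to vanish; along the flow it trades
    derivatives of \<open>X\<close> for derivatives of \<eta> and \<open>Z\<close>.\<close>
  have dWX: "W z (?DX z w) + (fst z *\<^sub>R fderiv Z (snd z) (snd w) + fst w *\<^sub>R \<alpha> (snd z)) (X z)
      = - fderiv \<eta> (snd z) (snd w)" if z: "z \<in> Q" for z w
  proof -
    have 1: "((\<lambda>z. W z (X z)) has_derivative (\<lambda>w. W z (?DX z w)
        + (fst z *\<^sub>R fderiv Z (snd z) (snd w) + fst w *\<^sub>R \<alpha> (snd z)) (X z))) (at z)"
      by (rule bounded_bilinear.FDERIV[OF bounded_bilinear_blinfun_apply hdW[OF z] hdX[OF z]])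
    have "((\<lambda>z. - \<eta> (snd z)) has_derivative (\<lambda>w. - fderiv \<eta> (snd z) (snd w))) (at z)"
      by (intro has_derivative_minus has_derivative_compose[OF bounded_linear_imp_has_derivative[OF bounded_linear_snd] hd\<eta>[OF Q_V[OF z]]])
    then have 2: "((\<lambda>z. W z (X z)) has_derivative (\<lambda>w. - fderiv \<eta> (snd z) (snd w))) (at z)"
      by (rule has_derivative_transform_within_open[OF _ Q z]) (simp add: WX)
    from has_derivative_unique[OF 1 2] show ?thesis by metis
  qed
  have tQ: "(t, 0) \<in> Q" if "t \<in> {0..1}" for t using that \<rho>1 by (auto simp: Q_def)
  have X0: "X (t, 0) = 0" if "t \<in> {0..1}" for t
    by (rule Winj[OF tQ[OF that]]) (simp add: WX[OF tQ[OF that]] \<eta>0)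
  have DX0: "?DX (t, 0) (0, v) = 0" if "t \<in> {0..1}" for t v
    by (rule Winj[OF tQ[OF that]]) (use dWX[OF tQ[OF that], of "(0, v)"] in \<open>simp add: X0[OF that] d\<eta>0\<close>)
  define N where "N = (\<lambda>z. Blinfun (?DX z) o\<^sub>L Blinfun (\<lambda>v::'e. (0::real, v)))"
  have bl0: "bounded_linear (\<lambda>v::'e. (0::real, v))" by (intro bounded_linear_intros)
  have N: "N z v = ?DX z (0, v)" if "z \<in> Q" for z v
    unfolding N_def blinfun_apply_blinfun_compose bounded_linear_Blinfun_apply[OF bl0]
      bounded_linear_Blinfun_apply[OF has_derivative_bounded_linear[OF hdX[OF that]]] ..
  have Ncont: "continuous_on Q N"
  proof -
    have "continuous_on Q (\<lambda>z. Blinfun (?DX z))"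
      using Ck_on_frechet_blinfun[OF Q XCk, of 0] by simp
    from bounded_linear.continuous_on[OF bounded_bilinear.bounded_linear_left[OF bounded_bilinear_blinfun_compose] this]
    show ?thesis unfolding N_def .
  qed
  \<comment> \<open>The operator \<open>N\<close> vanishes on this segment, so near it
    \<open>N\<close> has norm at most 1/2, uniformly in time: the bound that
    \<open>smooth_flow\<close> asks for. Halving \<open>d2\<close> afterwards leaves room for the
    closed ball.\<close>
  have "compact ({0..1::real} \<times> {0::'e})" by (intro compact_Times) auto
  moreover have "{0..1::real} \<times> {0::'e} \<subseteq> Q" using tQ by auto
  ultimately obtain d2 where d2: "d2 > 0"
    "\<And>z z'. z \<in> {0..1} \<times> {0} \<Longrightarrow> dist z' z < d2 \<Longrightarrow> z' \<in> Q \<and> dist (N z') (N z) < 1/2"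
    using uniformly_continuous_near_compact[of "{0..1::real} \<times> {0::'e}" Q N "1/2"] Q Ncont by (metis half_gt_zero_iff zero_less_one)
  define \<rho> where "\<rho> = d2 / 2"
  have \<rho>: "\<rho> > 0" using d2 by (simp add: \<rho>_def)
  have near: "(t, y) \<in> Q" "norm (?DX (t, y) (0, v)) \<le> norm v / 2" if "t \<in> {0..1}" "y \<in> cball 0 \<rho>" for t y v
  proof -
    have *: "(t, y) \<in> Q \<and> dist (N (t, y)) (N (t, 0)) < 1/2"
      by (rule d2(2)) (use that d2(1) in \<open>auto simp: dist_Pair_Pair \<rho>_def\<close>)
    then show "(t, y) \<in> Q" ..
    have "N (t, 0) = 0" by (rule blinfun_eqI) (simp add: N tQ[OF that(1)] DX0[OF that(1)])
    then have "norm (N (t, y)) \<le> 1/2" using * by (simp add: dist_norm)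
    then have "norm (N (t, y)) * norm v \<le> 1/2 * norm v" by (rule mult_right_mono) simp
    then show "norm (?DX (t, y) (0, v)) \<le> norm v / 2"
      using norm_blinfun[of "N (t, y)" v] * by (simp add: N)
  qed
  obtain \<Phi> :: "real \<Rightarrow> 'e \<Rightarrow> 'e" where \<Phi>:
    "\<And>t. smooth_on (ball 0 (\<rho> / 2)) (\<Phi> t)"
    "\<And>x. x \<in> ball 0 (\<rho> / 2) \<Longrightarrow> \<Phi> 0 x = x"
    "\<And>t. \<Phi> t 0 = 0"
    "\<And>t x. x \<in> ball 0 (\<rho> / 2) \<Longrightarrow> \<Phi> t x \<in> ball 0 \<rho>"
    "\<And>t x. x \<in> ball 0 (\<rho> / 2) \<Longrightarrow> t \<in> {0..1} \<Longrightarrow>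
      ((\<lambda>t. \<Phi> t x) has_vector_derivative X (t, \<Phi> t x)) (at t within {0..1})"
    "\<And>t x v. x \<in> ball 0 (\<rho> / 2) \<Longrightarrow> t \<in> {0..1} \<Longrightarrow>
      ((\<lambda>t. fderiv (\<Phi> t) x v) has_vector_derivative
        ?DX (t, \<Phi> t x) (0, fderiv (\<Phi> t) x v)) (at t within {0..1})"
  proof (rule smooth_flow[OF Q _ \<rho> _ X0 near(2)])
    show "smooth_on Q X" using XCk by (simp add: smooth_on_def)
    show "{0..1} \<times> cball 0 \<rho> \<subseteq> Q" using near(1) by blast
  qed (assumption+ | rule that; assumption)+
  let ?S = "ball (0::'e) (\<rho> / 2)"
  have \<Phi>Q: "(t, \<Phi> t x) \<in> Q" if "t \<in> {0..1}" "x \<in> ?S" for t x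
    using near(1)[OF that(1)] \<Phi>(4)[OF that(2), of t] by simp
  have D0: "fderiv (\<Phi> 0) x v = v" if "x \<in> ?S" for x v
  proof (rule frechet_derivative_eqI)
    show "(\<Phi> 0 has_derivative (\<lambda>v. v)) (at x)"
      by (rule has_derivative_transform_within_open[OF has_derivative_ident open_ball that]) (simp add: \<Phi>(2))
  qed
  have const: "f 1 = f 0" if f': "\<And>t. t \<in> {0..1} \<Longrightarrow> (f has_vector_derivative 0) (at t within {0..1})"
    for f :: "real \<Rightarrow> 'x::real_normed_vector"
  proof -
    obtain c where "\<And>t. t \<in> {0..1} \<Longrightarrow> f t = c"
      using has_vector_derivative_zero_constant[of "{0..1}" f, OF convex_real_interval(5) f'] by blast
    then show ?thesis by simp
  qed
  have D1: "fderiv (\<Phi> 1) 0 v = v" for v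
  proof -
    have m: "0 \<in> ?S" using \<rho> by simp
    have "fderiv (\<Phi> 1) 0 v = fderiv (\<Phi> 0) 0 v"
      by (rule const) (use \<Phi>(6)[OF m] DX0 in \<open>simp add: \<Phi>(3)\<close>)
    then show ?thesis using D0[OF m] by simp
  qed
  have pull: "Z (\<Phi> 1 x) (fderiv (\<Phi> 1) x u) (fderiv (\<Phi> 1) x v) = Z 0 u v"
    if x: "x \<in> ?S" for x u v
  proof -
    let ?q = "\<lambda>u t. fderiv (\<Phi> t) x u"
    let ?z = "\<lambda>t. (t, \<Phi> t x)"
    have "((\<lambda>t. W (?z t) (?q u t) (?q v t)) has_vector_derivative 0) (at t within {0..1})" if t: "t \<in> {0..1}" for t
    proof -
      note zQ = \<Phi>Q[OF t x]
      have yV: "\<Phi> t x \<in> ?V" using Q_V[OF zQ] by simp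
      let ?x = "X (?z t)" and ?D = "fderiv Z (\<Phi> t x)" and ?E = "fderiv \<eta> (\<Phi> t x)"
      have "(?z has_derivative (\<lambda>s. (s, s *\<^sub>R ?x))) (at t within {0..1})"
        using \<Phi>(5)[OF x t] unfolding has_vector_derivative_def
        by (intro has_derivative_Pair has_derivative_ident)
      from has_derivative_compose[OF this hdW[OF zQ]]
      have "((\<lambda>t. W (?z t)) has_derivative (\<lambda>s. t *\<^sub>R ?D (s *\<^sub>R ?x) + s *\<^sub>R \<alpha> (\<Phi> t x))) (at t within {0..1})"
        by simp
      then have w: "((\<lambda>t. W (?z t)) has_vector_derivative t *\<^sub>R ?D ?x + \<alpha> (\<Phi> t x)) (at t within {0..1})"
        unfolding has_vector_derivative_def linear_scale[OF has_derivative_linear[OF hdZ[OF yV]]]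
        by (simp add: scaleR_add_right mult.commute)
      let ?a = "?q u t" and ?b = "?q v t"
      have der: "((\<lambda>t. W (?z t) (?q u t) (?q v t)) has_vector_derivative
        W (?z t) ?a (?DX (?z t) (0, ?b)) + (W (?z t) (?DX (?z t) (0, ?a)) + (t *\<^sub>R ?D ?x + \<alpha> (\<Phi> t x)) ?a) ?b) (at t within {0..1})"
        by (rule bounded_bilinear.has_vector_derivative[OF bounded_bilinear_blinfun_apply
          bounded_bilinear.has_vector_derivative[OF bounded_bilinear_blinfun_apply w \<Phi>(6)[OF x t]] \<Phi>(6)[OF x t]])
      have Wd: "W (?z t) (?DX (?z t) (0, c)) e = - ?E c e - t * ?D c ?x e" for c e
        using arg_cong[OF dWX[OF zQ, of "(0, c)"], of "\<lambda>l. blinfun_apply l e"]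
        by (simp add: blinfun.bilinear_simps)
      have Walt: "W (?z t) c e = - W (?z t) e c" for c e
        unfolding W_def blinfun.add_left blinfun.scaleR_left fst_conv snd_conv
        using alt[unfolded alternating_on_def, rule_format, OF 0, of c e] \<alpha>alt[OF yV, of c e] by simp
      have "W (?z t) ?a (?DX (?z t) (0, ?b)) = ?E ?b ?a + t * ?D ?b ?x ?a"
        using Walt[of ?a "?DX (?z t) (0, ?b)"] Wd[of ?b ?a] by linarith
      \<comment> \<open>The time derivative is regrouped into \<alpha> minus the exterior derivative
        of \<eta>, plus \<open>t\<close> times the exterior derivative of \<open>Z\<close>; both
        groups vanish.\<close>
      then have "W (?z t) ?a (?DX (?z t) (0, ?b)) + (W (?z t) (?DX (?z t) (0, ?a)) + (t *\<^sub>R ?D ?x + \<alpha> (\<Phi> t x)) ?a) ?b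
        = (?E ?b ?a - ?E ?a ?b + \<alpha> (\<Phi> t x) ?a ?b) + t * (?D ?x ?a ?b - ?D ?a ?x ?b + ?D ?b ?x ?a)"
        unfolding blinfun.add_left blinfun.scaleR_left Wd by (simp add: algebra_simps)
      also have "\<dots> = 0" using d\<eta>[OF yV, of ?a ?b] \<alpha>cl[OF yV, of ?x ?a ?b] by simp
      finally show ?thesis using der by (simp only:)
    qed
    from const[OF this] have "W (?z 1) (?q u 1) (?q v 1) = W (?z 0) (?q u 0) (?q v 0)" .
    then show ?thesis by (simp add: W_def \<alpha>_def D0[OF x])
  qed
  show ?thesis
  proof (rule that[of "\<rho> / 2" "\<Phi> 1"])
    show "\<Phi> 1 ` ?S \<subseteq> ?V"
    proof (rule image_subsetI)
      fix x assume "x \<in> ?S"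
      from Q_V[OF \<Phi>Q[OF _ this, of 1]] show "\<Phi> 1 x \<in> ?V" by simp
    qed
  qed (use \<rho> \<Phi>(1,3) D1 pull in auto)
qed

section \<open>Local normal form in the model space\<close>

definition std_form :: "'s \<Rightarrow> ('n::finite, 's::finite) model \<Rightarrow> ('n, 's) model \<Rightarrow> real" where
  "std_form j u v = (\<Sum>i\<in>UNIV. fst u $ i * snd v $ j $ i - fst v $ i * snd u $ j $ i)"

text \<open>Written as a finite sum of multiples of fixed vectors, so that differentiability and
  regularity in the coefficients follow from the rules for sums and bounded linear maps.\<close>

definition y_vec :: "('s \<Rightarrow> 'n \<Rightarrow> real) \<Rightarrow> ('n::finite, 's::finite) model" where
  "y_vec c = (\<Sum>j\<in>UNIV. \<Sum>i\<in>UNIV. c j i *\<^sub>R (0, axis j (axis i 1)))"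

lemma y_vec_simps [simp]: "fst (y_vec c) = 0" "snd (y_vec c) $ j $ i = c j i"
proof -
  have ax: "axis j' (axis i' (1::real)) $ j $ i = (if i' = i then if j' = j then 1 else 0 else 0)" for j' i'
    by (simp add: axis_def)
  show "fst (y_vec c) = 0" by (simp add: y_vec_def fst_sum)
  have "snd (y_vec c) $ j $ i = (\<Sum>j'\<in>UNIV. \<Sum>i'\<in>UNIV. c j' i' * (if i' = i then if j' = j then 1 else 0 else 0))"
    by (simp add: y_vec_def snd_sum ax)
  also have "\<dots> = c j i" by (simp add: if_distrib[of "\<lambda>x. _ * x"] cong: if_cong)
  finally show "snd (y_vec c) $ j $ i = c j i" .
qed

lemma model_eqI:
  fixes u v :: "('n::finite, 's::finite) model"
  assumes "\<And>i. fst u $ i = fst v $ i" "\<And>j i. snd u $ j $ i = snd v $ j $ i"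
  shows "u = v"
  using assms by (auto intro!: prod_eqI simp: vec_eq_iff)

text \<open>If the fibres of the projection to the \<open>x\<close>-coordinates are isotropic, then the two-step homotopy
  first along the fibres and then radially in the \<open>x\<close>-space yields primitives that vanish on the
  fibres, \<open>\<eta>\<^sub>j = - \<Sum>\<^sub>i f\<^sub>i\<^sup>j dx\<^sub>i\<close>, and \<open>x\<^sub>i, f\<^sub>i\<^sup>j\<close> are the required coordinates.\<close>

proposition relative_darboux:
  fixes Z :: "'s::finite \<Rightarrow> ('n::finite, 's) model \<Rightarrow> ('n, 's) model bilinear_form"
  assumes r: "r > 0" and Z: "\<And>j. smooth_on (ball 0 r) (Z j)" and alt: "\<And>j. alternating_on (ball 0 r) (Z j)"
    and closed: "\<And>j. closed_on (ball 0 r) (Z j)"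
    and Z0: "\<And>j u v. Z j 0 u v = std_form j u v"
    and iso: "\<And>j y b b'. y \<in> ball 0 r \<Longrightarrow> Z j y (0, b) (0, b') = 0"
  obtains f where "smooth_on (ball 0 r) f" "f 0 = 0" "\<And>v. fderiv f 0 v = v"
    "\<And>j y u v. y \<in> ball 0 r \<Longrightarrow> std_form j (fderiv f y u) (fderiv f y v) = Z j y u v"
proof -
  let ?V = "ball (0::('n, 's) model) r"
  have 0: "0 \<in> ?V" using r by simp
  define P where "P = Blinfun (\<lambda>y :: ('n, 's) model. (fst y, 0 :: (real^'n)^'s))"
  have P: "P y = (fst y, 0)" for y
  proof -
    have "bounded_linear (\<lambda>y :: ('n, 's) model. (fst y, 0 :: (real^'n)^'s))"
      by (intro bounded_linear_Pair bounded_linear_fst bounded_linear_zero)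
    from bounded_linear_Blinfun_apply[OF this] show ?thesis by (simp add: P_def)
  qed
  let ?A = "\<lambda>t. P + t *\<^sub>R (id_blinfun - P)"
  have A: "?A t y = (fst y, t *\<^sub>R snd y)" for t y
    by (simp add: blinfun.bilinear_simps P prod_eq_iff)
  have Anorm: "norm (?A t y) \<le> norm y" if "t \<in> {0..1}" for t y
  proof -
    have "norm (t *\<^sub>R snd y) \<le> norm (snd y)" using that by (simp add: mult_left_le_one_le)
    then have "norm (?A t y) \<le> sqrt ((norm (fst y))\<^sup>2 + (norm (snd y))\<^sup>2)"
      unfolding A norm_Pair by (intro real_sqrt_le_mono add_left_mono power_mono) auto
    then show ?thesis by (simp add: norm_prod_def)
  qed
  have PV: "P y \<in> ?V" if "y \<in> ?V" for y using Anorm[of 0 y] that by simp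
  let ?O = "0 :: ('n, 's) model \<Rightarrow>\<^sub>L ('n, 's) model"
  let ?T = "\<lambda>t. ?O + t *\<^sub>R (id_blinfun - ?O)"
  have T: "norm (?T t y) \<le> norm y" if "t \<in> {0..1}" for t y
    using that by (simp add: blinfun.bilinear_simps mult_left_le_one_le)
  have "\<exists>\<eta> :: ('n, 's) model \<Rightarrow> ('n, 's) model \<Rightarrow>\<^sub>L real. smooth_on ?V \<eta> \<and>
    (\<forall>y\<in>?V. \<forall>b. blinfun_apply (\<eta> y) (0, b) = 0) \<and> \<eta> 0 = 0 \<and>
    (\<forall>y\<in>?V. \<forall>u v. blinfun_apply (fderiv \<eta> y u) v
      - blinfun_apply (fderiv \<eta> y v) u = Z j y u v) \<and>
    (\<forall>u a. blinfun_apply (fderiv \<eta> 0 u) (a, 0) = std_form j (0, snd u) (a, 0))" for j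
  proof -
    obtain \<eta>1 :: "('n, 's) model \<Rightarrow> ('n, 's) model \<Rightarrow>\<^sub>L real" where \<eta>1: "smooth_on ?V \<eta>1"
      "\<And>y u. y \<in> ?V \<Longrightarrow> \<eta>1 y u = integral {0..1} (\<lambda>t. Z j (?A t y) (y - P y) (?A t u))"
      "\<And>y u v. y \<in> ?V \<Longrightarrow> fderiv \<eta>1 y u v - fderiv \<eta>1 y v u = Z j y u v - Z j (P y) (P u) (P v)"
      "\<And>u v. r > 0 \<Longrightarrow> fderiv \<eta>1 0 u v = integral {0..1} (\<lambda>t. Z j 0 (u - P u) (?A t v))"
      by (rule homotopy_primitive[of r "Z j" P, OF Z alt closed Anorm]) (assumption | rule that; assumption)+
    obtain \<eta>0 :: "('n, 's) model \<Rightarrow> ('n, 's) model \<Rightarrow>\<^sub>L real" where \<eta>0: "smooth_on ?V \<eta>0"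
      "\<And>y u. y \<in> ?V \<Longrightarrow> \<eta>0 y u = integral {0..1} (\<lambda>t. Z j (?T t y) (y - ?O y) (?T t u))"
      "\<And>y u v. y \<in> ?V \<Longrightarrow> fderiv \<eta>0 y u v - fderiv \<eta>0 y v u = Z j y u v - Z j (?O y) (?O u) (?O v)"
      "\<And>u v. r > 0 \<Longrightarrow> fderiv \<eta>0 0 u v = integral {0..1} (\<lambda>t. Z j 0 (u - ?O u) (?T t v))"
      by (rule homotopy_primitive[of r "Z j" ?O, OF Z alt closed T]) (assumption | rule that; assumption)+
    \<comment> \<open>The exterior derivative of \<open>\<eta>1\<close> is \<open>Z j\<close> minus
      its pullback along \<open>P\<close>, and the pullback of \<open>\<eta>0\<close> along
      \<open>P\<close> supplies the missing part.\<close>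
    define \<eta> where "\<eta> = (\<lambda>y. \<eta>1 y + (\<eta>0 (P y) o\<^sub>L P))"
    have hd: "(\<eta> has_derivative (\<lambda>u. fderiv \<eta>1 y u + (fderiv \<eta>0 (P y) (P u) o\<^sub>L P))) (at y)"
      if y: "y \<in> ?V" for y
    proof -
      have "((\<lambda>y. \<eta>0 (P y)) has_derivative (\<lambda>u. fderiv \<eta>0 (P y) (P u))) (at y)"
        by (rule has_derivative_compose[OF bounded_linear_imp_has_derivative[OF blinfun.bounded_linear_right] smooth_onD[OF \<eta>0(1) PV[OF y]]])
      from has_derivative_add[OF smooth_onD[OF \<eta>1(1) y]
          bounded_linear.has_derivative[OF bounded_bilinear.bounded_linear_left[OF bounded_bilinear_blinfun_compose, of P] this]]
      show ?thesis unfolding \<eta>_def .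
    qed
    have d: "fderiv \<eta> y u v = fderiv \<eta>1 y u v + fderiv \<eta>0 (P y) (P u) (P v)"
      if "y \<in> ?V" for y u v
      using frechet_derivative_eqI[OF hd[OF that], of u] by (simp add: blinfun.add_left)
    have "Ck_on k ?V \<eta>" for k
      unfolding \<eta>_def
      by (intro Ck_on_add open_ball smooth_on_imp_Ck_on[OF \<eta>1(1)] Ck_on_bilinear[OF open_ball bounded_bilinear_blinfun_compose]
          Ck_on_const Ck_on_compose[OF open_ball open_ball _ Ck_on_linear[OF open_ball blinfun.bounded_linear_right] smooth_on_imp_Ck_on[OF \<eta>0(1)]])
         (use PV in auto)
    then have s: "smooth_on ?V \<eta>" by (simp add: smooth_on_def)
    \<comment> \<open>Both \<open>y - P y\<close> and \<open>?A t (0, b)\<close> are tangent to the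
      fibres, so \<open>iso\<close> kills the integrand of \<open>\<eta>1\<close>; in the other
      summand \<open>P\<close> kills \<open>(0, b)\<close>.\<close>
    have van: "\<eta> y (0, b) = 0" if y: "y \<in> ?V" for y b
    proof -
      have "Z j (?A t y) (y - P y) (?A t (0, b)) = 0" if "t \<in> {0..1}" for t
      proof -
        have "?A t y \<in> ?V" using Anorm[OF that, of y] y by simp
        moreover have "y - P y = (0, snd y)" by (simp add: P prod_eq_iff)
        moreover have "?A t (0, b) = (0, t *\<^sub>R b)" by (simp add: A)
        ultimately show ?thesis using iso by (simp only:)
      qed
      then have "\<eta>1 y (0, b) = 0" unfolding \<eta>1(2)[OF y] by (metis (no_types, lifting) integral_cong integral_0)
      then show ?thesis by (simp add: \<eta>_def blinfun.add_left P flip: zero_prod_def)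
    qed
    have "\<eta>1 0 = 0" by (rule blinfun_eqI) (simp add: \<eta>1(2)[OF 0])
    moreover have "\<eta>0 0 = 0" by (rule blinfun_eqI) (simp add: \<eta>0(2)[OF 0])
    ultimately have e0: "\<eta> 0 = 0" by (simp add: \<eta>_def blinfun_eqI)
    have ext: "fderiv \<eta> y u v - fderiv \<eta> y v u = Z j y u v" if y: "y \<in> ?V" for y u v
      using \<eta>1(3)[OF y, of u v] \<eta>0(3)[OF PV[OF y], of "P u" "P v"] by (simp add: d[OF y] P)
    \<comment> \<open>The fibre contraction fixes \<open>(a, 0)\<close>, so its integrand is
      constant in \<open>t\<close>; the radial part contributes nothing because the model form
      vanishes on two x-vectors. This is what makes the derivative of \<open>f\<close> at 0 the
      identity.\<close>
    have "fderiv \<eta> 0 u (a, 0) = std_form j (0, snd u) (a, 0)" for u a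
    proof -
      have "u - P u = (0, snd u)" by (simp add: P prod_eq_iff)
      moreover have "?A t (a, 0) = (a, 0)" for t by (simp add: A)
      ultimately have 1: "fderiv \<eta>1 0 u (a, 0) = std_form j (0, snd u) (a, 0)"
        by (simp only: \<eta>1(4)[OF r] Z0) simp
      have "fderiv \<eta>0 0 (P u) (P (a, 0)) = 0"
        unfolding \<eta>0(4)[OF r] by (simp add: Z0 P blinfun.bilinear_simps std_form_def)
      with 1 show ?thesis using d[OF 0, of u "(a, 0)"] by simp
    qed
    with s van e0 ext show ?thesis by blast
  qed
  then obtain \<eta> :: "'s \<Rightarrow> ('n, 's) model \<Rightarrow> ('n, 's) model \<Rightarrow>\<^sub>L real" where \<eta>: "\<And>j. smooth_on ?V (\<eta> j)"
    "\<And>j y b. y \<in> ?V \<Longrightarrow> \<eta> j y (0, b) = 0" "\<And>j. \<eta> j 0 = 0"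
    "\<And>j y u v. y \<in> ?V \<Longrightarrow> fderiv (\<eta> j) y u v - fderiv (\<eta> j) y v u = Z j y u v"
    "\<And>j u a. fderiv (\<eta> j) 0 u (a, 0) = std_form j (0, snd u) (a, 0)"
    by metis
  let ?e = "\<lambda>i. (axis i 1, 0) :: ('n, 's) model"
  \<comment> \<open>The minus sign reflects the order of factors: the differential of a coefficient
    times \<open>dx\<close> has \<open>dx\<close> second, whereas \<open>std_form\<close> has it
    first.\<close>
  define f where "f = (\<lambda>y. P y + y_vec (\<lambda>j i. - \<eta> j y (?e i)))"
  let ?d = "\<lambda>j y. fderiv (\<eta> j) y"
  have hd\<eta>: "((\<lambda>y. \<eta> j y w) has_derivative (\<lambda>u. ?d j y u w)) (at y)" if "y \<in> ?V" for j y w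
    by (rule bounded_linear.has_derivative[OF blinfun.bounded_linear_left smooth_onD[OF \<eta>(1) that]])
  have hdf: "(f has_derivative (\<lambda>u. P u + y_vec (\<lambda>j i. - ?d j y u (?e i)))) (at y)" if "y \<in> ?V" for y
    unfolding f_def y_vec_def
    by (intro has_derivative_add bounded_linear_imp_has_derivative[OF blinfun.bounded_linear_right] has_derivative_sum
        bounded_linear.has_derivative[OF bounded_linear_scaleR_left] has_derivative_minus hd\<eta>[OF that])
  have df: "fderiv f y u = P u + y_vec (\<lambda>j i. - ?d j y u (?e i))" if "y \<in> ?V" for y u
    by (rule frechet_derivative_eqI[OF hdf[OF that]])
  have axis_sum: "(\<Sum>i\<in>UNIV. a $ i * l (?e i)) = l (a, 0)" for a and l :: "('n, 's) model \<Rightarrow>\<^sub>L real"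
  proof -
    have "(a, 0) = (\<Sum>i\<in>UNIV. (a $ i) *\<^sub>R ?e i)"
      by (simp add: prod_eq_iff fst_sum snd_sum vec_eq_iff axis_def if_distrib[of "\<lambda>x. _ * x"] cong: if_cong)
    then have "l (a, 0) = l (\<Sum>i\<in>UNIV. (a $ i) *\<^sub>R ?e i)" by (simp only:)
    then show ?thesis by (simp add: blinfun.sum_right blinfun.scaleR_right del: scaleR_Pair)
  qed
  have split: "l u = l (fst u, 0) + l (0, snd u)" for u and l :: "('n, 's) model \<Rightarrow>\<^sub>L real"
    by (simp flip: blinfun.add_right)
  show ?thesis
  proof (rule that[of f])
    have "Ck_on k ?V f" for k
      unfolding f_def y_vec_def
      by (intro Ck_on_add Ck_on_sum open_ball Ck_on_linear blinfun.bounded_linear_right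
          Ck_on_bounded_linear[OF open_ball bounded_linear_scaleR_left] Ck_on_uminus
          Ck_on_bounded_linear[OF open_ball blinfun.bounded_linear_left] smooth_on_imp_Ck_on[OF \<eta>(1)])
    then show "smooth_on ?V f" by (simp add: smooth_on_def)
    show "f 0 = 0" by (rule model_eqI) (simp_all add: f_def P \<eta>(3))
    show "fderiv f 0 v = v" for v
    proof (rule model_eqI)
      show "fst (fderiv f 0 v) $ i = fst v $ i" for i by (simp add: df[OF 0] P)
      have "std_form j (0, snd v) (?e i) = - snd v $ j $ i" for j i
        by (simp add: std_form_def axis_def if_distrib[of "\<lambda>x. x * _"] sum_negf cong: if_cong)
      then show "snd (fderiv f 0 v) $ j $ i = snd v $ j $ i" for j i
        by (simp add: df[OF 0] P \<eta>(5))
    qed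
    show "std_form j (fderiv f y u) (fderiv f y v) = Z j y u v" if y: "y \<in> ?V" for j y u v
    proof -
      \<comment> \<open>The value of \<open>\<eta> j\<close> on a fixed fibre vector is zero at all
        points of the ball, so its derivative vanishes as well and only the vectors
        \<open>?e i\<close> contribute.\<close>
      have d0: "?d j y w (0, b) = 0" for w b
      proof -
        have "((\<lambda>y. \<eta> j y (0, b)) has_derivative (\<lambda>w. 0)) (at y)"
          by (rule has_derivative_transform_within_open[OF has_derivative_const open_ball y]) (simp add: \<eta>(2))
        from has_derivative_unique[OF hd\<eta>[OF y] this] show ?thesis by metis
      qed
      have "std_form j (fderiv f y u) (fderiv f y v)
          = (\<Sum>i\<in>UNIV. fst v $ i * ?d j y u (?e i)) - (\<Sum>i\<in>UNIV. fst u $ i * ?d j y v (?e i))"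
        by (simp add: std_form_def df[OF y] P sum_subtractf sum_negf)
      also have "\<dots> = ?d j y u v - ?d j y v u"
        by (simp add: axis_sum split[of "?d j y u" v] split[of "?d j y v" u] d0)
      finally show ?thesis by (simp add: \<eta>(4)[OF y])
    qed
  qed
qed

section \<open>One local normal form for a single form and for several forms\<close>

lemma smooth_on_subset: "smooth_on S f \<Longrightarrow> T \<subseteq> S \<Longrightarrow> smooth_on T f"
  unfolding smooth_on_def using Ck_on_subset by blast

lemma std_form_nondegenerate:
  fixes u :: "('n::finite, 's::finite) model"
  assumes "\<And>j v. std_form j u v = 0"
  shows "u = 0"
proof (rule model_eqI)
  show "fst u $ i = fst 0 $ i" for i
  proof -
    fix j
    \<comment> \<open>Any \<open>j\<close> serves here, as the index type is inhabited.\<close>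
    have "std_form j u (0, axis j (axis i 1)) = fst u $ i"
      by (simp add: std_form_def axis_def if_distrib[of "\<lambda>x. _ * x"] cong: if_cong)
    then show ?thesis using assms by simp
  qed
  show "snd u $ j $ i = snd 0 $ j $ i" for j i
  proof -
    have "std_form j u (axis i 1, 0) = - snd u $ j $ i"
      by (simp add: std_form_def axis_def if_distrib[of "\<lambda>x. x * _"] sum_negf cong: if_cong)
    then show ?thesis using assms by simp
  qed
qed

text \<open>For a single form the straightened distribution is zero and says nothing about the
  y-fibres, so \<open>iso\<close> is conditional and the two cases need different arguments. Both
  end with derivative the identity at 0, which preserves differentials prescribed there.\<close>

theorem local_polysymplectic_darboux:
  fixes Z :: "'s::finite \<Rightarrow> ('n::finite, 's) model \<Rightarrow> ('n, 's) model bilinear_form"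
  assumes r: "r > 0" and Z: "\<And>j. smooth_on (ball 0 r) (Z j)" and alt: "\<And>j. alternating_on (ball 0 r) (Z j)"
    and closed: "\<And>j. closed_on (ball 0 r) (Z j)"
    and Z0: "\<And>j u v. Z j 0 u v = std_form j u v"
    and iso: "\<And>j y b b'. CARD('s) \<noteq> 1 \<Longrightarrow> y \<in> ball 0 r \<Longrightarrow> Z j y (0, b) (0, b') = 0"
  obtains H H' U V where "open U" "open V" "0 \<in> U" "U \<subseteq> ball 0 r" "homeomorphism U V H H'"
    "smooth_on U H" "smooth_on V H'" "H 0 = 0" "\<And>v. fderiv H 0 v = v"
    "\<And>j y u v. y \<in> U \<Longrightarrow> std_form j (fderiv H y u) (fderiv H y v) = Z j y u v"
proof (cases "CARD('s) = 1")
  case False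
  obtain f where f: "smooth_on (ball 0 r) f" "f 0 = 0" "\<And>v. fderiv f 0 v = v"
    "\<And>j y u v. y \<in> ball 0 r \<Longrightarrow> std_form j (fderiv f y u) (fderiv f y v) = Z j y u v"
    by (rule relative_darboux[OF r Z alt closed Z0 iso[OF False]]) (assumption | rule that; assumption)+
  have 0: "0 \<in> ball (0::('n, 's) model) r" using r by simp
  obtain U V g where "open U" "U \<subseteq> ball 0 r" "0 \<in> U" "open V" "homeomorphism U V f g" "smooth_on V g"
    by (rule smooth_on_local_inverse[OF open_ball f(1) 0]) (use f(3) in auto)
  then show ?thesis using f by (intro that[of U V f g]) (auto intro: smooth_on_subset)
next
  case True
  then obtain j0 :: 's where "UNIV = {j0}" using card_1_singletonE by blast
  then have j: "j = j0" for j :: 's by blast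
  have "u = 0" if "Z j0 0 u = 0" for u
    by (rule std_form_nondegenerate) (metis Z0 blinfun.zero_left j that)
  then obtain \<phi> \<rho> where \<phi>: "\<rho> > 0" "smooth_on (ball 0 \<rho>) \<phi>" "\<phi> 0 = 0" "\<phi> ` ball 0 \<rho> \<subseteq> ball 0 r"
    "\<And>v. fderiv \<phi> 0 v = v"
    "\<And>y u v. y \<in> ball 0 \<rho> \<Longrightarrow> Z j0 (\<phi> y) (fderiv \<phi> y u) (fderiv \<phi> y v) = Z j0 0 u v"
    by (rule moser[OF r Z alt closed]) (assumption | rule that; assumption)+
  have 0: "0 \<in> ball (0::('n, 's) model) \<rho>" using \<phi>(1) by simp
  \<comment> \<open>\<phi> pulls \<open>Z\<close> back to the constant form, so the desired
    coordinates are given by its local inverse \<open>g\<close>.\<close>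
  obtain U V g where UV: "open U" "U \<subseteq> ball 0 \<rho>" "0 \<in> U" "open V" "homeomorphism U V \<phi> g" "smooth_on V g"
    by (rule smooth_on_local_inverse[OF open_ball \<phi>(2) 0]) (use \<phi>(5) in auto)
  have inv: "fderiv \<phi> (g y) (fderiv g y v) = v" "g y \<in> U" "\<phi> (g y) = y" if "y \<in> V" for y v
  proof -
    show gU: "g y \<in> U" and "\<phi> (g y) = y" using UV(5) that by (auto simp: homeomorphism_def)
    have "((\<lambda>y. \<phi> (g y)) has_derivative (\<lambda>v. fderiv \<phi> (g y) (fderiv g y v))) (at y)"
      by (rule has_derivative_compose[OF smooth_onD[OF UV(6) that] smooth_onD[OF \<phi>(2)]]) (use gU UV(2) in blast)
    moreover have "((\<lambda>y. \<phi> (g y)) has_derivative (\<lambda>v. v)) (at y)"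
      by (rule has_derivative_transform_within_open[OF has_derivative_ident UV(4) that])
         (use UV(5) in \<open>auto simp: homeomorphism_def\<close>)
    ultimately show "fderiv \<phi> (g y) (fderiv g y v) = v"
      using has_derivative_unique by metis
  qed
  have 0: "0 \<in> V" "g 0 = 0" using UV(3,5) \<phi>(3) unfolding homeomorphism_def by (metis imageI)+
  show ?thesis
  proof (rule that[of V U g \<phi>])
    show "homeomorphism V U g \<phi>" by (rule homeomorphism_symD[OF UV(5)])
    show "V \<subseteq> ball 0 r" using UV(2,5) \<phi>(4) by (auto simp: homeomorphism_def)
    show "fderiv g 0 v = v" for v
      using inv(1)[OF 0(1), of v] by (simp add: 0(2) \<phi>(5))
    show "std_form j (fderiv g y u) (fderiv g y v) = Z j y u v" if "y \<in> V" for j y u v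
      using \<phi>(6)[of "g y" "fderiv g y u" "fderiv g y v"] inv[OF that] UV(2)
      by (auto simp: j[of j] Z0)
  qed (use UV \<phi> 0 in \<open>auto intro: smooth_on_subset\<close>)
qed

section \<open>Charts and tangent vectors\<close>

lemma chart_inv_left:
  assumes "smooth_manifold X" "k \<in> atlas X" "q \<in> fst k"
  shows "chart_inv k (snd k q) = q"
proof -
  have "homeomorphic_map (subtopology (mspace X) (fst k)) (top_of_set (chart_range k)) (snd k)"
    "openin (mspace X) (fst k)"
    using assms by (auto simp: smooth_manifold_def)
  then have "inj_on (snd k) (fst k)"
    using homeomorphic_imp_injective_map openin_subset by (metis inf.absorb_iff2 topspace_subtopology)
  then show ?thesis using assms(3) by (simp add: chart_inv_def)
qed

lemma open_chart_image:
  assumes "smooth_manifold X" "k \<in> atlas X" "openin (mspace X) U"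
  shows "open (snd k ` (fst k \<inter> U))"
proof -
  have h: "homeomorphic_map (subtopology (mspace X) (fst k)) (top_of_set (chart_range k)) (snd k)"
    "open (chart_range k)"
    using assms by (auto simp: smooth_manifold_def)
  have "openin (subtopology (mspace X) (fst k)) (fst k \<inter> U)"
    using assms(3) by (auto simp: openin_subtopology)
  then have "openin (top_of_set (chart_range k)) (snd k ` (fst k \<inter> U))"
    using homeomorphic_imp_open_map[OF h(1)] by (simp add: open_map_def)
  then show ?thesis using h(2) by (simp add: openin_open_eq)
qed

lemma open_chart_range:
  "smooth_manifold X \<Longrightarrow> k \<in> atlas X \<Longrightarrow> open (chart_range k)"
  by (simp add: smooth_manifold_def)

lemma chart_domain_open:
  "smooth_manifold X \<Longrightarrow> k \<in> atlas X \<Longrightarrow> openin (mspace X) (fst k)"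
  by (simp add: smooth_manifold_def)

lemma transition_at:
  assumes "smooth_manifold X" "k \<in> atlas X" "q \<in> fst k"
  shows "transition k l (snd k q) = snd l q"
  using chart_inv_left[OF assms] by (simp add: transition_def)

lemma transition_has_derivative:
  assumes X: "smooth_manifold X" and k: "k \<in> charts_at X q" and l: "l \<in> charts_at X q"
  shows "(transition k l has_derivative fderiv (transition k l) (snd k q)) (at (snd k q))"
proof (rule smooth_onD)
  show "smooth_on (snd k ` (fst k \<inter> fst l)) (transition k l)"
    using assms by (simp add: smooth_manifold_def charts_at_def)
qed (use k l in \<open>auto simp: charts_at_def\<close>)

text \<open>With a chart map for \<open>f\<close> this becomes the cocycle rule of the transition
  maps; with general \<open>f\<close> it shows that \<open>differential\<close> is independent of
  the chart.\<close>

lemma transition_chain: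
  assumes X: "smooth_manifold X" and k: "k \<in> charts_at X q" and l: "l \<in> charts_at X q"
    and f: "(f \<circ> chart_inv l has_derivative f') (at (snd l q))"
  shows "(f \<circ> chart_inv k has_derivative (\<lambda>u. f' (fderiv (transition k l) (snd k q) u))) (at (snd k q))"
proof -
  have kl: "k \<in> atlas X" "q \<in> fst k" "l \<in> atlas X" "q \<in> fst l" using k l by (auto simp: charts_at_def)
  have "open (snd k ` (fst k \<inter> fst l))"
    by (rule open_chart_image[OF X kl(1) chart_domain_open[OF X kl(3)]])
  moreover have "(f \<circ> chart_inv l) (transition k l x) = (f \<circ> chart_inv k) x" if x: "x \<in> snd k ` (fst k \<inter> fst l)" for x
    using x chart_inv_left[OF X kl(1)] chart_inv_left[OF X kl(3)] by (auto simp: transition_def)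
  moreover have "((\<lambda>x. (f \<circ> chart_inv l) (transition k l x)) has_derivative
      (\<lambda>u. f' (fderiv (transition k l) (snd k q) u))) (at (snd k q))"
    by (rule has_derivative_compose[OF transition_has_derivative[OF X k l]])
       (use f transition_at[OF X kl(1,2)] in \<open>simp add: o_def\<close>)
  ultimately show ?thesis
    using has_derivative_transform_within_open[of "\<lambda>x. (f \<circ> chart_inv l) (transition k l x)"] kl by blast
qed

lemma transition_cocycle:
  assumes X: "smooth_manifold X" and k: "k \<in> charts_at X q" and l: "l \<in> charts_at X q" and m: "m \<in> charts_at X q"
  shows "fderiv (transition k m) (snd k q) u =
    fderiv (transition l m) (snd l q) (fderiv (transition k l) (snd k q) u)"
  using frechet_derivative_eqI[OF transition_chain[OF X k l transition_has_derivative[OF X l m, unfolded transition_def]]]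
  by (simp add: transition_def)

lemma transition_self:
  assumes X: "smooth_manifold X" and k: "k \<in> charts_at X q"
  shows "fderiv (transition k k) (snd k q) u = u"
proof (rule frechet_derivative_eqI)
  have k': "k \<in> atlas X" "q \<in> fst k" using k by (auto simp: charts_at_def)
  have "x = transition k k x" if "x \<in> chart_range k" for x
    using that by (auto simp: chart_range_def transition_at[OF X k'(1)])
  then show "(transition k k has_derivative (\<lambda>u. u)) (at (snd k q))"
    using has_derivative_transform_within_open[OF has_derivative_ident open_chart_range[OF X k'(1)]] k'(2)
    by (metis chart_range_def imageI)
qed

section \<open>Tangent spaces in terms of one chart\<close>

lemma tvec_eqI: "(\<And>l. coord u l = coord v l) \<Longrightarrow> u = v"
  by (metis coord_inject ext)

lemma coord_simps [simp]:
  "coord (0 :: ('a, 'e::real_vector) tvec) k = 0"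
  "coord (u + v :: ('a, 'e::real_vector) tvec) k = coord u k + coord v k"
  "coord (c *\<^sub>R u :: ('a, 'e::real_vector) tvec) k = c *\<^sub>R coord u k"
  by (simp_all add: zero_tvec_def plus_tvec_def scaleR_tvec_def Tvec_inverse)

lemma coord_tangent_of:
  "coord (tangent_of X q k u) l = (if l \<in> charts_at X q then fderiv (transition k l) (snd k q) u else 0)"
  by (simp add: tangent_of_def Tvec_inverse)

lemma tangent_of_in_tangent_space:
  assumes "smooth_manifold X" "k \<in> charts_at X q"
  shows "tangent_of X q k u \<in> tangent_space X q"
proof -
  have "coord (tangent_of X q k u) m = fderiv (transition l m) (snd l q) (coord (tangent_of X q k u) l)"
    if "l \<in> charts_at X q" "m \<in> charts_at X q" for l m
    unfolding coord_tangent_of if_P[OF that(1)] if_P[OF that(2)] by (rule transition_cocycle[OF assms that])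
  moreover have "coord (tangent_of X q k u) l = 0" if "l \<notin> charts_at X q" for l
    using that by (simp add: coord_tangent_of)
  ultimately show ?thesis unfolding tangent_space_def by blast
qed

lemma coord_tangent_of_self:
  assumes "smooth_manifold X" "k \<in> charts_at X q"
  shows "coord (tangent_of X q k u) k = u"
  using assms by (simp add: coord_tangent_of transition_self)

lemma tangent_of_coord:
  assumes "k \<in> charts_at X q" "v \<in> tangent_space X q"
  shows "tangent_of X q k (coord v k) = v"
proof (rule tvec_eqI)
  show "coord (tangent_of X q k (coord v k)) l = coord v l" for l
  proof (cases "l \<in> charts_at X q")
    case True
    then have "coord v l = fderiv (transition k l) (snd k q) (coord v k)"
      using assms unfolding tangent_space_def by blast
    then show ?thesis by (simp only: coord_tangent_of True if_True)
  next
    case False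
    then have "coord v l = 0" using assms(2) unfolding tangent_space_def by blast
    then show ?thesis by (simp only: coord_tangent_of False if_False)
  qed
qed

lemma linear_tangent_of:
  assumes X: "smooth_manifold X" and k: "k \<in> charts_at X q"
  shows "linear (tangent_of X q k)"
proof (rule linearI)
  have lin: "linear (fderiv (transition k l) (snd k q))" if "l \<in> charts_at X q" for l
    using has_derivative_linear[OF transition_has_derivative[OF X k that]] .
  show "tangent_of X q k (u + v) = tangent_of X q k u + tangent_of X q k v" for u v
    by (rule tvec_eqI) (auto simp: coord_tangent_of linear_add[OF lin])
  show "tangent_of X q k (c *\<^sub>R u) = c *\<^sub>R tangent_of X q k u" for c u
    by (rule tvec_eqI) (auto simp: coord_tangent_of linear_scale[OF lin])
qed

text \<open>\<open>differential\<close> is defined with an arbitrarily chosen chart at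
  \<open>q\<close>; this allows computing it in whichever chart is at hand.\<close>

lemma differential_in_chart:
  assumes X: "smooth_manifold X" and k: "k \<in> charts_at X q" and v: "v \<in> tangent_space X q"
    and f: "(f \<circ> chart_inv k has_derivative f') (at (snd k q))"
  shows "differential X f q v = f' (coord v k)"
proof -
  let ?l = "chart_at X q"
  have l: "?l \<in> charts_at X q" unfolding chart_at_def using k by (rule someI)
  have "coord v k = fderiv (transition ?l k) (snd ?l q) (coord v ?l)"
    using v k l unfolding tangent_space_def by blast
  then show ?thesis
    unfolding differential_def Let_def frechet_derivative_eqI[OF transition_chain[OF X l k f]] by (simp only:)
qed

lemma mspace_euclidean [simp]: "mspace euclidean_manifold = euclidean"
  and atlas_euclidean [simp]: "atlas euclidean_manifold = {(UNIV, \<lambda>x. x)}"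
  by (simp_all add: euclidean_manifold_def)

lemma chart_inv_UNIV [simp]: "chart_inv (UNIV, \<lambda>x. x) = (\<lambda>x. x)"
  by (simp add: chart_inv_def fun_eq_iff inv_into_f_f[of "\<lambda>x. x" UNIV, simplified])

lemma charts_at_euclidean [simp]: "charts_at euclidean_manifold z = {(UNIV, \<lambda>x. x)}"
  by (auto simp: charts_at_def)

lemma chart_at_euclidean [simp]: "chart_at euclidean_manifold z = (UNIV, \<lambda>x. x)"
  by (simp add: chart_at_def)

text \<open>The coordinate functions of the model space are linear, so each is its own differential,
  and in the identity chart the tangent map is just \<open>differential X F q\<close>.\<close>

lemma standard_form_tangent_map:
  fixes F :: "'a \<Rightarrow> ('n::finite, 's::finite) model"
  shows "standard_form j (F q) (tangent_map X euclidean_manifold F q u) (tangent_map X euclidean_manifold F q v)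
    = std_form j (differential X F q u) (differential X F q v)"
proof -
  have bl: "bounded_linear (x_coord i)" "bounded_linear (y_coord i j)" for i :: 'n and j :: 's
    unfolding x_coord_def y_coord_def
    by (intro bounded_linear_compose[OF bounded_linear_vec_nth] bounded_linear_fst bounded_linear_snd)+
  have d: "fderiv L z w = L w" if "bounded_linear L" for L :: "('n, 's) model \<Rightarrow> real" and z w
    by (rule frechet_derivative_eqI[OF bounded_linear_imp_has_derivative[OF that]])
  have c: "coord (tangent_map X euclidean_manifold F q u) (UNIV, \<lambda>x. x) = differential X F q u" for u
    by (simp add: tangent_map_def Tvec_inverse o_def)
  have "differential euclidean_manifold (x_coord i) (F q) (tangent_map X euclidean_manifold F q u) = fst (differential X F q u) $ i" for u i
    by (simp add: differential_def[of euclidean_manifold] o_def d[OF bl(1)] c) (simp add: x_coord_def)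
  moreover have "differential euclidean_manifold (y_coord i j) (F q) (tangent_map X euclidean_manifold F q u) = snd (differential X F q u) $ j $ i" for u i
    by (simp add: differential_def[of euclidean_manifold] o_def d[OF bl(2)] c) (simp add: y_coord_def)
  ultimately show ?thesis
    by (simp add: standard_form_def std_form_def wedge_def)
qed

lemma diffeo_between_euclideanD:
  fixes F :: "'a \<Rightarrow> 'f::euclidean_space"
  assumes "diffeo_between X U euclidean_manifold V F"
  shows "openin (mspace X) U" "open V" "bij_betw F U V"
    "continuous_map (subtopology (mspace X) U) euclidean F"
    "\<And>k. k \<in> atlas X \<Longrightarrow> smooth_on (snd k ` (fst k \<inter> U)) (F \<circ> chart_inv k)"
    "continuous_map (top_of_set V) (mspace X) (inv_into U F)"
    "\<And>k. k \<in> atlas X \<Longrightarrow> smooth_on {y \<in> V. inv_into U F y \<in> fst k} (snd k \<circ> inv_into U F)"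
  using assms by (auto simp: diffeo_between_def smooth_map_on_def o_def Int_def cong: conj_cong)

lemma diffeo_between_compose:
  fixes F :: "'a \<Rightarrow> 'f::euclidean_space" and h :: "'f \<Rightarrow> 'g::euclidean_space"
  assumes X: "smooth_manifold X" and F: "diffeo_between X U euclidean_manifold V F"
    and W: "open W" "W \<subseteq> V" and V': "open V'"
    and hom: "homeomorphism W V' h h'" and h: "smooth_on W h" and h': "smooth_on V' h'"
  shows "diffeo_between X {q \<in> U. F q \<in> W} euclidean_manifold V' (h \<circ> F)"
proof -
  let ?U = "{q \<in> U. F q \<in> W}" and ?G = "inv_into U F"
  note U = diffeo_between_euclideanD(1)[OF F] and V = diffeo_between_euclideanD(2)[OF F]
    and bij = diffeo_between_euclideanD(3)[OF F] and cF = diffeo_between_euclideanD(4)[OF F]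
    and sF = diffeo_between_euclideanD(5)[OF F] and cG = diffeo_between_euclideanD(6)[OF F]
    and sG = diffeo_between_euclideanD(7)[OF F]
  have "openin (subtopology (mspace X) U) {q \<in> topspace (subtopology (mspace X) U). F q \<in> W}"
    using openin_continuous_map_preimage[OF cF, of W] W(1) by simp
  moreover have "{q \<in> topspace (subtopology (mspace X) U). F q \<in> W} = ?U"
    using openin_subset[OF U] by auto
  ultimately have oU: "openin (mspace X) ?U" using U openin_trans_full by metis
  have G: "?G y \<in> U" "F (?G y) = y" if "y \<in> V" for y
    using bij that by (auto simp: bij_betw_def inv_into_into f_inv_into_f)
  have hW: "h y \<in> V'" "h' (h y) = y" if "y \<in> W" for y using hom that by (auto simp: homeomorphism_def)
  have hV: "h' y \<in> W" "h' y \<in> V" "h (h' y) = y" if "y \<in> V'" for y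
    using hom that W(2) by (auto simp: homeomorphism_def)
  have injF: "inj_on F U" using bij by (simp add: bij_betw_def)
  have bij': "bij_betw (h \<circ> F) ?U V'"
  proof (rule bij_betwI[where g = "\<lambda>y. ?G (h' y)"])
    show "?G (h' ((h \<circ> F) x)) = x" if "x \<in> ?U" for x using that hW injF by simp
  qed (use hW hV G W(2) in auto)
  \<comment> \<open>\<open>inv_into\<close> is uncontrolled outside \<open>V'\<close>. The identity
    on \<open>V'\<close> suffices, since smoothness is only needed on open subsets of it.\<close>
  have inv: "inv_into ?U (h \<circ> F) y = ?G (h' y)" if "y \<in> V'" for y
  proof (rule inv_into_f_eq)
    show "inj_on (h \<circ> F) ?U" using bij' by (simp add: bij_betw_def)
  qed (use that hV G W(2) in auto)
  show ?thesis
    unfolding diffeo_between_def smooth_map_on_def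
  proof (intro conjI ballI oU bij')
    show "openin (mspace euclidean_manifold) V'" using V' by simp
    have "continuous_map (subtopology (mspace X) ?U) (top_of_set W) F"
      by (rule continuous_map_into_subtopology[OF continuous_map_from_subtopology_mono[OF cF]]) auto
    moreover have "continuous_map (top_of_set W) euclidean h"
      using Ck_on_imp_continuous_on[OF smooth_on_imp_Ck_on[OF h]] by simp
    ultimately show "continuous_map (subtopology (mspace X) ?U) (mspace euclidean_manifold) (h \<circ> F)"
      unfolding mspace_euclidean by (rule continuous_map_compose)
    fix k and l :: "('g, 'g) chart" assume k: "k \<in> atlas X" and l: "l \<in> atlas euclidean_manifold"
    have "Ck_on n (snd k ` (fst k \<inter> ?U)) (\<lambda>x. h ((F \<circ> chart_inv k) x))" for n
    proof (rule Ck_on_compose[OF open_chart_image[OF X k oU] W(1) _ _ smooth_on_imp_Ck_on[OF h]])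
      show "(F \<circ> chart_inv k) ` (snd k ` (fst k \<inter> ?U)) \<subseteq> W"
        using chart_inv_left[OF X k] by auto
      show "Ck_on n (snd k ` (fst k \<inter> ?U)) (F \<circ> chart_inv k)"
        by (rule Ck_on_subset[OF smooth_on_imp_Ck_on[OF sF[OF k]]]) auto
    qed
    then have "smooth_on (snd k ` (fst k \<inter> ?U)) (\<lambda>x. h ((F \<circ> chart_inv k) x))" by (simp add: smooth_on_def)
    moreover have "{q \<in> fst k \<inter> ?U. (h \<circ> F) q \<in> fst l} = fst k \<inter> ?U" using l by auto
    ultimately show "smooth_on (snd k ` {q \<in> fst k \<inter> ?U. (h \<circ> F) q \<in> fst l}) (snd l \<circ> (h \<circ> F) \<circ> chart_inv k)"
      using l by (simp add: o_def)
  next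
    have ch': "continuous_on V' h'" using Ck_on_imp_continuous_on[OF smooth_on_imp_Ck_on[OF h']] .
    have "continuous_map (top_of_set V') (top_of_set V) h'"
      by (rule continuous_map_into_subtopology) (use ch' hV in auto)
    from continuous_map_compose[OF this cG]
    have c: "continuous_map (top_of_set V') (mspace X) (\<lambda>y. ?G (h' y))" by (simp add: o_def)
    then show "continuous_map (subtopology (mspace euclidean_manifold) V') (mspace X) (inv_into ?U (h \<circ> F))"
      unfolding mspace_euclidean by (rule continuous_map_eq) (simp add: inv)
    fix k :: "('g, 'g) chart" and l assume k: "k \<in> atlas euclidean_manifold" and l: "l \<in> atlas X"
    let ?D = "{y \<in> V'. ?G (h' y) \<in> fst l}" and ?E = "{y \<in> V. ?G y \<in> fst l}"
    have "openin (top_of_set V) {y \<in> topspace (top_of_set V). ?G y \<in> fst l}"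
      using openin_continuous_map_preimage[OF cG chart_domain_open[OF X l]] .
    then have oE: "open ?E" using V by (simp add: openin_open_eq)
    have "openin (top_of_set V') {y \<in> topspace (top_of_set V'). ?G (h' y) \<in> fst l}"
      using openin_continuous_map_preimage[OF c chart_domain_open[OF X l]] .
    then have oD: "open ?D" using V' by (simp add: openin_open_eq)
    have "Ck_on n ?D (\<lambda>y. (snd l \<circ> ?G) (h' y))" for n
      by (rule Ck_on_compose[OF oD oE _ Ck_on_subset[OF smooth_on_imp_Ck_on[OF h']] smooth_on_imp_Ck_on[OF sG[OF l]]])
         (use hV W(2) in auto)
    moreover have "Ck_on n ?D (\<lambda>y. (snd l \<circ> ?G) (h' y)) \<longleftrightarrow> Ck_on n ?D (\<lambda>y. snd l (inv_into ?U (h \<circ> F) y))" for n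
      by (rule Ck_on_cong[OF oD]) (simp add: inv)
    ultimately have "smooth_on ?D (\<lambda>y. snd l (inv_into ?U (h \<circ> F) y))" by (simp add: smooth_on_def)
    moreover have "snd k ` {q \<in> fst k \<inter> V'. inv_into ?U (h \<circ> F) q \<in> fst l} = ?D"
      using k inv by auto
    ultimately show "smooth_on (snd k ` {q \<in> fst k \<inter> V'. inv_into ?U (h \<circ> F) q \<in> fst l}) (snd l \<circ> inv_into ?U (h \<circ> F) \<circ> chart_inv k)"
      using k by (simp add: o_def)
  qed
qed

section \<open>Transport of forms from a chart to the model space\<close>

lemma alternating_2form_antisym:
  assumes "alternating_2form_on UNIV \<theta>"
  shows "\<theta> u v = - \<theta> v u"
proof -
  have add: "\<theta> a (b + c) = \<theta> a b + \<theta> a c" "\<theta> (b + c) a = \<theta> b a + \<theta> c a" and "\<theta> a a = 0" for a b c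
    using assms by (auto simp: alternating_2form_on_def linear_form_on_def)
  from this(3)[of "u + v"] this(3)[of u] this(3)[of v] show ?thesis by (simp add: add)
qed

text \<open>Pulling back commutes with the exterior derivative: the extra terms contain second
  derivatives of \<kappa>, which are symmetric, inserted into an alternating form, and cancel in
  pairs. The form is also repackaged as an operator-valued map, as the local arguments
  require.\<close>

lemma pullback_form:
  fixes \<theta> :: "'e::euclidean_space \<Rightarrow> 'e \<Rightarrow> 'e \<Rightarrow> real" and \<kappa> :: "'f::euclidean_space \<Rightarrow> 'e"
  assumes R: "open R" and S: "open S" and \<kappa>: "smooth_on S \<kappa>" and \<kappa>S: "\<And>z. z \<in> S \<Longrightarrow> \<kappa> z \<in> R"
    and alt: "\<And>x. x \<in> R \<Longrightarrow> alternating_2form_on UNIV (\<theta> x)"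
    and smooth: "\<And>u v. smooth_on R (\<lambda>x. \<theta> x u v)"
    and closed: "\<And>x u v w. x \<in> R \<Longrightarrow> ext_deriv2 \<theta> x u v w = 0"
  obtains Z where "smooth_on S Z" "alternating_on S Z" "closed_on S Z"
    "\<And>z u v. z \<in> S \<Longrightarrow> Z z u v = \<theta> (\<kappa> z) (fderiv \<kappa> z u) (fderiv \<kappa> z v)"
proof -
  \<comment> \<open>Meaningful only on \<open>R\<close>, where \<theta> is bilinear and thus bounded
    by finite dimension.\<close>
  define T where "T = (\<lambda>x. Blinfun (\<lambda>u. Blinfun (\<lambda>v. \<theta> x u v)))"
  have T: "T x u v = \<theta> x u v" if x: "x \<in> R" for x u v
  proof -
    have lin: "\<theta> x a (b + c) = \<theta> x a b + \<theta> x a c" "\<theta> x (b + c) a = \<theta> x b a + \<theta> x c a"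
      "\<theta> x a (r *\<^sub>R b) = r * \<theta> x a b" "\<theta> x (r *\<^sub>R b) a = r * \<theta> x b a" for a b c r
      using alt[OF x] by (auto simp: alternating_2form_on_def linear_form_on_def)
    have "bounded_linear (\<lambda>v. \<theta> x u v)" for u
      unfolding linear_conv_bounded_linear[symmetric] by (rule linearI) (simp_all add: lin)
    then have 1: "Blinfun (\<lambda>v. \<theta> x u v) v = \<theta> x u v" for u v by (simp add: bounded_linear_Blinfun_apply)
    have "bounded_linear (\<lambda>u. Blinfun (\<lambda>v. \<theta> x u v))"
      unfolding linear_conv_bounded_linear[symmetric]
      by (rule linearI; rule blinfun_eqI) (simp_all add: 1 lin blinfun.add_left blinfun.scaleR_left)
    then show ?thesis by (simp add: T_def bounded_linear_Blinfun_apply 1)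
  qed
  have TCk: "Ck_on k R T" for k
  proof (intro Ck_on_blinfun_componentwise[OF R])
    show "Ck_on k R (\<lambda>x. T x u v)" for u v
      using Ck_on_cong[of R "\<lambda>x. T x u v" "\<lambda>x. \<theta> x u v" k, OF R T] smooth_on_imp_Ck_on[OF smooth[of u v], of k]
      by blast
  qed
  have hdT: "(T has_derivative fderiv T x) (at x)" if "x \<in> R" for x
    using Ck_on_SucD[OF TCk that] .
  have dT: "fderiv T x u v w = fderiv (\<lambda>y. \<theta> y v w) x u" if x: "x \<in> R" for x u v w
  proof -
    have "((\<lambda>y. T y v w) has_derivative (\<lambda>u. fderiv T x u v w)) (at x)"
      by (intro bounded_linear.has_derivative[OF blinfun.bounded_linear_left] hdT x)
    then have "((\<lambda>y. \<theta> y v w) has_derivative (\<lambda>u. fderiv T x u v w)) (at x)"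
      by (rule has_derivative_transform_within_open[OF _ R x]) (simp add: T)
    from frechet_derivative_eqI[OF this] show ?thesis by simp
  qed
  define D where "D = (\<lambda>z. Blinfun (fderiv \<kappa> z))"
  have hd\<kappa>: "(\<kappa> has_derivative fderiv \<kappa> z) (at z)" if "z \<in> S" for z
    by (rule smooth_onD[OF \<kappa> that])
  have D: "D z u = fderiv \<kappa> z u" if "z \<in> S" for z u
    unfolding D_def using has_derivative_bounded_linear[OF hd\<kappa>[OF that]] by (simp add: bounded_linear_Blinfun_apply)
  have DCk: "Ck_on k S D" for k
    unfolding D_def by (rule Ck_on_frechet_blinfun[OF S smooth_on_imp_Ck_on[OF \<kappa>]])
  note bil = bounded_bilinear_blinfun_compose
  \<comment> \<open>Precomposition of both slots with \<open>D z\<close>; \<open>prod_left\<close>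
    takes care of the second one. Using only compositions makes the regularity a matter of
    bilinearity.\<close>
  define Z where "Z = (\<lambda>z. (bounded_bilinear.prod_left (o\<^sub>L) (D z) o\<^sub>L T (\<kappa> z)) o\<^sub>L D z)"
  have Z: "Z z u v = T (\<kappa> z) (D z u) (D z v)" for z u v
    by (simp add: Z_def bounded_bilinear.prod_left.rep_eq[OF bil])
  have T\<kappa>: "Ck_on k S (\<lambda>z. T (\<kappa> z))" for k
    by (rule Ck_on_compose[OF S R _ smooth_on_imp_Ck_on[OF \<kappa>] TCk]) (use \<kappa>S in auto)
  have ZCk: "Ck_on k S Z" for k
    unfolding Z_def
    by (intro Ck_on_bilinear[OF S bil] DCk T\<kappa> Ck_on_bounded_linear[OF S bounded_bilinear.bounded_linear_prod_left[OF bil]])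
  show ?thesis
  proof (rule that[of Z])
    show "smooth_on S Z" using ZCk by (simp add: smooth_on_def)
    show "Z z u v = \<theta> (\<kappa> z) (fderiv \<kappa> z u) (fderiv \<kappa> z v)" if "z \<in> S" for z u v
      by (simp add: Z T[OF \<kappa>S[OF that]] D[OF that])
    have Talt: "T x u v = - T x v u" if "x \<in> R" for x u v
      unfolding T[OF that] by (rule alternating_2form_antisym[OF alt[OF that]])
    show "alternating_on S Z"
      unfolding alternating_on_def Z using Talt[OF \<kappa>S] by blast
    have dZ: "fderiv Z z u v w = fderiv T (\<kappa> z) (D z u) (D z v) (D z w)
        + T (\<kappa> z) (fderiv (\<lambda>y. fderiv \<kappa> y v) z u) (D z w)
        + T (\<kappa> z) (D z v) (fderiv (\<lambda>y. fderiv \<kappa> y w) z u)"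
      if z: "z \<in> S" for z u v w
    proof -
      have hD: "((\<lambda>y. D y v) has_derivative (\<lambda>u. fderiv (\<lambda>y. fderiv \<kappa> y v) z u)) (at z)" for v
        by (rule has_derivative_transform_within_open[OF smooth_onD[OF smooth_on_frechet_apply[OF \<kappa>] z] S z]) (simp add: D)
      have "((\<lambda>y. T (\<kappa> y)) has_derivative (\<lambda>u. fderiv T (\<kappa> z) (D z u))) (at z)"
        using has_derivative_compose[OF hd\<kappa>[OF z] hdT[OF \<kappa>S[OF z]]] by (simp add: D[OF z])
      from bounded_bilinear.FDERIV[OF bounded_bilinear_blinfun_apply
          bounded_bilinear.FDERIV[OF bounded_bilinear_blinfun_apply this hD[of v]] hD[of w]]
      have 1: "((\<lambda>y. Z y v w) has_derivative (\<lambda>u. T (\<kappa> z) (D z v) (fderiv (\<lambda>y. fderiv \<kappa> y w) z u)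
          + (T (\<kappa> z) (fderiv (\<lambda>y. fderiv \<kappa> y v) z u)
          + fderiv T (\<kappa> z) (D z u) (D z v)) (D z w))) (at z)"
        unfolding Z .
      have 2: "((\<lambda>y. Z y v w) has_derivative (\<lambda>u. fderiv Z z u v w)) (at z)"
        by (intro bounded_linear.has_derivative[OF blinfun.bounded_linear_left] Ck_on_SucD[OF ZCk z])
      from fun_cong[OF has_derivative_unique[OF 2 1], of u] show ?thesis by (simp add: blinfun.add_left)
    qed
    show "closed_on S Z"
      unfolding closed_on_def
    proof (intro ballI allI)
      fix z u v w assume z: "z \<in> S"
      let ?H = "\<lambda>v u. fderiv (\<lambda>y. fderiv \<kappa> y v) z u"
      have sym: "?H a b = ?H b a" for a b
        by (rule frechet_derivative_symmetric[OF S smooth_on_imp_Ck_on[OF \<kappa>] z])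
      have "fderiv T (\<kappa> z) a b c - fderiv T (\<kappa> z) b a c
          + fderiv T (\<kappa> z) c a b = 0" for a b c
        using closed[OF \<kappa>S[OF z], of a b c] by (simp add: ext_deriv2_def dT[OF \<kappa>S[OF z]])
      \<comment> \<open>The terms without second derivatives sum to zero by closedness of \<theta>;
        the other six cancel in pairs by \<open>sym\<close> and \<open>Talt\<close>.\<close>
      from this[of "D z u" "D z v" "D z w"]
      show "fderiv Z z u v w - fderiv Z z v u w + fderiv Z z w u v = 0"
        unfolding dZ[OF z] sym[of v u] sym[of w u] sym[of w v]
        using Talt[OF \<kappa>S[OF z], of "D z v" "?H u w"] Talt[OF \<kappa>S[OF z], of "D z u" "?H v w"]
          Talt[OF \<kappa>S[OF z], of "D z w" "?H u v"]
        by linarith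
    qed
  qed
qed

section \<open>Polysymplectic linear algebra\<close>

text \<open>Pairing with \<open>b (Inr (j, i))\<close> and with \<open>b (Inl i)\<close> under
  \<open>\<omega> j\<close> reads off \<open>\<alpha> i\<close> and \<open>- \<beta> i j\<close>.
  Hence \<open>\<alpha> i\<close> kills the kernel of each single form, and a vector in all kernels
  has only zero coefficients. Additivity is stated on \<open>S\<close> because
  \<open>representation\<close> is additive only on the span.\<close>

lemma polysymplectic_structure_dual:
  fixes \<omega> :: "'s::finite \<Rightarrow> 'v::real_vector \<Rightarrow> 'v \<Rightarrow> real"
  assumes "polysymplectic_structure TYPE('n::finite) S \<omega>"
  obtains \<alpha> :: "'n::finite \<Rightarrow> 'v \<Rightarrow> real" and \<beta> :: "'n \<Rightarrow> 's \<Rightarrow> 'v \<Rightarrow> real" where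
    "\<And>j u v. u \<in> S \<Longrightarrow> v \<in> S \<Longrightarrow> \<omega> j u v = (\<Sum>i\<in>UNIV. wedge (\<alpha> i) (\<beta> i j) u v)"
    "\<And>k i v. v \<in> perp_on S (\<omega> k) \<Longrightarrow> \<alpha> i v = 0"
    "\<And>w i. (\<forall>k. w k \<in> S) \<Longrightarrow> \<alpha> i (\<Sum>k\<in>(UNIV :: 's set). w k) = (\<Sum>k\<in>UNIV. \<alpha> i (w k))"
    "\<And>v. v \<in> S \<Longrightarrow> (\<And>j u. u \<in> S \<Longrightarrow> \<omega> j v u = 0) \<Longrightarrow> v = 0"
proof -
  obtain b :: "'n + 's \<times> 'n \<Rightarrow> 'v" where b: "inj b" "independent (range b)" "span (range b) = S"
    and \<omega>: "\<And>j u v. u \<in> S \<Longrightarrow> v \<in> S \<Longrightarrow> \<omega> j u v = (\<Sum>i\<in>UNIV. wedge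
      (\<lambda>u. representation (range b) u (b (Inl i))) (\<lambda>u. representation (range b) u (b (Inr (j, i)))) u v)"
    using assms by (auto simp: polysymplectic_structure_def Let_def)
  define \<alpha> where "\<alpha> = (\<lambda>i u. representation (range b) u (b (Inl i)))"
  define \<beta> where "\<beta> = (\<lambda>i j u. representation (range b) u (b (Inr (j, i))))"
  have \<omega>': "\<omega> j u v = (\<Sum>i\<in>UNIV. wedge (\<alpha> i) (\<beta> i j) u v)" if "u \<in> S" "v \<in> S" for j u v
    using \<omega>[OF that] by (simp add: \<alpha>_def \<beta>_def)
  have bS: "b a \<in> S" for a unfolding b(3)[symmetric] by (rule span_base[OF rangeI])
  have rep: "representation (range b) (b a) (b a') = (if a = a' then 1 else 0)" for a a'
    by (auto simp: representation_basis[OF b(2) rangeI] inj_eq[OF b(1)])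
  have z: "v = 0" if v: "v \<in> S" "\<And>i. \<alpha> i v = 0" "\<And>i j. \<beta> i j v = 0" for v
  proof -
    have "representation (range b) v (b a) = 0" for a
      using v(2,3) by (cases a) (auto simp: \<alpha>_def \<beta>_def)
    moreover have "representation (range b) v x \<noteq> 0 \<Longrightarrow> x \<in> range b" for x
      using representation_ne_zero by blast
    ultimately have "{x. representation (range b) v x \<noteq> 0} = {}" by auto
    then show ?thesis
      using sum_nonzero_representation_eq[OF b(2), of v] v(1) b(3) by simp
  qed
  have val: "\<omega> j v (b (Inr (j, i))) = \<alpha> i v" "\<omega> j v (b (Inl i)) = - \<beta> i j v" if "v \<in> S" for v j i
    by (simp_all add: \<omega>'[OF that bS] wedge_def, simp_all add: \<alpha>_def \<beta>_def rep sum_negf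
        if_distrib[of "\<lambda>x. _ * x"] if_distrib[of "\<lambda>x. x * _"] cong: if_cong)
  show ?thesis
  proof (rule that[of \<alpha> \<beta>])
    show "\<alpha> i v = 0" if "v \<in> perp_on S (\<omega> k)" for k i v
      using that val(1)[of v k i] bS by (auto simp: perp_on_def)
    show "\<alpha> i (\<Sum>k\<in>(UNIV :: 's set). w k) = (\<Sum>k\<in>UNIV. \<alpha> i (w k))" if "\<forall>k. w k \<in> S" for w i
      using representation_sum[OF b(2), of UNIV w] that b(3) by (simp add: \<alpha>_def)
    show "v = 0" if v: "v \<in> S" "\<And>j u. u \<in> S \<Longrightarrow> \<omega> j v u = 0" for v
    proof (rule z[OF v(1)])
      \<comment> \<open>Any one of the forms detects \<open>\<alpha> i\<close>, so the index is
        arbitrary.\<close>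
      show "\<alpha> i v = 0" for i using val(1)[OF v(1), of undefined i] v(2)[OF bS] by simp
      show "\<beta> i j v = 0" for i j using val(2)[OF v(1), of j i] v(2)[OF bS] by simp
    qed
  qed (rule \<omega>')
qed

text \<open>Each \<open>\<alpha> i\<close> vanishes on every summand and so on the sum, while each
  term of \<open>\<omega> j\<close> has a factor \<open>\<alpha> i\<close>. The dual basis comes
  from the structure at \<open>q\<close>, since given covectors exist only at
  \<open>p\<close>.\<close>

lemma perp_sum_isotropic:
  fixes \<omega> :: "'s::finite \<Rightarrow> ('a, 'e::euclidean_space) form2"
  assumes "polysymplectic_structure TYPE('n::finite) (tangent_space X q) (\<lambda>j. \<omega> j q)"
    and "u \<in> perp_sum X \<omega> q" "v \<in> perp_sum X \<omega> q" "u \<in> tangent_space X q" "v \<in> tangent_space X q"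
  shows "\<omega> j q u v = 0"
proof -
  obtain \<alpha> :: "'n \<Rightarrow> ('a, 'e) tvec \<Rightarrow> real" and \<beta> :: "'n \<Rightarrow> 's \<Rightarrow> ('a, 'e) tvec \<Rightarrow> real" where
    \<omega>: "\<And>j u v. u \<in> tangent_space X q \<Longrightarrow> v \<in> tangent_space X q \<Longrightarrow> \<omega> j q u v = (\<Sum>i\<in>UNIV. wedge (\<alpha> i) (\<beta> i j) u v)"
    and p: "\<And>k i v. v \<in> perp_on (tangent_space X q) (\<omega> k q) \<Longrightarrow> \<alpha> i v = 0"
    and s: "\<And>w i. (\<forall>k. w k \<in> tangent_space X q) \<Longrightarrow> \<alpha> i (\<Sum>k\<in>(UNIV :: 's set). w k) = (\<Sum>k\<in>UNIV. \<alpha> i (w k))"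
    by (rule polysymplectic_structure_dual[OF assms(1)], rule that) assumption+
  have "\<alpha> i x = 0" if "x \<in> perp_sum X \<omega> q" for i x
  proof -
    obtain w where w: "x = (\<Sum>k\<in>UNIV. w k)" "\<And>k. w k \<in> perp_on (tangent_space X q) (\<omega> k q)"
      using \<open>x \<in> perp_sum X \<omega> q\<close> by (auto simp: perp_sum_def)
    then have "\<forall>k. w k \<in> tangent_space X q" by (auto simp: perp_on_def)
    from s[OF this] show ?thesis using w(1) p[OF w(2)] by simp
  qed
  then show ?thesis using \<omega>[OF assms(4,5)] assms(2,3) by (simp add: wedge_def)
qed

lemma linear_injective_isomorphism_DIM:
  fixes f :: "'a::euclidean_space \<Rightarrow> 'b::euclidean_space"
  assumes "linear f" "\<And>u. f u = 0 \<Longrightarrow> u = 0" "DIM('a) = DIM('b)"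
  obtains g where "linear g" "\<And>u. g (f u) = u" "\<And>v. f (g v) = v"
proof -
  have inj: "inj f" using assms(1,2) by (simp add: linear_injective_0)
  then obtain g where g: "linear g" "g \<circ> f = id" using linear_injective_left_inverse[OF assms(1)] by blast
  have "dim (range f) = DIM('b)" using dim_image_eq[OF assms(1), of UNIV] inj assms(3) by simp
  then have "range f = UNIV" using dim_eq_full[of "range f"] span_eq_iff[of "range f"] linear_subspace_image[OF assms(1) subspace_UNIV] by simp
  then have "f (g v) = v" for v using g(2) by (metis comp_apply id_apply rangeE UNIV_I)
  then show ?thesis using that g by (metis comp_apply id_apply)
qed

lemma local_form_chart:
  assumes X: "smooth_manifold X" and k: "k \<in> charts_at X q"
  shows "local_form X \<omega> k (snd k q) u v = \<omega> q (tangent_of X q k u) (tangent_of X q k v)"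
  using chart_inv_left[OF X] k by (auto simp: local_form_def Let_def charts_at_def)

lemma alternating_local_form:
  assumes X: "smooth_manifold X" and k: "k \<in> charts_at X q"
    and \<omega>: "alternating_2form_on (tangent_space X q) (\<omega> q)"
  shows "alternating_2form_on UNIV (local_form X \<omega> k (snd k q))"
proof -
  note lin = linear_add[OF linear_tangent_of[OF X k]] linear_scale[OF linear_tangent_of[OF X k]]
  show ?thesis
    using \<omega> tangent_of_in_tangent_space[OF X k]
    unfolding alternating_2form_on_def linear_form_on_def local_form_chart[OF X k] by (simp add: lin)
qed

theorem theorem6p1:
  fixes X :: "('a, 'e::euclidean_space) manifold"
    and \<omega> :: "'s::finite \<Rightarrow> ('a, 'e) form2"
    and p :: 'a
    and \<phi> :: "'n::finite \<Rightarrow> ('a, 'e) tvec \<Rightarrow> real"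
    and \<psi> :: "'n \<Rightarrow> 's \<Rightarrow> ('a, 'e) tvec \<Rightarrow> real"
  assumes "polysymplectic_manifold TYPE('n) X \<omega>"
    and "p \<in> topspace (mspace X)"
    and "\<And>i. \<phi> i \<in> cotangent_space X p"
    and "\<And>i j. \<psi> i j \<in> cotangent_space X p"
    and "\<And>j u v. u \<in> tangent_space X p \<Longrightarrow> v \<in> tangent_space X p \<Longrightarrow>
           \<omega> j p u v = (\<Sum>i\<in>UNIV. wedge (\<phi> i) (\<psi> i j) u v)"
  shows "\<exists>(U :: 'a set) (V :: ('n, 's) model set) (F :: 'a \<Rightarrow> ('n, 's) model).
           p \<in> U \<and> 0 \<in> V \<and> F p = 0 \<and>
           polysymplectic_iso X U \<omega> euclidean_manifold V standard_form F \<and>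
           (\<forall>i. \<forall>v\<in>tangent_space X p. differential X (x_coord i \<circ> F) p v = \<phi> i v) \<and>
           (\<forall>i j. \<forall>v\<in>tangent_space X p. differential X (y_coord i j \<circ> F) p v = \<psi> i j v)"
proof -
  have X: "smooth_manifold X" and dim: "DIM('e) = CARD('n) * (CARD('s) + 1)"
    and sm: "\<And>j. smooth_2form X (\<omega> j)" and cl: "\<And>j. closed_2form X (\<omega> j)"
    and ps: "\<And>q. q \<in> topspace (mspace X) \<Longrightarrow> polysymplectic_structure TYPE('n) (tangent_space X q) (\<lambda>j. \<omega> j q)"
    and integ: "integrable_distribution X (perp_sum X \<omega>)"
    using assms(1) by (auto simp: polysymplectic_manifold_def)
  have "\<exists>U V F. \<exists>K\<subseteq>Basis. p \<in> U \<and> diffeo_between X U (euclidean_manifold :: ('e, 'e) manifold) V F \<and>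
      (\<forall>q\<in>U. perp_sum X \<omega> q = {v \<in> tangent_space X q. differential X F q v \<in> span K})"
    using integ assms(2) unfolding integrable_distribution_def by blast
  then obtain U0 V0 F0 K where p0: "p \<in> U0" and dif: "diffeo_between X U0 (euclidean_manifold :: ('e, 'e) manifold) V0 F0"
    and D: "\<And>q. q \<in> U0 \<Longrightarrow> perp_sum X \<omega> q = {v \<in> tangent_space X q. differential X F0 q v \<in> span K}"
    by blast
  note d = diffeo_between_euclideanD[OF dif]
  have U0top: "U0 \<subseteq> topspace (mspace X)" using d(1) openin_subset by blast
  obtain k where k: "k \<in> atlas X" "p \<in> fst k"
    using X assms(2) by (auto simp: smooth_manifold_def)
  have kc: "k \<in> charts_at X q" if "q \<in> fst k" for q using k(1) that by (simp add: charts_at_def)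
  note kp = kc[OF k(2)]
  define G0 where "G0 = inv_into U0 F0"
  define S where "S = snd k ` (fst k \<inter> U0)"
  define T where "T = {y \<in> V0. G0 y \<in> fst k}"
  define g0 where "g0 = F0 \<circ> chart_inv k"
  define \<gamma> where "\<gamma> = snd k \<circ> G0"
  have S: "open S" unfolding S_def by (rule open_chart_image[OF X k(1) d(1)])
  have T: "open T"
  proof -
    have "openin (top_of_set V0) {y \<in> topspace (top_of_set V0). G0 y \<in> fst k}"
      unfolding G0_def by (rule openin_continuous_map_preimage[OF d(6) chart_domain_open[OF X k(1)]])
    then show ?thesis using d(2) by (simp add: openin_open_eq T_def)
  qed
  have g0: "smooth_on S g0" unfolding S_def g0_def by (rule d(5)[OF k(1)])
  have \<gamma>: "smooth_on T \<gamma>" unfolding T_def G0_def \<gamma>_def by (rule d(7)[OF k(1)])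
  have U0V0: "F0 q \<in> V0" "G0 (F0 q) = q" if "q \<in> U0" for q
    using d(3) that by (auto simp: bij_betw_def G0_def)
  have V0U0: "G0 y \<in> U0" "F0 (G0 y) = y" if "y \<in> V0" for y
    using d(3) that by (auto simp: bij_betw_def G0_def inv_into_into f_inv_into_f)
  have fromU: "snd k q \<in> S" "F0 q \<in> T" "g0 (snd k q) = F0 q" "\<gamma> (F0 q) = snd k q" if "q \<in> fst k" "q \<in> U0" for q
    using that U0V0[OF that(2)] chart_inv_left[OF X k(1) that(1)] by (auto simp: S_def T_def g0_def \<gamma>_def)
  have fromT: "\<gamma> y \<in> S" "g0 (\<gamma> y) = y" "G0 y \<in> fst k" "G0 y \<in> U0" "snd k (G0 y) = \<gamma> y" if "y \<in> T" for y
    using that V0U0[of y] chart_inv_left[OF X k(1), of "G0 y"] by (auto simp: S_def T_def g0_def \<gamma>_def)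
  have fromS: "g0 x \<in> T" "\<gamma> (g0 x) = x" if x: "x \<in> S" for x
    using x fromU by (auto simp: S_def)
  let ?Dg = "\<lambda>x. fderiv g0 x" and ?D\<gamma> = "\<lambda>y. fderiv \<gamma> y"
  have g\<gamma>: "?Dg (\<gamma> y) (?D\<gamma> y c) = c" if y: "y \<in> T" for y c
  proof -
    have "((\<lambda>y. g0 (\<gamma> y)) has_derivative (\<lambda>c. ?Dg (\<gamma> y) (?D\<gamma> y c))) (at y)"
      by (rule has_derivative_compose[OF smooth_onD[OF \<gamma> y] smooth_onD[OF g0 fromT(1)[OF y]]])
    moreover have "((\<lambda>y. g0 (\<gamma> y)) has_derivative (\<lambda>c. c)) (at y)"
      by (rule has_derivative_transform_within_open[OF has_derivative_ident T y]) (simp add: fromT)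
    ultimately show ?thesis using has_derivative_unique by metis
  qed
  have \<gamma>g: "?D\<gamma> (g0 x) (?Dg x c) = c" if x: "x \<in> S" for x c
  proof -
    have "((\<lambda>x. \<gamma> (g0 x)) has_derivative (\<lambda>c. ?D\<gamma> (g0 x) (?Dg x c))) (at x)"
      by (rule has_derivative_compose[OF smooth_onD[OF g0 x] smooth_onD[OF \<gamma> fromS(1)[OF x]]])
    moreover have "((\<lambda>x. \<gamma> (g0 x)) has_derivative (\<lambda>c. c)) (at x)"
      by (rule has_derivative_transform_within_open[OF has_derivative_ident S x]) (simp add: fromS)
    ultimately show ?thesis using has_derivative_unique by metis
  qed
  have dF0: "differential X F0 q v = ?Dg (snd k q) (coord v k)"
    if "q \<in> fst k" "q \<in> U0" "v \<in> tangent_space X q" for q v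
    using differential_in_chart[OF X kc[OF that(1)] that(3)] smooth_onD[OF g0 fromU(1)[OF that(1,2)]]
    unfolding g0_def by blast

  define xp where "xp = snd k p"
  define y0 where "y0 = F0 p"
  have xp: "xp \<in> S" "g0 xp = y0" and y0: "y0 \<in> T" "\<gamma> y0 = xp"
    using fromU[OF k(2) p0] by (auto simp: xp_def y0_def)
  define L where "L = ?Dg xp"
  define M where "M = ?D\<gamma> y0"
  have M_L: "M (L c) = c" for c using \<gamma>g[OF xp(1)] by (simp add: M_def L_def xp(2))
  have L_M: "L (M c) = c" for c using g\<gamma>[OF y0(1)] by (simp add: M_def L_def y0(2))
  have linL: "linear L" unfolding L_def by (rule has_derivative_linear[OF smooth_onD[OF g0 xp(1)]])
  have linM: "linear M" unfolding M_def by (rule has_derivative_linear[OF smooth_onD[OF \<gamma> y0(1)]])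

  define \<tau> where "\<tau> = tangent_of X p k"
  have lin\<tau>: "linear \<tau>" unfolding \<tau>_def by (rule linear_tangent_of[OF X kp])
  have \<tau>T: "\<tau> c \<in> tangent_space X p" for c unfolding \<tau>_def by (rule tangent_of_in_tangent_space[OF X kp])
  have \<tau>coord: "\<tau> (coord v k) = v" if "v \<in> tangent_space X p" for v
    unfolding \<tau>_def by (rule tangent_of_coord[OF kp that])
  have coord\<tau>: "coord (\<tau> c) k = c" for c unfolding \<tau>_def by (rule coord_tangent_of_self[OF X kp])
  \<comment> \<open>The prescribed covectors, read in the chart \<open>k\<close> and collected into
    one linear map: the derivative that the final coordinates must have at \<open>p\<close>.\<close>
  define \<theta> where "\<theta> = (\<lambda>c. ((\<chi> i. \<phi> i (\<tau> c)), (\<chi> j i. \<psi> i j (\<tau> c))) :: ('n, 's) model)"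
  have \<theta>: "fst (\<theta> c) $ i = \<phi> i (\<tau> c)" "snd (\<theta> c) $ j $ i = \<psi> i j (\<tau> c)" for c i j by (simp_all add: \<theta>_def)
  have \<phi>lin: "\<phi> i (u + v) = \<phi> i u + \<phi> i v" "\<phi> i (r *\<^sub>R u) = r * \<phi> i u"
    and \<psi>lin: "\<psi> i j (u + v) = \<psi> i j u + \<psi> i j v" "\<psi> i j (r *\<^sub>R u) = r * \<psi> i j u"
    if "u \<in> tangent_space X p" "v \<in> tangent_space X p" for u v i j r
    using assms(3)[of i] assms(4)[of i j] that by (auto simp: cotangent_space_def linear_form_on_def)
  have lin\<theta>: "linear \<theta>"
    by (rule linearI; rule model_eqI)
       (simp_all add: \<theta> linear_add[OF lin\<tau>] linear_scale[OF lin\<tau>] \<phi>lin[OF \<tau>T \<tau>T] \<psi>lin[OF \<tau>T \<tau>T])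
  \<comment> \<open>A vector killed by all \<open>\<phi> i\<close> and \<open>\<psi> i j\<close>
    lies in the kernel of every \<open>\<omega> j p\<close>, hence is zero. With the dimension
    count, the given covectors form a basis of the cotangent space.\<close>
  have inj\<theta>: "c = 0" if "\<theta> c = 0" for c
  proof -
    have "\<phi> i (\<tau> c) = 0" "\<psi> i j (\<tau> c) = 0" for i j using that
      by (simp_all add: \<theta>(1)[symmetric] \<theta>(2)[symmetric])
    then have "\<omega> j p (\<tau> c) u = 0" if "u \<in> tangent_space X p" for j u
      using assms(5)[OF \<tau>T that] by (simp add: wedge_def)
    then have "\<tau> c = 0"
      using polysymplectic_structure_dual[OF ps[OF assms(2)]] \<tau>T by metis
    then show ?thesis using coord\<tau>[of c] by simp
  qed
  have "DIM('e) = DIM(('n, 's) model)" using dim by (simp add: algebra_simps)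
  then obtain \<theta>i where lin\<theta>i: "linear \<theta>i" and \<theta>i: "\<And>c. \<theta>i (\<theta> c) = c" "\<And>z. \<theta> (\<theta>i z) = z"
    using linear_injective_isomorphism_DIM[OF lin\<theta> inj\<theta>] by metis

  \<comment> \<open>\<open>a \<circ> F0\<close> sends \<open>p\<close> to 0 with derivative \<theta>
    in the chart, because \<open>M\<close> inverts the derivative \<open>L\<close> of
    \<open>F0\<close>. Being affine, \<open>a\<close> keeps the straightened distribution spanned by
    constant vectors.\<close>
  define a where "a = (\<lambda>y. \<theta> (M (y - y0)))"
  define b where "b = (\<lambda>z. y0 + L (\<theta>i z))"
  have ab: "a (b z) = z" for z by (simp add: a_def b_def M_L \<theta>i)
  have ba: "b (a y) = y" for y by (simp add: a_def b_def L_M \<theta>i)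
  have bl: "bounded_linear (\<lambda>y. \<theta> (M y))" "bounded_linear (\<lambda>z. L (\<theta>i z))"
    unfolding linear_conv_bounded_linear[symmetric]
    using linear_compose[OF linM lin\<theta>] linear_compose[OF lin\<theta>i linL] by (simp_all add: o_def)
  have hda: "(a has_derivative (\<lambda>c. \<theta> (M c))) (at y)" for y
    unfolding a_def using bounded_linear.has_derivative[OF bl(1) has_derivative_diff[OF has_derivative_ident has_derivative_const]] by simp
  have hdb: "(b has_derivative (\<lambda>c. L (\<theta>i c))) (at z)" for z
    unfolding b_def using has_derivative_add[OF has_derivative_const bounded_linear_imp_has_derivative[OF bl(2)]] by simp
  have aCk: "Ck_on n R a" if "open R" for n R
    unfolding a_def by (intro Ck_on_bounded_linear[OF that bl(1)] Ck_on_diff that Ck_on_const Ck_on_linear bounded_linear_ident)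
  have bCk: "Ck_on n R b" if "open R" for n R
    unfolding b_def by (intro Ck_on_add that Ck_on_const Ck_on_linear bl(2))
  have acont: "continuous_on UNIV a" and bcont: "continuous_on UNIV b"
    using Ck_on_imp_continuous_on aCk bCk open_UNIV by blast+
  have b0: "b 0 = y0" by (simp add: b_def linear_0[OF lin\<theta>i] linear_0[OF linL])
  have a0: "a y0 = 0" by (simp add: a_def linear_0[OF lin\<theta>] linear_0[OF linM])
  have "open (b -` T)" using bcont T open_vimage by blast
  moreover have "0 \<in> b -` T" using b0 y0 by simp
  ultimately obtain r where r: "r > 0" "ball 0 r \<subseteq> b -` T" using open_contains_ball by blast
  let ?B = "ball (0 :: ('n, 's) model) r"
  have bT: "b z \<in> T" if "z \<in> ?B" for z using r(2) that by blast
  \<comment> \<open>From the adapted coordinates back to the chart \<open>k\<close>; the forms are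
    pulled back along it to a ball in the model space.\<close>
  define \<kappa> where "\<kappa> = (\<lambda>z. \<gamma> (b z))"
  have \<kappa>: "smooth_on ?B \<kappa>"
    unfolding smooth_on_def \<kappa>_def
    by (intro allI Ck_on_compose[OF open_ball T _ bCk smooth_on_imp_Ck_on[OF \<gamma>]]) (use bT in auto)
  have \<kappa>S: "\<kappa> z \<in> S" if "z \<in> ?B" for z unfolding \<kappa>_def by (rule fromT(1)[OF bT[OF that]])
  have SR: "S \<subseteq> chart_range k" by (auto simp: S_def chart_range_def)
  have D\<kappa>: "fderiv \<kappa> z c = ?D\<gamma> (b z) (L (\<theta>i c))" if "z \<in> ?B" for z c
    unfolding \<kappa>_def by (rule frechet_derivative_eqI[OF has_derivative_compose[OF hdb smooth_onD[OF \<gamma> bT[OF that]]]])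

  have "\<exists>Z. smooth_on ?B Z \<and> alternating_on ?B Z \<and> closed_on ?B Z \<and>
    (\<forall>z\<in>?B. \<forall>u v. blinfun_apply (blinfun_apply (Z z) u) v = local_form X (\<omega> j) k (\<kappa> z) (fderiv \<kappa> z u) (fderiv \<kappa> z v))" for j
  proof -
    have alt: "alternating_2form_on UNIV (local_form X (\<omega> j) k x)" if x: "x \<in> chart_range k" for x
    proof -
      obtain q where q: "q \<in> fst k" "x = snd k q" using x by (auto simp: chart_range_def)
      have "q \<in> topspace (mspace X)" using chart_domain_open[OF X k(1)] openin_subset q(1) by blast
      then have "alternating_2form_on (tangent_space X q) (\<omega> j q)" using sm by (simp add: smooth_2form_def)
      from alternating_local_form[where \<omega> = "\<omega> j", OF X kc[OF q(1)] this] show ?thesis using q(2) by simp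
    qed
    have smo: "smooth_on (chart_range k) (\<lambda>x. local_form X (\<omega> j) k x u v)" for u v
      using sm k(1) by (simp add: smooth_2form_def)
    have clo: "ext_deriv2 (local_form X (\<omega> j) k) x u v w = 0" if "x \<in> chart_range k" for x u v w
      using cl k(1) that by (simp add: closed_2form_def)
    have \<kappa>R: "\<kappa> z \<in> chart_range k" if "z \<in> ?B" for z using \<kappa>S[OF that] SR by blast
    show ?thesis
      by (rule pullback_form[OF open_chart_range[OF X k(1)] open_ball \<kappa> \<kappa>R alt smo clo]) blast+
  qed
  then obtain Z where Z: "\<And>j. smooth_on ?B (Z j)" "\<And>j. alternating_on ?B (Z j)" "\<And>j. closed_on ?B (Z j)"
    and Zapp: "\<And>j z u v. z \<in> ?B \<Longrightarrow> blinfun_apply (blinfun_apply (Z j z) u) v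
      = local_form X (\<omega> j) k (\<kappa> z) (fderiv \<kappa> z u) (fderiv \<kappa> z v)"
    by metis
  have 0: "0 \<in> ?B" using r(1) by simp
  have \<kappa>0: "\<kappa> 0 = snd k p" by (simp add: \<kappa>_def b0 y0(2) xp_def)
  have D\<kappa>0: "fderiv \<kappa> 0 c = \<theta>i c" for c
    by (simp add: D\<kappa>[OF 0] b0 flip: M_def) (simp add: M_L)
  have Z0: "Z j 0 u v = std_form j u v" for j u v
    unfolding Zapp[OF 0] \<kappa>0 D\<kappa>0 local_form_chart[OF X kp] \<tau>_def[symmetric] assms(5)[OF \<tau>T \<tau>T] std_form_def
    by (simp add: wedge_def \<theta>(1)[symmetric] \<theta>(2)[symmetric] \<theta>i)
  have iso: "Z j z (0, c) (0, c') = 0" if s: "CARD('s) \<noteq> 1" and z: "z \<in> ?B" for j z c c'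
  proof -
    let ?q = "G0 (b z)"
    note q = fromT(3-5)[OF bT[OF z]]
    have mem: "tangent_of X ?q k (fderiv \<kappa> z (0, c)) \<in> perp_sum X \<omega> ?q" for c
    proof -
      let ?t = "tangent_of X ?q k (fderiv \<kappa> z (0, c))"
      have tT: "?t \<in> tangent_space X ?q" by (rule tangent_of_in_tangent_space[OF X kc[OF q(1)]])
      have "coord ?t k = ?D\<gamma> (b z) (L (\<theta>i (0, c)))"
        unfolding coord_tangent_of_self[OF X kc[OF q(1)]] by (rule D\<kappa>[OF z])
      then have "differential X F0 ?q ?t = L (\<theta>i (0, c))"
        using dF0[OF q(1,2) tT] g\<gamma>[OF bT[OF z]] by (simp only: q(3))
      \<comment> \<open>This image does not depend on \<open>z\<close>, and neither does
        \<open>span K\<close>. Membership is therefore decided at \<open>p\<close>, where the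
        kernels are known from the given covectors.\<close>
      moreover have "L (\<theta>i (0, c)) \<in> span K"
      proof -
        obtain m1 m2 :: 's where m: "m1 \<noteq> m2"
        proof -
          have "\<exists>m2. m2 \<noteq> m1" for m1 :: 's
          proof (rule ccontr)
            assume "\<nexists>m2. m2 \<noteq> m1"
            then have "UNIV = {m1}" by blast
            then have "CARD('s) = card {m1}" by (rule arg_cong)
            with s show False by simp
          qed
          then show ?thesis using that by metis
        qed
        \<comment> \<open>A y-vector lies in the kernel of \<open>\<omega> m p\<close> once its
          block \<open>m\<close> is zero. \<open>c1\<close> has block \<open>m1\<close> emptied;
          \<open>c2\<close> has only block \<open>m1\<close>, so the kernel for the different index
          \<open>m2\<close> contains it. This is where two forms enter.\<close>
        define c1 where "c1 = (\<chi> j. if j = m1 then 0 else c $ j)"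
        define c2 where "c2 = (\<chi> j. if j = m1 then c $ j else 0)"
        define w where "w = (\<lambda>m. (if m = m1 then \<tau> (\<theta>i (0, c1)) else 0) + (if m = m2 then \<tau> (\<theta>i (0, c2)) else 0))"
        have val: "\<phi> i (\<tau> (\<theta>i (0, e))) = 0" "\<psi> i j (\<tau> (\<theta>i (0, e))) = e $ j $ i" for i j e
          by (simp_all add: \<theta>(1)[symmetric] \<theta>(2)[symmetric] \<theta>i)
        have perp: "\<tau> (\<theta>i (0, e)) \<in> perp_on (tangent_space X p) (\<omega> m p)" if "e $ m = 0" for e m
          unfolding perp_on_def using \<tau>T assms(5)[OF \<tau>T] by (simp add: wedge_def val that)
        have "w m \<in> perp_on (tangent_space X p) (\<omega> m p)" for m
        proof -
          have "\<tau> (\<theta>i (0, 0)) = 0" by (simp add: linear_0[OF lin\<theta>i] linear_0[OF lin\<tau>] flip: zero_prod_def)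
          then have "0 \<in> perp_on (tangent_space X p) (\<omega> m p)" using perp[of 0 m] by simp
          then show ?thesis using perp[of c1 m] perp[of c2 m] m by (auto simp: w_def c1_def c2_def)
        qed
        then have "(\<Sum>m\<in>UNIV. w m) \<in> perp_sum X \<omega> p" unfolding perp_sum_def by blast
        moreover have "(\<Sum>m\<in>UNIV. w m) = \<tau> (\<theta>i (0, c))"
        proof -
          have "c1 + c2 = c" by (simp add: c1_def c2_def vec_eq_iff)
          then have "(0, c) = (0, c1) + (0 :: real ^ 'n, c2)" by simp
          then have "\<tau> (\<theta>i (0, c)) = \<tau> (\<theta>i (0, c1)) + \<tau> (\<theta>i (0, c2))"
            by (metis linear_add[OF lin\<theta>i] linear_add[OF lin\<tau>])
          then show ?thesis by (simp add: w_def sum.distrib)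
        qed
        ultimately have "differential X F0 p (\<tau> (\<theta>i (0, c))) \<in> span K" using D[OF p0] by auto
        then show ?thesis unfolding dF0[OF k(2) p0 \<tau>T] coord\<tau> by (simp add: L_def xp_def)
      qed
      ultimately show ?thesis using D[OF q(2)] tT by simp
    qed
    have "?q \<in> topspace (mspace X)" using q(2) U0top by blast
    from perp_sum_isotropic[OF ps[OF this] mem mem] tangent_of_in_tangent_space[OF X kc[OF q(1)]]
    show ?thesis
      unfolding Zapp[OF z] \<kappa>_def[of] q(3)[symmetric] local_form_chart[OF X kc[OF q(1)]] by blast
  qed
  obtain H H' U1 V1 where U1: "open U1" "open V1" "0 \<in> U1" "U1 \<subseteq> ?B" "homeomorphism U1 V1 H H'"
    "smooth_on U1 H" "smooth_on V1 H'" "H 0 = 0" "\<And>v. fderiv H 0 v = v"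
    "\<And>j y u v. y \<in> U1 \<Longrightarrow> std_form j (fderiv H y u) (fderiv H y v) = Z j y u v"
    by (rule local_polysymplectic_darboux[OF r(1) Z Z0 iso]) (assumption | rule that; assumption)+
  define W where "W = a -` U1"
  have W: "open W" unfolding W_def using acont U1(1) open_vimage by blast
  have WT: "W \<subseteq> T" using bT U1(4) ba by (metis W_def subsetD subsetI vimageD)
  have WV: "W \<subseteq> V0" using WT by (auto simp: T_def)
  let ?h = "\<lambda>y. H (a y)" and ?h' = "\<lambda>z. b (H' z)"
  have h: "smooth_on W ?h"
    unfolding smooth_on_def
    by (intro allI Ck_on_compose[OF W U1(1) _ aCk[OF W] smooth_on_imp_Ck_on[OF U1(6)]]) (auto simp: W_def)
  have h': "smooth_on V1 ?h'"
    unfolding smooth_on_def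
    by (intro allI Ck_on_compose[OF U1(2) open_UNIV _ smooth_on_imp_Ck_on[OF U1(7)] bCk]) auto
  have hom: "homeomorphism W V1 ?h ?h'"
  proof (rule homeomorphismI)
    show "continuous_on W ?h" using Ck_on_imp_continuous_on[OF smooth_on_imp_Ck_on[OF h]] .
    show "continuous_on V1 ?h'" using Ck_on_imp_continuous_on[OF smooth_on_imp_Ck_on[OF h']] .
  qed (use U1(5) in \<open>auto simp: W_def homeomorphism_def ab ba\<close>)
  define F where "F = ?h \<circ> F0"
  define U where "U = {q \<in> U0. F0 q \<in> W}"
  have diffF: "diffeo_between X U euclidean_manifold V1 F"
    unfolding U_def F_def by (rule diffeo_between_compose[OF X dif W WV U1(2) hom h h'])
  have qU: "q \<in> fst k" "q \<in> U0" "a (F0 q) \<in> U1" if "q \<in> U" for q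
    using that WT U0V0(2)[of q] by (auto simp: U_def W_def T_def)
  have hdF: "(F \<circ> chart_inv k has_derivative (\<lambda>c. fderiv H (a (F0 q)) (\<theta> (M (?Dg (snd k q) c))))) (at (snd k q))"
    if q: "q \<in> U" for q
  proof -
    note f = fromU[OF qU(1,2)[OF q]]
    have "((\<lambda>x. H (a (g0 x))) has_derivative (\<lambda>c. fderiv H (a (g0 (snd k q))) (\<theta> (M (?Dg (snd k q) c))))) (at (snd k q))"
      by (rule has_derivative_compose[OF has_derivative_compose[OF smooth_onD[OF g0 f(1)] hda] smooth_onD[OF U1(6)]])
         (use qU(3)[OF q] f(3) in simp)
    then show ?thesis by (simp add: F_def g0_def o_def f(3)[unfolded g0_def o_def])
  qed
  have dF: "differential X F q v = fderiv H (a (F0 q)) (\<theta> (M (?Dg (snd k q) (coord v k))))"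
    if "q \<in> U" "v \<in> tangent_space X q" for q v
    by (rule differential_in_chart[OF X kc[OF qU(1)[OF that(1)]] that(2) hdF[OF that(1)]])
  have pull: "\<omega> j q u v = standard_form j (F q) (tangent_map X euclidean_manifold F q u) (tangent_map X euclidean_manifold F q v)"
    if q: "q \<in> U" and u: "u \<in> tangent_space X q" and v: "v \<in> tangent_space X q" for j q u v
  proof -
    let ?z = "a (F0 q)"
    note f = fromU[OF qU(1,2)[OF q]]
    have zB: "?z \<in> ?B" using qU(3)[OF q] U1(4) by blast
    \<comment> \<open>\<kappa> inverts \<open>a \<circ> g0\<close>, so its derivative undoes the
      passage to adapted coordinates.\<close>
    have c: "fderiv \<kappa> ?z (\<theta> (M (?Dg (snd k q) c))) = c" for c
      unfolding D\<kappa>[OF zB] ba \<theta>i L_M using \<gamma>g[OF f(1), of c] by (simp add: f(3))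
    have "\<omega> j q u v = local_form X (\<omega> j) k (snd k q) (coord u k) (coord v k)"
      unfolding local_form_chart[OF X kc[OF qU(1)[OF q]]]
        tangent_of_coord[OF kc[OF qU(1)[OF q]] u] tangent_of_coord[OF kc[OF qU(1)[OF q]] v] ..
    also have "\<dots> = Z j ?z (\<theta> (M (?Dg (snd k q) (coord u k)))) (\<theta> (M (?Dg (snd k q) (coord v k))))"
      unfolding Zapp[OF zB] c by (simp add: \<kappa>_def ba f(4))
    also have "\<dots> = std_form j (differential X F q u) (differential X F q v)"
      unfolding dF[OF q u] dF[OF q v] U1(10)[OF qU(3)[OF q]] ..
    finally show ?thesis unfolding standard_form_tangent_map .
  qed
  have pU: "p \<in> U" using p0 a0 U1(3) by (simp add: U_def W_def flip: y0_def)
  \<comment> \<open>\<open>H\<close> has derivative the identity at \<open>a (F0 p) = 0\<close>, and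
    \<open>M\<close> cancels \<open>L\<close>; what remains is \<theta>, whose components are the
    prescribed covectors.\<close>
  have hdFp: "(F \<circ> chart_inv k has_derivative \<theta>) (at (snd k p))"
    using hdF[OF pU] by (simp add: M_L U1(9) a0 flip: y0_def xp_def L_def)
  have Vp: "0 \<in> V1" using U1(3,5,8) by (metis homeomorphism_def imageI)
  have Fp: "F p = 0" by (simp add: F_def a0 U1(8) flip: y0_def)
  have bx: "bounded_linear (x_coord i :: ('n, 's) model \<Rightarrow> real)" "bounded_linear (y_coord i j :: ('n, 's) model \<Rightarrow> real)" for i j
    unfolding x_coord_def y_coord_def
    by (intro bounded_linear_compose[OF bounded_linear_vec_nth] bounded_linear_fst bounded_linear_snd)+
  have dx: "differential X (x_coord i \<circ> F) p v = \<phi> i v" if v: "v \<in> tangent_space X p" for i v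
  proof -
    have "((x_coord i \<circ> F) \<circ> chart_inv k has_derivative (\<lambda>c. x_coord i (\<theta> c))) (at (snd k p))"
      using bounded_linear.has_derivative[OF bx(1) hdFp] by (simp add: o_def)
    from differential_in_chart[OF X kp v this] show ?thesis by (simp add: x_coord_def \<theta> \<tau>coord[OF v])
  qed
  have dy: "differential X (y_coord i j \<circ> F) p v = \<psi> i j v" if v: "v \<in> tangent_space X p" for i j v
  proof -
    have "((y_coord i j \<circ> F) \<circ> chart_inv k has_derivative (\<lambda>c. y_coord i j (\<theta> c))) (at (snd k p))"
      using bounded_linear.has_derivative[OF bx(2) hdFp] by (simp add: o_def)
    from differential_in_chart[OF X kp v this] show ?thesis by (simp add: y_coord_def \<theta> \<tau>coord[OF v])
  qed
  have "polysymplectic_iso X U \<omega> euclidean_manifold V1 standard_form F"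
    unfolding polysymplectic_iso_def using diffF pull by blast
  then show ?thesis
    by (intro exI[of _ U] exI[of _ V1] exI[of _ F] conjI allI ballI pU Vp Fp dx dy) assumption+
qed

end
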